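(* Let $(u_i)_{i\ge0}$ be given by $u_0=0$, $u_{i+1}=u_i^2+i+1$, and $N_i=u_i^2-u_i+i$. Fix $k\ge1$ and, for $0\le L\le k$, let $H^{[L]}_k(z,u)$ be the bivariate generating function of closed lambda-terms with at most $k$ De Bruijn levels where $z$ marks the size and $u$ marks the number of leaves at De Bruijn level $L$; let $\tilde\rho_k(u)$ be its dominant singularity for $u$ near $1$ and $\tilde B(u)=\frac{\tilde\rho_k(1)}{\tilde\rho_k(u)}$. Consider a uniformly random closed lambda-term of size $n$ with at most $k$ De Bruijn levels, $n\to\infty$. (1) If $N_j<k<N_{j+1}$ for some $j\ge0$, then the expected number of leaves at each of the levels $0,1,\dots,k-j-1$ is $O(1)$, while it is $\Theta(n)$ at each of the levels $k-j,\dots,k$. Moreover, for each level $L\in\{k-j,\dots,k\}$, if $\tilde B''(1)+\tilde B'(1)-\tilde B'(1)^2\ne0$ (with $\tilde B$ built from $H^{[L]}_k$), the number of leaves at level $L$ is asymptotically normally distributed with mean and variance proportional to $n$. (2) If $k=N_j$, then the expected number of leaves at each of the levels $0,\dots,k-j-1$ is $O(1)$, the expected number of leaves at level $k-j$ is $\Theta(\sqrt n)$, and the expected number of leaves at each of the levels $k-j+1,\dots,k$ is $\Theta(n)$. Moreover, for each level $L\in\{k-j+1,\dots,k\}$, if $\tilde B''(1)+\tilde B'(1)-\tilde B'(1)^2\ne0$ (with $\tilde B$ built from $H^{[L]}_k$), the number of leaves at level $L$ is asymptotically normally distributed with mean and variance proportional to $n$.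
   Context: Lambda-terms are considered modulo $\alpha$-equivalence and represented by their skeleton, a rooted plane unary-binary tree (leaves = variables, unary nodes = abstractions, binary nodes = applications); size = total number of nodes. The De Bruijn level of a node is the number of unary nodes strictly above it on the path from the root (root at level $0$). A closed lambda-term has at most $k$ De Bruijn levels if every node has level at most $k$; such terms correspond bijectively to rooted plane unary-binary trees with all levels $\le k$ in which each leaf at level $L$ (necessarily $L\ge1$) carries a label in $\{1,\dots,L\}$.
   Formalization: In (2) the Θ(√n) claim is made only for k−j≥1 (for k=1, level 0 has no leaves), and normality also assumes that B̃'(1) and B̃''(1) exist; for k=N_j, B̃''(1) is shown never to exist, so the normality clause of (2) is empty. *)

theory Defs
  imports "HOL-Probability.Probability"
begin

text \<open>
  Skeletons with labelled leaves. Terms modulo alpha-equivalence are represented without bound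
  names: the label of a leaf is its De Bruijn index, so a leaf at level \<open>l\<close> is bound iff its label
  lies in \<open>{1..l}\<close>.
\<close>

datatype lterm = Var nat | Abs lterm | App lterm lterm

primrec term_size :: "lterm \<Rightarrow> nat" where
  "term_size (Var i) = 1"
| "term_size (Abs t) = 1 + term_size t"
| "term_size (App s t) = 1 + term_size s + term_size t"

text \<open>In the next three functions \<open>l\<close> is the De Bruijn level of the root of the given (sub)term.\<close>

primrec node_levels :: "nat \<Rightarrow> lterm \<Rightarrow> nat set" where
  "node_levels l (Var i) = {l}"
| "node_levels l (Abs t) = insert l (node_levels (Suc l) t)"
| "node_levels l (App s t) = insert l (node_levels l s \<union> node_levels l t)"

primrec closed_at :: "nat \<Rightarrow> lterm \<Rightarrow> bool" where
  "closed_at l (Var i) \<longleftrightarrow> 1 \<le> i \<and> i \<le> l"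
| "closed_at l (Abs t) \<longleftrightarrow> closed_at (Suc l) t"
| "closed_at l (App s t) \<longleftrightarrow> closed_at l s \<and> closed_at l t"

primrec leaves_at_from :: "nat \<Rightarrow> nat \<Rightarrow> lterm \<Rightarrow> nat" where
  "leaves_at_from L l (Var i) = (if l = L then 1 else 0)"
| "leaves_at_from L l (Abs t) = leaves_at_from L (Suc l) t"
| "leaves_at_from L l (App s t) = leaves_at_from L l s + leaves_at_from L l t"

definition leaves_at :: "nat \<Rightarrow> lterm \<Rightarrow> nat" where
  "leaves_at L t = leaves_at_from L 0 t"

definition closed_terms :: "nat \<Rightarrow> lterm set" where
  "closed_terms k = {t. closed_at 0 t \<and> (\<forall>l \<in> node_levels 0 t. l \<le> k)}"

definition closed_terms_of_size :: "nat \<Rightarrow> nat \<Rightarrow> lterm set" where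
  "closed_terms_of_size k n = {t \<in> closed_terms k. term_size t = n}"

lemma finite_closed_at: "finite {t. closed_at l t \<and> term_size t = n}"
proof (induction n arbitrary: l rule: less_induct)
  case (less n)
  let ?S = "\<lambda>l m. {t. closed_at l t \<and> term_size t = m}"
  let ?U = "\<Union>m<n. ?S l m"
  let ?B = "Var ` {1..l} \<union> Abs ` (\<Union>m<n. ?S (Suc l) m) \<union> case_prod App ` (?U \<times> ?U)"
  have "?S l n \<subseteq> ?B"
  proof
    fix t assume t: "t \<in> ?S l n"
    show "t \<in> ?B"
      using t by (cases t) auto
  qed
  moreover have "finite ?B"
    using less.IH by (intro finite_UnI finite_imageI finite_UN_I finite_cartesian_product) auto
  ultimately show ?case
    by (rule finite_subset)
qed

lemma finite_closed_terms_of_size: "finite (closed_terms_of_size k n)"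
  by (rule finite_subset[OF _ finite_closed_at[of 0 n]])
     (auto simp: closed_terms_of_size_def closed_terms_def)

text \<open>
  The set of terms is empty for some small \<open>n\<close> (e.g. \<open>n = 1\<close>), where \<open>pmf_of_set\<close> is unspecified;
  only the behaviour for \<open>n\<close> tending to infinity is used.
\<close>

definition random_term :: "nat \<Rightarrow> nat \<Rightarrow> lterm pmf" where
  "random_term k n = pmf_of_set (closed_terms_of_size k n)"

definition mean_leaves :: "nat \<Rightarrow> nat \<Rightarrow> nat \<Rightarrow> real" where
  "mean_leaves k L n = measure_pmf.expectation (random_term k n) (\<lambda>t. real (leaves_at L t))"

definition var_leaves :: "nat \<Rightarrow> nat \<Rightarrow> nat \<Rightarrow> real" where
  "var_leaves k L n = measure_pmf.variance (random_term k n) (\<lambda>t. real (leaves_at L t))"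

definition leaves_asymp_normal :: "nat \<Rightarrow> nat \<Rightarrow> bool" where
  "leaves_asymp_normal k L \<longleftrightarrow>
     weak_conv_m
       (\<lambda>n. distr (measure_pmf (random_term k n)) borel
              (\<lambda>t. (real (leaves_at L t) - mean_leaves k L n) / sqrt (var_leaves k L n)))
       std_normal_distribution"

definition proportional_to_n :: "(nat \<Rightarrow> real) \<Rightarrow> bool" where
  "proportional_to_n f \<longleftrightarrow> (\<exists>c>0. f \<sim>[at_top] (\<lambda>n. c * real n))"

definition H_gf :: "nat \<Rightarrow> nat \<Rightarrow> complex \<Rightarrow> complex fps" where
  "H_gf k L u = Abs_fps (\<lambda>n. \<Sum>t\<in>closed_terms_of_size k n. u ^ leaves_at L t)"

definition is_singularity_on_circle :: "complex fps \<Rightarrow> complex \<Rightarrow> bool" where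
  "is_singularity_on_circle F s \<longleftrightarrow>
     ereal (norm s) = fps_conv_radius F \<and>
     \<not> (\<exists>e>0. \<exists>g. g holomorphic_on ball s e \<and>
          (\<forall>z \<in> ball s e \<inter> eball 0 (fps_conv_radius F). g z = eval_fps F z))"

text \<open>
  A dominant singularity is a singularity of least modulus, i.e. one on the circle of convergence.
  It is taken for real \<open>u\<close> (near 1), where the series has nonnegative coefficients; there may be
  several on the circle (for \<open>k = 1\<close>), and as usual the positive real one is meant.
\<close>

definition rho_tilde :: "nat \<Rightarrow> nat \<Rightarrow> real \<Rightarrow> real" where
  "rho_tilde k L u =
     (THE r. 0 < r \<and> is_singularity_on_circle (H_gf k L (of_real u)) (of_real r))"

definition B_tilde :: "nat \<Rightarrow> nat \<Rightarrow> real \<Rightarrow> real" where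
  "B_tilde k L u = rho_tilde k L 1 / rho_tilde k L u"

text \<open>
  \<open>deriv\<close> is a total function with unspecified values at points of non-differentiability. The
  following says that \<open>f'(a)\<close> and \<open>f''(a)\<close> exist.
\<close>

definition twice_differentiable_at :: "(real \<Rightarrow> real) \<Rightarrow> real \<Rightarrow> bool" where
  "twice_differentiable_at f a \<longleftrightarrow>
     (\<forall>\<^sub>F x in nhds a. f differentiable (at x)) \<and> deriv f differentiable (at a)"

fun u_seq :: "nat \<Rightarrow> nat" where
  "u_seq 0 = 0"
| "u_seq (Suc i) = (u_seq i)\<^sup>2 + i + 1"

text \<open>
  The subtraction does not truncate, since \<open>x \<le> x\<^sup>2\<close> on the naturals. Moreover \<open>j \<le> N_seq j\<close>, so
  \<open>k - j\<close> does not truncate when \<open>N_seq j \<le> k\<close>. It is 0 when \<open>k = N_seq j\<close> only for \<open>j \<le> 1\<close>, i.e. for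
  \<open>k = 1\<close> if \<open>k \<ge> 1\<close>; a closed term has no leaves at level 0, so no square-root growth is possible there.
\<close>

definition N_seq :: "nat \<Rightarrow> nat" where
  "N_seq i = (u_seq i)\<^sup>2 - u_seq i + i"

end

theory Submission
  imports Defs "HOL-Complex_Analysis.Complex_Analysis" "HOL-Real_Asymp.Real_Asymp"
begin

text \<open>
  Let \<open>F l\<close> be the generating function of the (sub)terms whose root is at level \<open>l\<close>. Since \<open>F l\<close> satisfies
  a quadratic equation over \<open>F (l + 1)\<close>, the series \<open>1 - 2 z F l\<close> are the successive stages of a nest of
  \<open>k + 1\<close> square roots. The dominant singularity \<open>\<rho>\<close> is the first positive zero of a radicand. In the
  variable \<open>x = 1 / (2 z)\<close> the recursion of the radicands at a zero of the \<open>j\<close>-th one becomes that of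
  \<open>u_seq\<close>, perturbed by a parameter \<open>t\<close> in \<open>[0, 1)\<close> with \<open>k = x\<^sup>2 - x + j + t\<close>; so \<open>t = 0\<close> means
  \<open>k = N_seq j\<close>, and then the radicands \<open>j - 1\<close> and \<open>j\<close> vanish together.

  If \<open>t > 0\<close>, the zero is simple and persists as an analytic function of \<open>u\<close>, and the generating function
  has a square-root expansion at \<open>\<rho>(u)\<close> that is uniform in \<open>u\<close> near 1. Coefficient transfer bounds the
  probability generating functions by powers of \<open>B(u) = \<rho>(1) / \<rho>(u)\<close>, and the moments and the
  normal limit follow (quasi-powers). For \<open>L < k - j\<close> the weight \<open>u\<close> enters only the radicands after the
  vanishing one, so \<open>\<rho>(u)\<close> is constant and the mean is bounded.

  If \<open>t = 0\<close>, the expansions are in \<open>(1 - z / \<rho>)\<^sup>1\<^sup>/\<^sup>4\<close>, and the means come from the product formula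
  \<open>L z\<^sup>L\<^sup>+\<^sup>1 / (S 0 \<cdots> S L)\<close>, \<open>S l = 1 - 2 z F l\<close>, for the generating function of the total number of leaves at level \<open>L\<close>.
  Here \<open>\<rho>(u)\<close> is given by the radicand \<open>j - 1\<close> for \<open>u > 1\<close> and by the radicand \<open>j\<close> for \<open>u < 1\<close>. These
  branches differ at second order, so \<open>B\<close> is not twice differentiable at 1 and the claim about
  asymptotic normality is vacuous. The case \<open>k = 1\<close>, where \<open>j = 1\<close>, is settled by counting.
\<close>

subsection \<open>Coefficient transfer\<close>

text \<open>All roots are principal values at complex arguments, so every radicand has to be kept
  off the negative axis on the whole closed disc except at the singularity. This rests on comparison
  with the radicands at the positive real point, and on the circle itself on the equality case of
  the triangle inequality.

  Uniformity in \<open>u\<close> comes from joint continuity and compactness. The quasi-power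
  argument asks for little: divided by B(u)^n, the probability generating functions are uniformly
  bounded analytic functions with value 1 at u = 1, so Cauchy's inequality controls their
  derivatives and no limit of them has to be found. A uniform upper bound of order n^(-3/2) for the
  coefficients, with the exact order at u = 1 alone, replaces a uniform asymptotic expansion.

  The equation for \<rho>(u) is a nest of roots whose depth grows with j. Solving it for the weight
  instead of the singularity gives a closed formula, increasing in x at the critical point; its
  local inverse is the wanted branch, and no implicit function of two variables enters.\<close>

text \<open>
  Discs whose radii are proportional to their distance from 1 cover the closed unit disc except for the
  point 1, and Cauchy's inequality on them bounds derivatives up to the singularity.
\<close>

definition delta_domain :: "real \<Rightarrow> complex set" where
  "delta_domain c = (\<Union>w\<in>ball 0 1. ball w (c * norm (1 - w)))"

lemma open_delta_domain [simp]: "open (delta_domain c)"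
  unfolding delta_domain_def by blast

lemma ball_subset_delta_domain:
  assumes "c > 0"
  shows "ball 0 1 \<subseteq> delta_domain c"
proof
  fix w :: complex assume w: "w \<in> ball 0 1"
  hence "w \<noteq> 1" by auto
  with assms have "w \<in> ball w (c * norm (1 - w))" by simp
  thus "w \<in> delta_domain c" using w unfolding delta_domain_def by blast
qed

text \<open>With \<open>c\<close> at most 1/3, a point \<open>w0\<close> of the unit disc satisfies
  |w - w0| < |1 - w0| / 3, whence |1 - w| > 2 |w - w0|, while Re (1 - w) > - |w - w0|. So 1 - w
  stays in a sector of half-angle 120 degrees; this margin later allows the principal root of (1 -
  w) g to be split when g is nearly positive.\<close>

lemma delta_domainD:
  assumes "w \<in> delta_domain c" "0 < c" "c \<le> 1/3"
  shows "Re (1 - w) > - norm (1 - w) / 2" "1 - w \<notin> \<real>\<^sub>\<le>\<^sub>0" "w \<noteq> 1" "norm (1 - w) \<le> 3"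
proof -
  obtain w0 where w0: "norm w0 < 1" "norm (w - w0) < c * norm (1 - w0)"
    using assms(1) by (auto simp: delta_domain_def dist_norm norm_minus_commute)
  have le2: "norm (1 - w0) \<le> 2"
    using norm_triangle_ineq4[of 1 w0] w0(1) by simp
  have nz: "norm (1 - w0) > 0" using w0(1) by (auto)
  have c3: "c * norm (1 - w0) \<le> norm (1 - w0) / 3"
    using mult_right_mono[OF assms(3), of "norm (1 - w0)"] by simp
  have Re0: "Re (1 - w0) > 0"
    using complex_Re_le_cmod[of w0] w0(1) by simp
  have eq: "1 - w = (1 - w0) - (w - w0)" by simp
  have "Re (1 - w) = Re (1 - w0) - Re (w - w0)" by simp
  moreover have "Re (w - w0) \<le> norm (w - w0)" by (rule complex_Re_le_cmod)
  moreover have "norm (1 - w0) - norm (w - w0) \<le> norm (1 - w)"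
    by (subst eq) (rule norm_triangle_ineq2)
  ultimately show 1: "Re (1 - w) > - norm (1 - w) / 2"
    using w0(2) c3 Re0 by linarith
  have "norm (1 - w) > 0"
    using \<open>norm (1 - w0) - norm (w - w0) \<le> norm (1 - w)\<close> w0(2) c3 nz by linarith
  thus 2: "w \<noteq> 1" by auto
  show "1 - w \<notin> \<real>\<^sub>\<le>\<^sub>0"
  proof
    assume "1 - w \<in> \<real>\<^sub>\<le>\<^sub>0"
    then obtain x where x: "1 - w = of_real x" "x \<le> 0" by (auto elim!: nonpos_Reals_cases)
    have "x > - \<bar>x\<bar> / 2" using 1 unfolding x(1) by simp
    hence "x = 0" using x(2) by auto
    thus False using x 2 by simp
  qed
  have "norm (1 - w) \<le> norm (1 - w0) + norm (w - w0)"
    by (subst eq) (rule norm_triangle_ineq4)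
  thus "norm (1 - w) \<le> 3" using le2 w0(2) c3 by linarith
qed

text \<open>Cauchy's inequality on all smaller circles, followed by the limit of the radii. The
  bounds in this proof hold on open discs, so nothing is assumed on the boundary.\<close>

lemma Cauchy_inequality_open_ball:
  assumes "f holomorphic_on ball z r" "0 < r" "\<And>w. w \<in> ball z r \<Longrightarrow> norm (f w) \<le> M"
  shows "norm ((deriv ^^ n) f z) \<le> fact n * M / r ^ n"
proof -
  have *: "norm ((deriv ^^ n) f z) * \<rho> ^ n \<le> fact n * M" if "\<rho> \<in> {0<..<r}" for \<rho>
  proof -
    have "norm ((deriv ^^ n) f z) \<le> fact n * M / \<rho> ^ n"
    proof (rule Cauchy_inequality)
      show "f holomorphic_on ball z \<rho>"
        using that by (intro holomorphic_on_subset[OF assms(1)]) auto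
      show "continuous_on (cball z \<rho>) f"
        using that by (intro holomorphic_on_imp_continuous_on holomorphic_on_subset[OF assms(1)]) auto
    qed (use that assms in \<open>auto simp: dist_norm\<close>)
    thus ?thesis using that by (simp add: field_simps)
  qed
  have "((\<lambda>\<rho>. norm ((deriv ^^ n) f z) * \<rho> ^ n) \<longlongrightarrow> norm ((deriv ^^ n) f z) * r ^ n) (at_left r)"
    by (intro tendsto_intros)
  moreover have "eventually (\<lambda>\<rho>. norm ((deriv ^^ n) f z) * \<rho> ^ n \<le> fact n * M) (at_left r)"
    using eventually_at_left_real[OF assms(2)] by eventually_elim (rule *)
  ultimately have "norm ((deriv ^^ n) f z) * r ^ n \<le> fact n * M"
    by (rule tendsto_upperbound) simp
  thus ?thesis using assms(2) by (simp add: field_simps)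
qed

text \<open>Cauchy's inequality dominates the tail by a geometric series of ratio at most 1/2; hence
  the factor 2.\<close>

lemma Taylor_remainder_bound:
  assumes "f holomorphic_on ball 0 r" "0 < r" "\<And>w. w \<in> ball 0 r \<Longrightarrow> norm (f w) \<le> M"
    and "norm s \<le> r / 2"
  shows "norm (f s - (\<Sum>m<N. (deriv ^^ m) f 0 / fact m * s ^ m)) \<le> 2 * M * (norm s / r) ^ N"
proof -
  let ?a = "\<lambda>m. (deriv ^^ m) f 0 / fact m * s ^ m"
  have M: "M \<ge> 0" using assms(3)[of 0] assms(2) norm_ge_zero[of "f 0"] by (simp del: norm_ge_zero)
  have s: "s \<in> ball 0 r" using assms(2,4) by auto
  have sm: "?a sums f s"
    using holomorphic_power_series[OF assms(1) s] by simp
  have x: "norm s / r \<le> 1/2" "norm s / r \<ge> 0" using assms(2,4) by (auto simp: field_simps)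
  have b: "norm (?a m) \<le> M * (norm s / r) ^ m" for m
  proof -
    have "norm (?a m) = norm ((deriv ^^ m) f 0) / fact m * norm s ^ m"
      by (simp add: norm_mult norm_divide norm_power)
    also have "\<dots> \<le> (fact m * M / r ^ m) / fact m * norm s ^ m"
      by (intro mult_right_mono divide_right_mono Cauchy_inequality_open_ball assms) auto
    also have "\<dots> = M * (norm s / r) ^ m" by (simp add: power_divide)
    finally show ?thesis .
  qed
  have gs: "(\<lambda>m. M * (norm s / r) ^ (m + N)) sums (M * (norm s / r) ^ N * (1 / (1 - norm s / r)))"
  proof -
    have "norm (norm s / r) < 1" using x by (subst real_norm_def) linarith
    from sums_mult[OF geometric_sums[OF this], of "M * (norm s / r) ^ N"]
    show ?thesis by (simp add: power_add mult_ac)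
  qed
  have "(\<lambda>m. ?a (m + N)) sums (f s - (\<Sum>m<N. ?a m))"
    using sums_split_initial_segment[OF sm, of N] .
  hence eq: "f s - (\<Sum>m<N. ?a m) = (\<Sum>m. ?a (m + N))" by (simp add: sums_iff)
  have "norm (\<Sum>m. ?a (m + N)) \<le> (\<Sum>m. M * (norm s / r) ^ (m + N))"
    by (intro norm_suminf_le b sums_summable[OF gs])
  also have "\<dots> = M * (norm s / r) ^ N * (1 / (1 - norm s / r))"
    using gs by (simp add: sums_iff)
  also have "\<dots> \<le> M * (norm s / r) ^ N * 2"
  proof (rule mult_left_mono)
    have "1 / (1 - norm s / r) \<le> 1 / (1/2)" using x by (intro divide_left_mono mult_pos_pos) linarith+
    thus "1 / (1 - norm s / r) \<le> 2" by simp
    show "0 \<le> M * (norm s / r) ^ N" using M x(2) by (intro mult_nonneg_nonneg zero_le_power)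
  qed
  finally show ?thesis unfolding eq by simp
qed

text \<open>
  The hypothesis makes \<open>E''\<close> bounded on the unit disc, and two derivatives cost a factor \<open>n\<^sup>2\<close>.
\<close>

lemma fps_coeff_bound_delta_domain:
  assumes hol: "E holomorphic_on delta_domain c" and c: "0 < c"
    and bd: "\<And>w. w \<in> delta_domain c \<Longrightarrow> norm (E w) \<le> M * norm (1 - w) ^ 2"
    and fps: "E has_fps_expansion F" and n: "n \<ge> 2"
  shows "norm (fps_nth F n) \<le> 4 * M * (1 + c/2)^2 / (c/2)^2 / real n ^ 2"
proof -
  define M2 where "M2 = 2 * M * (1 + c/2)^2 / (c/2)^2"
  have M: "M \<ge> 0"
  proof -
    have "0 \<in> delta_domain c" using ball_subset_delta_domain[OF c] by auto
    from bd[OF this] norm_ge_zero[of "E 0"] show ?thesis by (simp del: norm_ge_zero)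
  qed
  \<comment> \<open>On the disc of radius c/2 |1 - w| the factor |1 - w|^2 in the bound for
    \<open>E\<close> cancels against the squared radius in Cauchy's inequality.\<close>
  have d2: "norm ((deriv ^^ 2) E w) \<le> M2" if w: "w \<in> ball 0 1" for w
  proof -
    let ?r = "c/2 * norm (1 - w)"
    have w1: "norm (1 - w) > 0" using w by auto
    have sub: "ball w ?r \<subseteq> delta_domain c"
    proof -
      have "ball w ?r \<subseteq> ball w (c * norm (1 - w))" using c w1 by (intro subset_ball) auto
      thus ?thesis using w unfolding delta_domain_def by blast
    qed
    have "norm ((deriv ^^ 2) E w) \<le> fact 2 * (M * ((1 + c/2) * norm (1 - w))^2) / ?r ^ 2"
    proof (rule Cauchy_inequality_open_ball)
      show "E holomorphic_on ball w ?r" by (rule holomorphic_on_subset[OF hol sub])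
      show "?r > 0" using c w1 by simp
      fix v assume v: "v \<in> ball w ?r"
      have "norm (1 - v) \<le> norm (1 - w) + norm (w - v)"
        using norm_triangle_ineq[of "1 - w" "w - v"] by simp
      also have "\<dots> \<le> (1 + c/2) * norm (1 - w)"
        using v by (simp add: dist_norm algebra_simps)
      finally have "norm (1 - v) ^ 2 \<le> ((1 + c/2) * norm (1 - w))^2"
        by (intro power_mono) auto
      thus "norm (E v) \<le> M * ((1 + c/2) * norm (1 - w))^2"
        using bd[of v] v sub M by (meson mult_left_mono order_trans subsetD)
    qed
    also have "\<dots> = M2" using w1 c unfolding M2_def by (simp add: power_mult_distrib power_divide del: zero_less_norm_iff) (simp add: field_simps)
    finally show ?thesis .
  qed
  have M2: "M2 \<ge> 0" using M unfolding M2_def by simp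
  have holb: "E holomorphic_on ball 0 1"
    by (rule holomorphic_on_subset[OF hol ball_subset_delta_domain[OF c]])
  obtain m where m: "n = m + 2" using n by (metis add.commute le_Suc_ex)
  have "norm ((deriv ^^ m) ((deriv ^^ 2) E) 0) \<le> fact m * M2 / 1 ^ m"
    by (rule Cauchy_inequality_open_ball) (use d2 in \<open>auto intro!: holomorphic_higher_deriv holb\<close>)
  moreover have "(deriv ^^ m) ((deriv ^^ 2) E) = (deriv ^^ n) E"
    by (simp only: m funpow_add o_apply)
  ultimately have "norm ((deriv ^^ n) E 0) \<le> fact m * M2" by simp
  hence "norm (fps_nth F n) \<le> fact m * M2 / fact n"
    unfolding fps_nth_fps_expansion[OF fps] by (simp add: norm_divide divide_right_mono)
  also have "fact n = fact m * (real n * (real n - 1))"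
    unfolding m by (simp add: algebra_simps)
  also have "fact m * M2 / (fact m * (real n * (real n - 1))) = M2 / (real n * (real n - 1))"
    by simp
  also have "\<dots> \<le> M2 / (real n ^ 2 / 2)"
    using n M2 by (intro divide_left_mono) (auto simp: power2_eq_square field_simps)
  also have "\<dots> = 4 * M * (1 + c/2)^2 / (c/2)^2 / real n ^ 2" unfolding M2_def by simp
  finally show ?thesis .
qed

section \<open>Binomial coefficients and transfer of singular expansions\<close>

lemma has_fps_expansion_one_minus_powr:
  "(\<lambda>w. (1 - w) powr a) has_fps_expansion Abs_fps (\<lambda>n. (-1) ^ n * (a gchoose n))" for a :: complex
proof (rule has_fps_expansionI)
  have "eventually (\<lambda>z::complex. z \<in> ball 0 1) (nhds 0)"
    by (intro eventually_nhds_in_open) auto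
  thus "eventually (\<lambda>u. (\<lambda>n. fps_nth (Abs_fps (\<lambda>n. (-1) ^ n * (a gchoose n))) n * u ^ n) sums (1 - u) powr a) (nhds 0)"
  proof eventually_elim
    case (elim u)
    show ?case using gen_binomial_complex[of "-u" a] elim
      by (simp add: power_minus[of u] mult_ac)
  qed
qed

text \<open>The classical order n^(-\<alpha>-1) of the coefficients of (1 - w)^\<alpha>. With
  \<open>rGamma\<close> in place of a quotient by \<open>Gamma\<close>, natural exponents are no
  exception: the coefficients vanish eventually and the limit is 0.\<close>

lemma gbinomial_real_asymptotic:
  "(\<lambda>n. (-1) ^ n * (complex_of_real \<alpha> gchoose n) * of_real (real n powr (\<alpha> + 1)))
     \<longlonglongrightarrow> rGamma (- of_real \<alpha>)"
proof (rule Lim_transform_eventually)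
  show "(\<lambda>n. (of_real \<alpha> gchoose n) / ((-1)^n / exp ((of_real \<alpha>+1) * of_real (ln (real n)))))
     \<longlonglongrightarrow> (rGamma (- of_real \<alpha>) :: complex)"
    using gbinomial_asymptotic[of "complex_of_real \<alpha>"] by (simp add: rGamma_inverse_Gamma)
  show "\<forall>\<^sub>F n in sequentially. (of_real \<alpha> gchoose n) / ((-1)^n / exp ((of_real \<alpha>+1) * of_real (ln (real n)))) =
    (-1) ^ n * (complex_of_real \<alpha> gchoose n) * of_real (real n powr (\<alpha> + 1))"
    using eventually_gt_at_top[of 0]
  proof eventually_elim
    case (elim n)
    have "exp ((of_real \<alpha>+1) * of_real (ln (real n))) = complex_of_real (exp ((\<alpha> + 1) * ln (real n)))"
      by (simp add: exp_of_real[symmetric])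
    also have "exp ((\<alpha> + 1) * ln (real n)) = real n powr (\<alpha> + 1)"
      using elim by (simp add: powr_def)
    finally show ?case by (simp add: field_simps power_mult_distrib[symmetric])
  qed
qed

lemma gbinomial_real_bound:
  "\<exists>C\<ge>0. \<forall>n\<ge>1. norm (complex_of_real \<alpha> gchoose n) \<le> C * real n powr (-\<alpha> - 1)"
proof -
  have "Bseq (\<lambda>n. (-1) ^ n * (complex_of_real \<alpha> gchoose n) * of_real (real n powr (\<alpha> + 1)))"
    using gbinomial_real_asymptotic by (rule convergent_imp_Bseq[OF convergentI])
  then obtain C where C: "C > 0" "\<And>n. norm ((-1) ^ n * (complex_of_real \<alpha> gchoose n) * of_real (real n powr (\<alpha> + 1))) \<le> C"
    unfolding Bseq_def by auto
  have "norm (complex_of_real \<alpha> gchoose n) \<le> C * real n powr (-\<alpha> - 1)" if "n \<ge> 1" for n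
  proof -
    have "norm (complex_of_real \<alpha> gchoose n) * real n powr (\<alpha> + 1) \<le> C"
      using C(2)[of n] by (simp add: norm_mult norm_power)
    hence "norm (complex_of_real \<alpha> gchoose n) * real n powr (\<alpha> + 1) * real n powr (-\<alpha>-1) \<le> C * real n powr (-\<alpha>-1)"
      by (intro mult_right_mono) auto
    thus ?thesis using that by (simp add: mult.assoc powr_add[symmetric])
  qed
  thus ?thesis using C(1) by (intro exI[of _ C]) auto
qed

text \<open>
  Subtracting the terms of order less than \<open>(1 - w)\<^sup>2\<close> leaves an error to which the last bound on
  coefficients applies. The constant \<open>C\<close> does not depend on \<open>f\<close>, which is needed for uniformity in \<open>u\<close>.
\<close>

lemma transfer_expansion:
  fixes p q :: nat and \<epsilon> c :: real
  assumes q: "q > 0" and \<epsilon>: "0 < \<epsilon>" and c: "0 < c" "c \<le> 1/3"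
  obtains C where "C \<ge> 0" and
    "\<And>(f :: complex \<Rightarrow> complex) (\<Phi> :: complex \<Rightarrow> complex) F M n. f holomorphic_on delta_domain c \<Longrightarrow> f has_fps_expansion F \<Longrightarrow>
        \<Phi> holomorphic_on ball 0 \<epsilon> \<Longrightarrow> (\<And>s. s \<in> ball 0 \<epsilon> \<Longrightarrow> norm (\<Phi> s) \<le> M) \<Longrightarrow>
        (\<And>w. w \<in> delta_domain c \<Longrightarrow> norm ((1 - w) powr of_real (1 / real q)) < \<epsilon> \<Longrightarrow>
            f w = \<Phi> ((1 - w) powr of_real (1 / real q)) / ((1 - w) powr of_real (1 / real q)) ^ p) \<Longrightarrow>
        (\<And>w. w \<in> delta_domain c \<Longrightarrow> norm ((1 - w) powr of_real (1 / real q)) \<ge> \<epsilon> / 2 \<Longrightarrow> norm (f w) \<le> M) \<Longrightarrow>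
        n \<ge> 2 \<Longrightarrow>
        norm (fps_nth F n - (\<Sum>m<p+2*q. (deriv ^^ m) \<Phi> 0 / fact m *
           ((-1) ^ n * (of_real ((real m - real p) / real q) gchoose n)))) \<le> C * M / real n ^ 2"
proof -
  define N where "N = p + 2 * q"
  define C1 where "C1 = 2 / \<epsilon> ^ N"
  define C2 where "C2 = (1 + (\<Sum>m<N. 3 ^ m / \<epsilon> ^ m / (\<epsilon>/2) ^ p)) / (\<epsilon>/2)^(2*q)"
  define D where "D = max C1 C2"
  define C where "C = 4 * D * (1 + c/2)^2 / (c/2)^2"
  have C1: "C1 \<ge> 0" using \<epsilon> by (simp add: C1_def)
  have D: "D \<ge> 0" using C1 by (simp add: D_def)
  show ?thesis
  proof (rule that[of C])
    show "C \<ge> 0" using D unfolding C_def by simp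
    fix f \<Phi> :: "complex \<Rightarrow> complex" and F M and n :: nat
    assume hol: "f holomorphic_on delta_domain c" and fps: "f has_fps_expansion F"
      and holP: "\<Phi> holomorphic_on ball 0 \<epsilon>" and bdP: "\<And>s. s \<in> ball 0 \<epsilon> \<Longrightarrow> norm (\<Phi> s) \<le> M"
      and near: "\<And>w. w \<in> delta_domain c \<Longrightarrow> norm ((1 - w) powr of_real (1 / real q)) < \<epsilon> \<Longrightarrow>
            f w = \<Phi> ((1 - w) powr of_real (1 / real q)) / ((1 - w) powr of_real (1 / real q)) ^ p"
      and far: "\<And>w. w \<in> delta_domain c \<Longrightarrow> norm ((1 - w) powr of_real (1 / real q)) \<ge> \<epsilon> / 2 \<Longrightarrow> norm (f w) \<le> M"
      and n: "n \<ge> 2"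
    define \<phi> where "\<phi> m = (deriv ^^ m) \<Phi> 0 / fact m" for m
    define \<alpha> where "\<alpha> m = complex_of_real ((real m - real p) / real q)" for m
    define E where "E w = f w - (\<Sum>m<N. \<phi> m * (1 - w) powr \<alpha> m)" for w
    define G where "G = F - (\<Sum>m<N. fps_const (\<phi> m) * Abs_fps (\<lambda>n. (-1) ^ n * (\<alpha> m gchoose n)))"
    have M: "M \<ge> 0" using bdP[of 0] \<epsilon> norm_ge_zero[of "\<Phi> 0"] by (simp del: norm_ge_zero)
    have \<phi>: "norm (\<phi> m) \<le> M / \<epsilon> ^ m" for m
      using Cauchy_inequality_open_ball[OF holP \<epsilon> bdP, of m]
      by (simp add: \<phi>_def norm_divide field_simps)
    have "E has_fps_expansion G"
      unfolding E_def G_def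
      by (intro fps_expansion_intros fps has_fps_expansion_one_minus_powr)
    moreover have "E holomorphic_on delta_domain c"
      unfolding E_def by (intro holomorphic_intros hol) (use delta_domainD[OF _ c] in auto)
    moreover have "norm (E w) \<le> (D * M) * norm (1 - w) ^ 2" if w: "w \<in> delta_domain c" for w
    proof -
      define s where "s = (1 - w) powr of_real (1 / real q)"
      have w1: "w \<noteq> 1" using delta_domainD(3)[OF w c] .
      have s0: "s \<noteq> 0" using w1 by (simp add: s_def)
      have sm: "s ^ m = (1 - w) powr (of_real (real m / real q))" for m
        using w1 by (simp add: s_def powr_def exp_of_nat_mult[symmetric])
      have pw: "(1 - w) powr \<alpha> m = s ^ m / s ^ p" for m
        unfolding \<alpha>_def sm using w1 by (simp add: diff_divide_distrib powr_diff)
      have n2: "norm (1 - w) ^ 2 = norm s ^ (2 * q)"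
      proof -
        have "s ^ q = 1 - w" using sm[of q] q w1 by simp
        thus ?thesis by (metis norm_power power_mult mult.commute)
      qed
      show ?thesis
      proof (cases "norm s < \<epsilon> / 2")
        case True
        have "E w = (\<Phi> s - (\<Sum>m<N. \<phi> m * s ^ m)) / s ^ p"
        proof -
          have "f w = \<Phi> s / s ^ p" using near[OF w] True \<epsilon> unfolding s_def by simp
          thus ?thesis unfolding E_def pw by (simp add: diff_divide_distrib sum_divide_distrib)
        qed
        hence "norm (E w) = norm (\<Phi> s - (\<Sum>m<N. \<phi> m * s ^ m)) / norm s ^ p"
          by (simp add: norm_divide norm_power)
        also have "\<dots> \<le> (2 * M * (norm s / \<epsilon>) ^ N) / norm s ^ p"
          unfolding \<phi>_def using True
          by (intro divide_right_mono Taylor_remainder_bound holP \<epsilon> bdP) auto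
        also have "\<dots> = C1 * M * norm s ^ (2 * q)"
          using s0 by (simp add: C1_def N_def power_divide power_add)
        also have "\<dots> \<le> D * M * norm s ^ (2 * q)"
          using M by (intro mult_right_mono) (auto simp: D_def)
        finally show ?thesis by (simp add: n2)
      next
        \<comment> \<open>Away from 1 a crude bound of each term is enough: |s| lies between
          \<epsilon>/2 and 3, and the constant is absorbed because |1 - w|^2 = |s|^(2q) is at least
          (\<epsilon>/2)^(2q).\<close>
        case False
        have s3: "norm s \<le> 3"
        proof (rule ccontr)
          assume "\<not> norm s \<le> 3"
          hence "3 < norm s" by simp
          also have "norm s \<le> norm s ^ q" using q \<open>3 < norm s\<close> by (intro self_le_power) auto
          also have "\<dots> = norm (1 - w)" using sm[of q] q w1 by (simp flip: norm_power)
          finally show False using delta_domainD(4)[OF w c] by simp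
        qed
        have t: "norm (\<phi> m * (1 - w) powr \<alpha> m) \<le> M * (3 ^ m / \<epsilon> ^ m / (\<epsilon>/2) ^ p)" for m
        proof -
          have "norm (\<phi> m * (1 - w) powr \<alpha> m) = norm (\<phi> m) * (norm s ^ m / norm s ^ p)"
            unfolding pw by (simp add: norm_mult norm_divide norm_power)
          also have "\<dots> \<le> (M / \<epsilon> ^ m) * (3 ^ m / (\<epsilon>/2) ^ p)"
            using False s3 \<epsilon> M by (intro mult_mono \<phi> frac_le power_mono) auto
          finally show ?thesis by (simp add: field_simps)
        qed
        have "norm (E w) \<le> norm (f w) + norm (\<Sum>m<N. \<phi> m * (1 - w) powr \<alpha> m)"
          unfolding E_def by (rule norm_triangle_ineq4)
        also have "\<dots> \<le> M + (\<Sum>m<N. M * (3 ^ m / \<epsilon> ^ m / (\<epsilon>/2) ^ p))"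
          using far[OF w] False by (intro add_mono sum_norm_le t) (auto simp: s_def)
        also have "\<dots> = C2 * M * (\<epsilon>/2)^(2*q)"
        proof -
          have "C2 * (\<epsilon>/2)^(2*q) = 1 + (\<Sum>m<N. 3 ^ m / \<epsilon> ^ m / (\<epsilon>/2) ^ p)"
            using \<epsilon> by (simp add: C2_def)
          hence "M * (C2 * (\<epsilon>/2)^(2*q)) = M + (\<Sum>m<N. M * (3 ^ m / \<epsilon> ^ m / (\<epsilon>/2) ^ p))"
            by (simp only: distrib_left sum_distrib_left mult_1_right)
          thus ?thesis by (simp only: mult_ac)
        qed
        also have "\<dots> \<le> D * M * norm s ^ (2*q)"
          using M False \<epsilon> D by (intro mult_mono power_mono) (auto simp: D_def)
        finally show ?thesis by (simp add: n2)
      qed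
    qed
    ultimately have "norm (fps_nth G n) \<le> 4 * (D * M) * (1 + c/2)^2 / (c/2)^2 / real n ^ 2"
      using fps_coeff_bound_delta_domain c n by blast
    moreover have "fps_nth G n = fps_nth F n - (\<Sum>m<N. \<phi> m * ((-1) ^ n * (\<alpha> m gchoose n)))"
      by (simp add: G_def fps_sum_nth)
    ultimately show "norm (fps_nth F n - (\<Sum>m<p+2*q. (deriv ^^ m) \<Phi> 0 / fact m *
           ((-1) ^ n * (of_real ((real m - real p) / real q) gchoose n)))) \<le> C * M / real n ^ 2"
      by (simp add: C_def N_def \<phi>_def \<alpha>_def mult_ac)
  qed
qed

text \<open>Even powers of csqrt (1 - w) are powers of 1 - w, and those of degree at most 1 have no
  coefficients from n = 2 on. Of the four terms split off only the exponents 1/2 and 3/2 remain, and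
  the first of them sets the order n^(-3/2).\<close>

lemma transfer_sqrt_bound:
  fixes \<epsilon> c :: real
  assumes \<epsilon>: "0 < \<epsilon>" and c: "0 < c" "c \<le> 1/3"
  obtains C where "C \<ge> 0" and
    "\<And>(f :: complex \<Rightarrow> complex) (\<Phi> :: complex \<Rightarrow> complex) F M n.
        f holomorphic_on delta_domain c \<Longrightarrow> f has_fps_expansion F \<Longrightarrow>
        \<Phi> holomorphic_on ball 0 \<epsilon> \<Longrightarrow> (\<And>s. s \<in> ball 0 \<epsilon> \<Longrightarrow> norm (\<Phi> s) \<le> M) \<Longrightarrow>
        (\<And>w. w \<in> delta_domain c \<Longrightarrow> norm (csqrt (1 - w)) < \<epsilon> \<Longrightarrow> f w = \<Phi> (csqrt (1 - w))) \<Longrightarrow>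
        (\<And>w. w \<in> delta_domain c \<Longrightarrow> norm (csqrt (1 - w)) \<ge> \<epsilon> / 2 \<Longrightarrow> norm (f w) \<le> M) \<Longrightarrow>
        n \<ge> 2 \<Longrightarrow> norm (fps_nth F n) \<le> C * M * real n powr (-3/2)"
proof -
  show ?thesis
  proof (rule transfer_expansion[of 2 \<epsilon> c 0])
    fix C0 :: real
    assume C0: "C0 \<ge> 0" and transfer:
    "\<And>(f :: complex \<Rightarrow> complex) (\<Phi> :: complex \<Rightarrow> complex) F M n. f holomorphic_on delta_domain c \<Longrightarrow> f has_fps_expansion F \<Longrightarrow>
        \<Phi> holomorphic_on ball 0 \<epsilon> \<Longrightarrow> (\<And>s. s \<in> ball 0 \<epsilon> \<Longrightarrow> norm (\<Phi> s) \<le> M) \<Longrightarrow>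
        (\<And>w. w \<in> delta_domain c \<Longrightarrow> norm ((1 - w) powr of_real (1 / real 2)) < \<epsilon> \<Longrightarrow>
            f w = \<Phi> ((1 - w) powr of_real (1 / real 2)) / ((1 - w) powr of_real (1 / real 2)) ^ 0) \<Longrightarrow>
        (\<And>w. w \<in> delta_domain c \<Longrightarrow> norm ((1 - w) powr of_real (1 / real 2)) \<ge> \<epsilon> / 2 \<Longrightarrow> norm (f w) \<le> M) \<Longrightarrow>
        n \<ge> 2 \<Longrightarrow>
        norm (fps_nth F n - (\<Sum>m<0+2*2. (deriv ^^ m) \<Phi> 0 / fact m *
           ((-1) ^ n * (of_real ((real m - real 0) / real 2) gchoose n)))) \<le> C0 * M / real n ^ 2"
  obtain C1 where C1: "C1 \<ge> 0" "\<And>n. n \<ge> 1 \<Longrightarrow> norm (complex_of_real (1/2) gchoose n) \<le> C1 * real n powr (-(1/2) - 1)"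
    using gbinomial_real_bound[of "1/2"] by auto
  obtain C3 where C3: "C3 \<ge> 0" "\<And>n. n \<ge> 1 \<Longrightarrow> norm (complex_of_real (3/2) gchoose n) \<le> C3 * real n powr (-(3/2) - 1)"
    using gbinomial_real_bound[of "3/2"] by auto
  show ?thesis
  proof (rule that[of "C0 + C1 / \<epsilon> + C3 / \<epsilon> ^ 3"])
    show "C0 + C1 / \<epsilon> + C3 / \<epsilon> ^ 3 \<ge> 0" using C0 C1 C3 \<epsilon> by auto
    fix f \<Phi> :: "complex \<Rightarrow> complex" and F M and n :: nat
    assume hol: "f holomorphic_on delta_domain c" and fps: "f has_fps_expansion F"
      and holP: "\<Phi> holomorphic_on ball 0 \<epsilon>" and bdP: "\<And>s. s \<in> ball 0 \<epsilon> \<Longrightarrow> norm (\<Phi> s) \<le> M"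
      and near: "\<And>w. w \<in> delta_domain c \<Longrightarrow> norm (csqrt (1 - w)) < \<epsilon> \<Longrightarrow> f w = \<Phi> (csqrt (1 - w))"
      and far: "\<And>w. w \<in> delta_domain c \<Longrightarrow> norm (csqrt (1 - w)) \<ge> \<epsilon> / 2 \<Longrightarrow> norm (f w) \<le> M"
      and n: "n \<ge> 2"
    define \<phi> where "\<phi> m = (deriv ^^ m) \<Phi> 0 / fact m" for m
    define x where "x = real n powr (-3/2)"
    have M: "M \<ge> 0" using bdP[of 0] \<epsilon> norm_ge_zero[of "\<Phi> 0"] by (simp del: norm_ge_zero)
    have \<phi>: "norm (\<phi> m) \<le> M / \<epsilon> ^ m" for m
      using Cauchy_inequality_open_ball[OF holP \<epsilon> bdP, of m]
      by (simp add: \<phi>_def norm_divide field_simps)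
    have cs: "(1 - w) powr of_real (1 / real 2) = csqrt (1 - w)" if "w \<in> delta_domain c" for w
      using delta_domainD(3)[OF that c] by (subst csqrt_conv_powr) auto
    have z: "complex_of_real 0 gchoose n = 0" "complex_of_real 1 gchoose n = 0"
      using n binomial_gbinomial[of 0 n, where 'a = complex] binomial_gbinomial[of 1 n, where 'a = complex]
      by (simp_all add: binomial_eq_0)
    have e: "norm (fps_nth F n - (\<phi> 1 * ((-1) ^ n * (of_real (1/2) gchoose n)) + \<phi> 3 * ((-1) ^ n * (of_real (3/2) gchoose n))))
               \<le> C0 * M / real n ^ 2"
      using transfer[OF hol fps holP bdP _ _ n] near far cs z
      by (simp add: \<phi>_def[symmetric] numeral_eq_Suc)
    have p1: "1 / real n ^ 2 \<le> x"
    proof -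
      have "1 / real n ^ 2 = real n powr (-2)"
        using n by (simp add: powr_minus powr_numeral divide_inverse)
      also have "\<dots> \<le> x" unfolding x_def using n by (intro powr_mono) auto
      finally show ?thesis .
    qed
    have p3: "real n powr (-(3/2) - 1) \<le> x" unfolding x_def using n by (intro powr_mono) auto
    have x: "x \<ge> 0" by (simp add: x_def)
    have "norm (fps_nth F n) \<le> C0 * M / real n ^ 2 + norm (\<phi> 1 * ((-1) ^ n * (of_real (1/2) gchoose n)) + \<phi> 3 * ((-1) ^ n * (of_real (3/2) gchoose n)))"
      using e norm_triangle_sub order_trans by (smt (verit))
    also have "\<dots> \<le> C0 * M / real n ^ 2 + (norm (\<phi> 1) * norm (complex_of_real (1/2) gchoose n) + norm (\<phi> 3) * norm (complex_of_real (3/2) gchoose n))"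
      by (intro add_left_mono order_trans[OF norm_triangle_ineq]) (simp add: norm_mult norm_power)
    also have "\<dots> \<le> C0 * M * x + ((M / \<epsilon> ^ 1) * (C1 * x) + (M / \<epsilon> ^ 3) * (C3 * x))"
    proof (intro add_mono mult_mono \<phi>)
      show "C0 * M / (real n)\<^sup>2 \<le> C0 * M * x"
        using mult_left_mono[OF p1, of "C0 * M"] C0 M by simp
      show "norm (complex_of_real (1/2) gchoose n) \<le> C1 * x" using C1(2)[of n] n by (simp add: x_def)
      have "norm (complex_of_real (3/2) gchoose n) \<le> C3 * real n powr (-(3/2) - 1)"
        using C3(2)[of n] n by simp
      also have "\<dots> \<le> C3 * x" by (intro mult_left_mono p3 C3)
      finally show "norm (complex_of_real (3/2) gchoose n) \<le> C3 * x" .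
    qed (use M \<epsilon> in auto)
    also have "\<dots> = (C0 + C1 / \<epsilon> + C3 / \<epsilon> ^ 3) * M * x"
      by (simp add: algebra_simps)
    finally show "norm (fps_nth F n) \<le> (C0 + C1 / \<epsilon> + C3 / \<epsilon> ^ 3) * M * real n powr (-3/2)"
      by (simp add: x_def)
  qed
  qed (use assms in auto)
qed

text \<open>
  The terms before the \<open>m0\<close>-th are polynomials in \<open>1 - w\<close> and contribute to finitely many coefficients only.
\<close>

lemma transfer_asymptotics:
  fixes p q m0 :: nat and \<epsilon> c :: real and f \<Phi> :: "complex \<Rightarrow> complex"
  assumes q: "q > 0" and \<epsilon>: "0 < \<epsilon>" and c: "0 < c" "c \<le> 1/3"
    and hol: "f holomorphic_on delta_domain c" and fps: "f has_fps_expansion F"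
    and holP: "\<Phi> holomorphic_on ball 0 \<epsilon>" and bdP: "\<And>s. s \<in> ball 0 \<epsilon> \<Longrightarrow> norm (\<Phi> s) \<le> M"
    and near: "\<And>w. w \<in> delta_domain c \<Longrightarrow> norm ((1 - w) powr of_real (1 / real q)) < \<epsilon> \<Longrightarrow>
            f w = \<Phi> ((1 - w) powr of_real (1 / real q)) / ((1 - w) powr of_real (1 / real q)) ^ p"
    and far: "\<And>w. w \<in> delta_domain c \<Longrightarrow> norm ((1 - w) powr of_real (1 / real q)) \<ge> \<epsilon> / 2 \<Longrightarrow> norm (f w) \<le> M"
    and m0: "m0 < p + q" and int: "\<And>m. m < m0 \<Longrightarrow> (real m - real p) / real q \<in> \<nat>"
    and \<beta>: "\<beta> = (real m0 - real p) / real q"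
  shows "(\<lambda>n. fps_nth F n * of_real (real n powr (\<beta> + 1))) \<longlonglongrightarrow>
           (deriv ^^ m0) \<Phi> 0 / fact m0 * rGamma (- of_real \<beta>)"
proof -
  define N where "N = p + 2 * q"
  define \<phi> where "\<phi> m = (deriv ^^ m) \<Phi> 0 / fact m" for m
  define \<alpha> where "\<alpha> m = (real m - real p) / real q" for m
  define a where "a m n = (-1) ^ n * (complex_of_real (\<alpha> m) gchoose n)" for m n
  define S where "S n = (\<Sum>m<N. \<phi> m * a m n)" for n
  define y where "y n = complex_of_real (real n powr (\<beta> + 1))" for n
  obtain C where C: "\<And>n. n \<ge> 2 \<Longrightarrow> norm (fps_nth F n - S n) \<le> C * M / real n ^ 2"
  proof (rule transfer_expansion[OF q \<epsilon> c, of p])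
    fix C :: real
    assume T: "\<And>(f :: complex \<Rightarrow> complex) (\<Phi> :: complex \<Rightarrow> complex) F M n. f holomorphic_on delta_domain c \<Longrightarrow> f has_fps_expansion F \<Longrightarrow>
        \<Phi> holomorphic_on ball 0 \<epsilon> \<Longrightarrow> (\<And>s. s \<in> ball 0 \<epsilon> \<Longrightarrow> norm (\<Phi> s) \<le> M) \<Longrightarrow>
        (\<And>w. w \<in> delta_domain c \<Longrightarrow> norm ((1 - w) powr of_real (1 / real q)) < \<epsilon> \<Longrightarrow>
            f w = \<Phi> ((1 - w) powr of_real (1 / real q)) / ((1 - w) powr of_real (1 / real q)) ^ p) \<Longrightarrow>
        (\<And>w. w \<in> delta_domain c \<Longrightarrow> norm ((1 - w) powr of_real (1 / real q)) \<ge> \<epsilon> / 2 \<Longrightarrow> norm (f w) \<le> M) \<Longrightarrow>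
        n \<ge> 2 \<Longrightarrow>
        norm (fps_nth F n - (\<Sum>m<p+2*q. (deriv ^^ m) \<Phi> 0 / fact m *
           ((-1) ^ n * (of_real ((real m - real p) / real q) gchoose n)))) \<le> C * M / real n ^ 2"
    show thesis
    proof (rule that)
      fix n :: nat assume "n \<ge> 2"
      thus "norm (fps_nth F n - S n) \<le> C * M / real n ^ 2"
        unfolding S_def \<phi>_def \<alpha>_def a_def N_def
        by (intro T[OF hol fps holP]) (use bdP near far in blast)+
    qed
  qed
  \<comment> \<open>This makes the error of order n^(-2) negligible against n^(-\<beta>-1).\<close>
  have \<beta>1: "\<beta> < 1" using m0 q unfolding \<beta> by (simp add: field_simps flip: of_nat_add)
  have err: "(\<lambda>n. (fps_nth F n - S n) * y n) \<longlonglongrightarrow> 0"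
  proof (rule Lim_null_comparison)
    show "eventually (\<lambda>n. norm ((fps_nth F n - S n) * y n) \<le> C * M * real n powr (\<beta> - 1)) sequentially"
      using eventually_ge_at_top[of 2]
    proof eventually_elim
      case (elim n)
      have "norm ((fps_nth F n - S n) * y n) \<le> C * M / real n ^ 2 * real n powr (\<beta> + 1)"
        using mult_right_mono[OF C[OF elim], of "real n powr (\<beta> + 1)"]
        by (simp add: norm_mult y_def)
      also have "\<dots> = C * M * (real n powr (\<beta> + 1) / real n powr 2)"
        using elim by (simp add: powr_numeral)
      also have "real n powr (\<beta> + 1) / real n powr 2 = real n powr (\<beta> - 1)"
      proof -
        have "\<beta> - 1 = (\<beta> + 1) - 2" by simp
        thus ?thesis by (simp only: powr_diff)
      qed
      finally show ?case .
    qed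
    have "(\<lambda>n. real n powr (\<beta> - 1)) \<longlonglongrightarrow> 0"
      using \<beta>1 by (intro tendsto_neg_powr filterlim_real_sequentially) auto
    from tendsto_mult_left[OF this, of "C * M"]
    show "(\<lambda>n. C * M * real n powr (\<beta> - 1)) \<longlonglongrightarrow> 0" by simp
  qed
  have summand: "(\<lambda>n. \<phi> m * a m n * y n) \<longlonglongrightarrow> (if m = m0 then \<phi> m0 * rGamma (- of_real \<beta>) else 0)" for m
  proof -
    consider "m < m0" | "m = m0" | "m > m0" by linarith
    thus ?thesis
    proof cases
      case 1
      then obtain i where i: "\<alpha> m = real i" using int[of m] by (auto simp: \<alpha>_def elim!: Nats_cases)
      have "eventually (\<lambda>n. \<phi> m * a m n * y n = 0) sequentially"
        using eventually_gt_at_top[of i]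
        by eventually_elim (simp add: a_def i binomial_eq_0 flip: binomial_gbinomial)
      thus ?thesis using 1 by (simp add: tendsto_eventually)
    next
      case 2
      have "(\<lambda>n. \<phi> m0 * (a m0 n * y n)) \<longlonglongrightarrow> \<phi> m0 * rGamma (- of_real \<beta>)"
        unfolding a_def y_def \<alpha>_def \<beta>[symmetric] by (intro tendsto_mult_left gbinomial_real_asymptotic)
      thus ?thesis using 2 by (simp add: mult_ac)
    next
      case 3
      have lt: "\<beta> < \<alpha> m" unfolding \<beta> \<alpha>_def using q 3 by (intro divide_strict_right_mono) auto
      have "(\<lambda>n. real n powr (\<beta> - \<alpha> m)) \<longlonglongrightarrow> 0"
        using lt by (intro tendsto_neg_powr filterlim_real_sequentially) auto
      hence "(\<lambda>n. complex_of_real (real n powr (\<beta> - \<alpha> m))) \<longlonglongrightarrow> of_real 0" by (rule tendsto_of_real)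
      hence "(\<lambda>n. \<phi> m * (a m n * of_real (real n powr (\<alpha> m + 1))) * of_real (real n powr (\<beta> - \<alpha> m))) \<longlonglongrightarrow>
          \<phi> m * rGamma (- of_real (\<alpha> m)) * of_real 0"
        unfolding a_def by (intro tendsto_mult tendsto_mult_left gbinomial_real_asymptotic)
      also have "(\<lambda>n. \<phi> m * (a m n * of_real (real n powr (\<alpha> m + 1))) * of_real (real n powr (\<beta> - \<alpha> m))) =
         (\<lambda>n. \<phi> m * a m n * y n)"
        by (simp add: y_def mult.assoc flip: of_real_mult powr_add) (simp add: add_ac)
      finally show ?thesis using 3 by simp
    qed
  qed
  have "(\<lambda>n. (fps_nth F n - S n) * y n + (\<Sum>m<N. \<phi> m * a m n * y n)) \<longlonglongrightarrow>
     0 + (\<Sum>m<N. if m = m0 then \<phi> m0 * rGamma (- of_real \<beta>) else 0)"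
    by (intro tendsto_add err tendsto_sum summand)
  also have "(\<lambda>n. (fps_nth F n - S n) * y n + (\<Sum>m<N. \<phi> m * a m n * y n)) = (\<lambda>n. fps_nth F n * y n)"
    by (simp add: S_def left_diff_distrib flip: sum_distrib_right)
  also have "0 + (\<Sum>m<N. if m = m0 then \<phi> m0 * rGamma (- of_real \<beta>) else 0) = \<phi> m0 * rGamma (- of_real \<beta>)"
    using m0 by (simp add: N_def)
  finally show ?thesis by (simp add: y_def \<phi>_def)
qed

subsection \<open>Functions of a variable and a parameter\<close>

text \<open>The first variable is the one in which coefficients are extracted, the second is the
  weight. Joint continuity yields bounds and discs uniform in the weight; analyticity is asked in
  the first variable. Both survive arithmetic and composition with analytic functions, so that
  nested radicands can be treated by induction.\<close>

definition nice_at :: "(complex \<Rightarrow> complex \<Rightarrow> complex) \<Rightarrow> complex \<Rightarrow> complex \<Rightarrow> bool" where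
  "nice_at F a b \<longleftrightarrow> (\<exists>e>0. continuous_on (ball a e \<times> ball b e) (\<lambda>x. F (fst x) (snd x)) \<and>
     (\<forall>u\<in>ball b e. (\<lambda>s. F s u) holomorphic_on ball a e))"

lemma nice_at_open:
  assumes "nice_at F a b" "open V" "F a b \<in> V" "0 < d"
  shows "\<exists>e>0. e \<le> d \<and> continuous_on (ball a e \<times> ball b e) (\<lambda>x. F (fst x) (snd x)) \<and>
    (\<forall>u\<in>ball b e. (\<lambda>s. F s u) holomorphic_on ball a e) \<and> (\<forall>s\<in>ball a e. \<forall>u\<in>ball b e. F s u \<in> V)"
proof -
  obtain e where e: "e > 0" "continuous_on (ball a e \<times> ball b e) (\<lambda>x. F (fst x) (snd x))"
     "\<And>u. u \<in> ball b e \<Longrightarrow> (\<lambda>s. F s u) holomorphic_on ball a e"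
    using assms(1) unfolding nice_at_def by blast
  have "open ((\<lambda>x. F (fst x) (snd x)) -` V \<inter> (ball a e \<times> ball b e))"
    by (intro continuous_open_preimage[THEN open_Int[OF open_UNIV], simplified] continuous_on_open_vimage[THEN iffD1, rule_format] e assms open_Times open_ball)
  moreover have "(a, b) \<in> (\<lambda>x. F (fst x) (snd x)) -` V \<inter> (ball a e \<times> ball b e)"
    using assms e by auto
  ultimately obtain A B where AB: "open A" "open B" "a \<in> A" "b \<in> B"
     "A \<times> B \<subseteq> (\<lambda>x. F (fst x) (snd x)) -` V \<inter> (ball a e \<times> ball b e)"
    by (elim open_prod_elim) auto
  obtain r1 where r1: "r1 > 0" "ball a r1 \<subseteq> A" using AB by (meson open_contains_ball)
  obtain r2 where r2: "r2 > 0" "ball b r2 \<subseteq> B" using AB by (meson open_contains_ball)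
  define r where "r = min (min d e) (min r1 r2)"
  have r: "r > 0" "r \<le> d" "r \<le> e" "r \<le> r1" "r \<le> r2" using e r1 r2 assms by (auto simp: r_def)
  show ?thesis
  proof (intro exI[of _ r] conjI ballI)
    show "continuous_on (ball a r \<times> ball b r) (\<lambda>x. F (fst x) (snd x))"
      by (rule continuous_on_subset[OF e(2)]) (use r in auto)
    show "(\<lambda>s. F s u) holomorphic_on ball a r" if "u \<in> ball b r" for u
      by (rule holomorphic_on_subset[OF e(3)]) (use r that in auto)
    show "F s u \<in> V" if "s \<in> ball a r" "u \<in> ball b r" for s u
    proof -
      have "(s, u) \<in> A \<times> B" using that r r1 r2 by auto
      thus ?thesis using AB(5) by auto
    qed
  qed (use r in auto)
qed

lemma nice_at_shrink:
  assumes "nice_at F a b" "0 < d"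
  shows "\<exists>e>0. e \<le> d \<and> continuous_on (ball a e \<times> ball b e) (\<lambda>x. F (fst x) (snd x)) \<and>
    (\<forall>u\<in>ball b e. (\<lambda>s. F s u) holomorphic_on ball a e)"
  using nice_at_open[OF assms(1) open_UNIV _ assms(2)] by auto

lemma nice_at_const_fst:
  assumes "open U" "b \<in> U" "continuous_on U g"
  shows "nice_at (\<lambda>s u. g u) a b"
proof -
  obtain e where e: "e > 0" "ball b e \<subseteq> U" using assms by (meson open_contains_ball)
  have "continuous_on (ball a e \<times> ball b e) (g \<circ> snd)"
    by (intro continuous_on_compose continuous_intros continuous_on_subset[OF assms(3)]) (use e in auto)
  thus ?thesis unfolding nice_at_def using e by (intro exI[of _ e]) (auto simp: o_def)
qed

lemma nice_at_const [simp, intro]: "nice_at (\<lambda>s u. c) a b"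
  using nice_at_const_fst[OF open_UNIV] by auto

lemma nice_at_fst [simp, intro]: "nice_at (\<lambda>s u. s) a b"
  unfolding nice_at_def by (intro exI[of _ 1]) (auto intro!: continuous_intros)

lemma nice_at_binop:
  assumes "nice_at F a b" "nice_at G a b"
    and "\<And>S f g. continuous_on S f \<Longrightarrow> continuous_on S g \<Longrightarrow> continuous_on S (\<lambda>x::complex\<times>complex. h (f x) (g x))"
    and "\<And>S f g. f holomorphic_on S \<Longrightarrow> g holomorphic_on S \<Longrightarrow> (\<lambda>x. h (f x) (g x)) holomorphic_on S"
  shows "nice_at (\<lambda>s u. h (F s u) (G s u)) a b"
proof -
  obtain e1 where e1: "0 < e1" "continuous_on (ball a e1 \<times> ball b e1) (\<lambda>x. F (fst x) (snd x))"
    "\<And>u. u \<in> ball b e1 \<Longrightarrow> (\<lambda>s. F s u) holomorphic_on ball a e1"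
    using assms(1) unfolding nice_at_def by blast
  obtain e where e: "0 < e" "e \<le> e1" "continuous_on (ball a e \<times> ball b e) (\<lambda>x. G (fst x) (snd x))"
    "\<And>u. u \<in> ball b e \<Longrightarrow> (\<lambda>s. G s u) holomorphic_on ball a e"
    using nice_at_shrink[OF assms(2) e1(1)] by blast
  have "continuous_on (ball a e \<times> ball b e) (\<lambda>x. F (fst x) (snd x))"
    by (rule continuous_on_subset[OF e1(2)]) (use e in auto)
  moreover have "(\<lambda>s. F s u) holomorphic_on ball a e" if "u \<in> ball b e" for u
    by (rule holomorphic_on_subset[OF e1(3)]) (use e that in auto)
  ultimately show ?thesis unfolding nice_at_def
    using e by (intro exI[of _ e]) (auto intro!: assms(3,4))
qed

lemma nice_at_add [intro]: "nice_at F a b \<Longrightarrow> nice_at G a b \<Longrightarrow> nice_at (\<lambda>s u. F s u + G s u) a b"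
  and nice_at_diff [intro]: "nice_at F a b \<Longrightarrow> nice_at G a b \<Longrightarrow> nice_at (\<lambda>s u. F s u - G s u) a b"
  and nice_at_mult [intro]: "nice_at F a b \<Longrightarrow> nice_at G a b \<Longrightarrow> nice_at (\<lambda>s u. F s u * G s u) a b"
  by (erule (1) nice_at_binop; intro continuous_intros holomorphic_intros; assumption)+

lemma nice_at_power [intro]: "nice_at F a b \<Longrightarrow> nice_at (\<lambda>s u. F s u ^ n) a b"
  by (induction n) auto

lemma nice_at_compose:
  assumes "nice_at F a b" "open V" "F a b \<in> V" "g holomorphic_on V"
  shows "nice_at (\<lambda>s u. g (F s u)) a b"
proof -
  obtain e where e: "0 < e" "continuous_on (ball a e \<times> ball b e) (\<lambda>x. F (fst x) (snd x))"
    "\<And>u. u \<in> ball b e \<Longrightarrow> (\<lambda>s. F s u) holomorphic_on ball a e"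
    "\<And>s u. s \<in> ball a e \<Longrightarrow> u \<in> ball b e \<Longrightarrow> F s u \<in> V"
    using nice_at_open[OF assms(1-3) zero_less_one] by blast
  have "continuous_on (ball a e \<times> ball b e) (g \<circ> (\<lambda>x. F (fst x) (snd x)))"
    by (intro continuous_on_compose e continuous_on_subset[OF holomorphic_on_imp_continuous_on[OF assms(4)]])
       (use e(4) in auto)
  moreover have "(g \<circ> (\<lambda>s. F s u)) holomorphic_on ball a e" if "u \<in> ball b e" for u
    by (intro holomorphic_on_compose e that holomorphic_on_subset[OF assms(4)]) (use e(4) that in auto)
  ultimately show ?thesis unfolding nice_at_def using e(1) by (intro exI[of _ e]) (auto simp: o_def)
qed

lemma nice_at_csqrt:
  assumes "nice_at F a b" "F a b \<notin> \<real>\<^sub>\<le>\<^sub>0"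
  shows "nice_at (\<lambda>s u. csqrt (F s u)) a b"
  by (rule nice_at_compose[OF assms(1), of "- \<real>\<^sub>\<le>\<^sub>0"])
     (use assms(2) in \<open>auto intro!: holomorphic_intros open_Compl\<close>)

lemma nice_at_divide:
  assumes "nice_at F a b" "nice_at G a b" "G a b \<noteq> 0"
  shows "nice_at (\<lambda>s u. F s u / G s u) a b"
proof -
  have "nice_at (\<lambda>s u. inverse (G s u)) a b"
    by (rule nice_at_compose[OF assms(2), of "- {0}"])
       (use assms(3) in \<open>auto intro!: holomorphic_intros open_Compl\<close>)
  from nice_at_mult[OF assms(1) this] show ?thesis by (simp add: divide_inverse)
qed

text \<open>A Lebesgue number argument: the finite subcover is taken with half of each radius, and
  the other half leaves room for a common disc around every point of \<open>K\<close>.\<close>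

lemma nice_at_compact:
  assumes "compact K" "\<And>z. z \<in> K \<Longrightarrow> nice_at F z b"
  obtains e M where "0 < e" "\<And>z u. z \<in> K \<Longrightarrow> u \<in> ball b e \<Longrightarrow> (\<lambda>s. F s u) holomorphic_on ball z e"
    "\<And>z u s. z \<in> K \<Longrightarrow> u \<in> ball b e \<Longrightarrow> s \<in> ball z e \<Longrightarrow> norm (F s u) \<le> M"
proof -
  have "\<exists>e>0. (\<forall>u\<in>ball b e. (\<lambda>s. F s u) holomorphic_on ball z e) \<and>
           (\<forall>s\<in>ball z e. \<forall>u\<in>ball b e. norm (F s u) < norm (F z b) + 1)" if "z \<in> K" for z
    using nice_at_open[OF assms(2)[OF that] open_ball[of 0 "norm (F z b) + 1"] _ zero_less_one]
    by (auto simp: dist_norm)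
  then obtain e where e: "\<And>z. z \<in> K \<Longrightarrow> e z > 0"
    "\<And>z u. z \<in> K \<Longrightarrow> u \<in> ball b (e z) \<Longrightarrow> (\<lambda>s. F s u) holomorphic_on ball z (e z)"
    "\<And>z u s. z \<in> K \<Longrightarrow> u \<in> ball b (e z) \<Longrightarrow> s \<in> ball z (e z) \<Longrightarrow> norm (F s u) < norm (F z b) + 1"
    by metis
  obtain Z where Z: "Z \<subseteq> K" "finite Z" "K \<subseteq> (\<Union>z\<in>Z. ball z (e z / 2))"
    using compactE_image[OF assms(1), of K "\<lambda>z. ball z (e z / 2)"] e(1) by force
  define r where "r = Min (insert 1 ((\<lambda>z. e z / 2) ` Z))"
  define M where "M = Max (insert 0 ((\<lambda>z. norm (F z b) + 1) ` Z))"
  have r: "r > 0" using Z e(1) by (auto simp: r_def)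
  have rz: "r \<le> e z / 2" if "z \<in> Z" for z unfolding r_def using Z(2) that by (intro Min_le) auto
  have Mz: "norm (F z b) + 1 \<le> M" if "z \<in> Z" for z unfolding M_def using Z(2) that by (intro Max_ge) auto
  have *: "\<exists>z'\<in>Z. z' \<in> K \<and> ball z r \<subseteq> ball z' (e z') \<and> ball b r \<subseteq> ball b (e z')" if zK: "z \<in> K" for z
  proof -
    obtain z' where z': "z' \<in> Z" "dist z' z < e z' / 2" using subsetD[OF Z(3) zK] by auto
    have "ball z r \<subseteq> ball z' (e z')"
    proof
      fix x assume "x \<in> ball z r"
      thus "x \<in> ball z' (e z')" using z' rz[OF z'(1)] dist_triangle[of z' x z] by (auto)
    qed
    moreover have "ball b r \<subseteq> ball b (e z')" using rz[OF z'(1)] r by (intro subset_ball) auto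
    ultimately show ?thesis using z' Z by blast
  qed
  show ?thesis
  proof (rule that[OF r])
    fix z u assume zu: "z \<in> K" "u \<in> ball b r"
    obtain z' where z': "z' \<in> Z" "z' \<in> K" "ball z r \<subseteq> ball z' (e z')" "ball b r \<subseteq> ball b (e z')"
      using *[OF zu(1)] by blast
    show "(\<lambda>s. F s u) holomorphic_on ball z r"
      by (rule holomorphic_on_subset[OF e(2)[OF z'(2)] z'(3)]) (use zu z' in auto)
    fix s assume "s \<in> ball z r"
    hence "norm (F s u) < norm (F z' b) + 1" using zu z' by (intro e(3)) auto
    thus "norm (F s u) \<le> M" using Mz[OF z'(1)] by linarith
  qed
qed

subsection \<open>Quasi-powers\<close>

text \<open>Product rule for a quasi-power f B^n. Applied to a probability generating function,
  these are the first two factorial moments.\<close>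

lemma DERIV_mult_power_at_one:
  fixes f B \<phi> :: "complex \<Rightarrow> complex"
  assumes \<delta>: "\<delta> > 0" and f: "f holomorphic_on ball 1 \<delta>" and B: "B holomorphic_on ball 1 \<delta>"
    and eq: "\<And>u. u \<in> ball 1 \<delta> \<Longrightarrow> \<phi> u = f u * B u ^ n" and f1: "f 1 = 1" and B1: "B 1 = 1"
  shows "deriv \<phi> 1 = deriv f 1 + of_nat n * deriv B 1"
    "deriv (deriv \<phi>) 1 = deriv (deriv f) 1 + 2 * of_nat n * deriv f 1 * deriv B 1
       + of_nat n * (of_nat n - 1) * (deriv B 1)^2 + of_nat n * deriv (deriv B) 1"
proof -
  have df: "(f has_field_derivative deriv f u) (at u)" "(deriv f has_field_derivative deriv (deriv f) u) (at u)"
    if "u \<in> ball 1 \<delta>" for u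
    using that by (auto intro!: holomorphic_derivI[OF f] holomorphic_derivI[OF holomorphic_deriv[OF f]])
  have dB: "(B has_field_derivative deriv B u) (at u)" "(deriv B has_field_derivative deriv (deriv B) u) (at u)"
    if "u \<in> ball 1 \<delta>" for u
    using that by (auto intro!: holomorphic_derivI[OF B] holomorphic_derivI[OF holomorphic_deriv[OF B]])
  have ev: "eventually (\<lambda>v. v \<in> ball 1 \<delta>) (nhds u)" if "u \<in> ball 1 \<delta>" for u
    using that by (intro eventually_nhds_in_open) auto
  have d1: "deriv \<phi> u = deriv f u * B u ^ n + f u * (of_nat n * B u ^ (n - 1) * deriv B u)"
    if u: "u \<in> ball 1 \<delta>" for u
  proof -
    have "deriv \<phi> u = deriv (\<lambda>u. f u * B u ^ n) u"
      by (intro deriv_cong_ev eventually_mono[OF ev[OF u]] eq) auto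
    also have "\<dots> = deriv f u * B u ^ n + f u * (of_nat n * B u ^ (n - 1) * deriv B u)"
      by (intro DERIV_imp_deriv) (auto intro!: derivative_eq_intros df dB u)
    finally show ?thesis .
  qed
  show "deriv \<phi> 1 = deriv f 1 + of_nat n * deriv B 1"
    using d1[of 1] \<delta> f1 B1 by simp
  have one: "1 \<in> ball (1::complex) \<delta>" using \<delta> by simp
  have "deriv (deriv \<phi>) 1 = deriv (\<lambda>u. deriv f u * B u ^ n + f u * (of_nat n * B u ^ (n - 1) * deriv B u)) 1"
    by (intro deriv_cong_ev eventually_mono[OF ev[OF one]] d1) auto
  also have "\<dots> = deriv (deriv f) 1 * B 1 ^ n + deriv f 1 * (of_nat n * B 1 ^ (n - 1) * deriv B 1)
      + (deriv f 1 * (of_nat n * B 1 ^ (n - 1) * deriv B 1) + f 1 * (of_nat n * (of_nat (n - 1) * B 1 ^ (n - 1 - 1) * deriv B 1) * deriv B 1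
      + of_nat n * B 1 ^ (n - 1) * deriv (deriv B) 1))"
    by (intro DERIV_imp_deriv) (auto intro!: derivative_eq_intros df dB one simp: algebra_simps)
  also have "\<dots> = deriv (deriv f) 1 + 2 * of_nat n * deriv f 1 * deriv B 1
       + of_nat n * of_nat (n - 1) * (deriv B 1)^2 + of_nat n * deriv (deriv B) 1"
    by (simp add: f1 B1 algebra_simps power2_eq_square)
  also have "of_nat n * of_nat (n - 1) = (of_nat n * (of_nat n - 1) :: complex)"
    by (cases n) auto
  finally show "deriv (deriv \<phi>) 1 = deriv (deriv f) 1 + 2 * of_nat n * deriv f 1 * deriv B 1
       + of_nat n * (of_nat n - 1) * (deriv B 1)^2 + of_nat n * deriv (deriv B) 1" .
qed

lemma pgf_derivs:
  fixes P :: "'a pmf" and X :: "'a \<Rightarrow> nat"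
  assumes fin: "finite (set_pmf P)"
  defines "\<phi> \<equiv> \<lambda>u::complex. \<Sum>x\<in>set_pmf P. of_real (pmf P x) * u ^ X x"
  shows "deriv \<phi> 1 = of_real (measure_pmf.expectation P (\<lambda>x. real (X x)))"
    "deriv (deriv \<phi>) 1 = of_real (measure_pmf.expectation P (\<lambda>x. real (X x) ^ 2) - measure_pmf.expectation P (\<lambda>x. real (X x)))"
proof -
  have E: "measure_pmf.expectation P g = (\<Sum>x\<in>set_pmf P. pmf P x * g x)" for g :: "'a \<Rightarrow> real"
    by (subst integral_measure_pmf_real[OF fin]) (auto simp: mult_ac)
  have d1: "deriv \<phi> = (\<lambda>u. \<Sum>x\<in>set_pmf P. of_real (pmf P x) * (of_nat (X x) * u ^ (X x - 1)))"
    unfolding \<phi>_def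
    by (rule ext, rule DERIV_imp_deriv) (auto intro!: derivative_eq_intros sum.cong)
  show "deriv \<phi> 1 = of_real (measure_pmf.expectation P (\<lambda>x. real (X x)))"
    unfolding d1 E by simp
  have "deriv (deriv \<phi>) 1 = (\<Sum>x\<in>set_pmf P. of_real (pmf P x) * (of_nat (X x) * of_nat (X x - 1)))"
    unfolding d1 by (rule DERIV_imp_deriv) (auto intro!: derivative_eq_intros sum.cong)
  also have "\<dots> = (\<Sum>x\<in>set_pmf P. of_real (pmf P x * (real (X x) ^ 2) - pmf P x * real (X x)))"
  proof (intro sum.cong refl)
    fix x
    show "complex_of_real (pmf P x) * (of_nat (X x) * of_nat (X x - 1)) = of_real (pmf P x * (real (X x) ^ 2) - pmf P x * real (X x))"
      by (cases "X x") (simp_all add: algebra_simps power2_eq_square)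
  qed
  finally show "deriv (deriv \<phi>) 1 = of_real (measure_pmf.expectation P (\<lambda>x. real (X x) ^ 2) - measure_pmf.expectation P (\<lambda>x. real (X x)))"
    unfolding E by (simp add: sum_subtractf)
qed

text \<open>In place of an asymptotic form of the generating functions, only the upper bound K |B
  u|^n is demanded near 1. Since both sides are tied at u = 1, where the generating function and
  \<open>B\<close> have the value 1, this already determines mean and variance up to bounded errors
  and forces the normal limit.\<close>

locale quasi_powers =
  fixes P :: "nat \<Rightarrow> 'a pmf" and X :: "'a \<Rightarrow> nat" and B :: "complex \<Rightarrow> complex"
    and \<delta> K b1 b2 :: real
  assumes \<delta>: "\<delta> > 0" and holB: "B holomorphic_on ball 1 \<delta>" and B1: "B 1 = 1"
    and Bnz: "\<And>u. u \<in> ball 1 \<delta> \<Longrightarrow> B u \<noteq> 0"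
    and b1: "deriv B 1 = of_real b1" and b2: "deriv (deriv B) 1 = of_real b2"
    and fin: "eventually (\<lambda>n. finite (set_pmf (P n))) sequentially"
    and bound: "eventually (\<lambda>n. \<forall>u\<in>ball 1 \<delta>.
       norm (\<Sum>x\<in>set_pmf (P n). of_real (pmf (P n) x) * u ^ X x) \<le> K * norm (B u) ^ n) sequentially"
begin

definition "\<mu> n = measure_pmf.expectation (P n) (\<lambda>x. real (X x))"
definition "V n = measure_pmf.variance (P n) (\<lambda>x. real (X x))"
definition "\<sigma>2 = b2 + b1 - b1\<^sup>2"
definition "\<phi> n u = (\<Sum>x\<in>set_pmf (P n). complex_of_real (pmf (P n) x) * u ^ X x)"
definition "f n u = \<phi> n u / B u ^ n"

lemma ev_good:
  "eventually (\<lambda>n. finite (set_pmf (P n)) \<and> (\<forall>u\<in>ball 1 \<delta>. norm (f n u) \<le> K)) sequentially"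
  using fin bound
proof eventually_elim
  case (elim n)
  have "norm (f n u) \<le> K" if "u \<in> ball 1 \<delta>" for u
    using elim(2)[rule_format, OF that] Bnz[OF that] that
    by (simp add: f_def norm_divide norm_power divide_le_eq \<phi>_def del: mem_ball)
  thus ?case using elim by blast
qed

lemma f_hol: "f n holomorphic_on ball 1 \<delta>"
  unfolding f_def[abs_def] \<phi>_def by (intro holomorphic_intros holB) (use Bnz in auto)

lemma f_1: assumes "finite (set_pmf (P n))" shows "f n 1 = 1"
proof -
  have "(\<Sum>x\<in>set_pmf (P n). pmf (P n) x) = 1" by (rule sum_pmf_eq_1[OF assms]) auto
  thus ?thesis by (simp add: f_def \<phi>_def B1 flip: of_real_sum)
qed

text \<open>The errors \<open>r1\<close> and \<open>r2\<close> are the first two derivatives of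
  \<open>f n\<close> at 1, bounded independently of n by Cauchy's inequality. In the variance the
  terms in n^2 and the mixed terms 2 n r1 b1 cancel.\<close>

lemma f_derivs:
  assumes "finite (set_pmf (P n))" "\<forall>u\<in>ball 1 \<delta>. norm (f n u) \<le> K"
  obtains r1 r2 where "\<bar>r1\<bar> \<le> K / \<delta>" "\<bar>r2\<bar> \<le> 2 * K / \<delta>\<^sup>2" "\<mu> n = real n * b1 + r1"
    "V n = real n * \<sigma>2 + (r2 + r1 - r1\<^sup>2)"
proof -
  have eq: "\<phi> n u = f n u * B u ^ n" if "u \<in> ball 1 \<delta>" for u
    using Bnz[OF that] by (simp add: f_def)
  note D = DERIV_mult_power_at_one[OF \<delta> f_hol holB eq f_1[OF assms(1)] B1]
  have "\<phi> n = (\<lambda>u. \<Sum>x\<in>set_pmf (P n). complex_of_real (pmf (P n) x) * u ^ X x)"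
    by (rule ext) (simp add: \<phi>_def)
  note G = pgf_derivs[OF assms(1), of X, folded this]
  have var: "V n = measure_pmf.expectation (P n) (\<lambda>x. real (X x) ^ 2) - (\<mu> n)\<^sup>2"
    unfolding V_def \<mu>_def
    by (rule measure_pmf.variance_eq) (auto intro!: integrable_measure_pmf_finite assms)
  define r1 where "r1 = \<mu> n - real n * b1"
  define r2 where "r2 = V n + (\<mu> n)\<^sup>2 - \<mu> n - (2 * real n * r1 * b1 + real n * (real n - 1) * b1\<^sup>2 + real n * b2)"
  have d1: "deriv (f n) 1 = of_real r1"
    using D(1) G(1) unfolding b1 by (simp add: r1_def \<mu>_def algebra_simps)
  have phi2: "deriv (deriv (\<phi> n)) 1 = of_real (V n + (\<mu> n)\<^sup>2 - \<mu> n)"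
    using G(2) unfolding var by (simp add: \<mu>_def)
  hence d2: "deriv (deriv (f n)) 1 = of_real r2"
  proof -
    have "of_real (V n + (\<mu> n)\<^sup>2 - \<mu> n) = deriv (deriv (f n)) 1 +
        of_real (2 * real n * r1 * b1 + real n * (real n - 1) * b1\<^sup>2 + real n * b2)"
      using D(2) unfolding d1 b1 b2 phi2 by simp
    hence "deriv (deriv (f n)) 1 = of_real (V n + (\<mu> n)\<^sup>2 - \<mu> n) -
        of_real (2 * real n * r1 * b1 + real n * (real n - 1) * b1\<^sup>2 + real n * b2)"
      by (simp only: add_diff_cancel_right')
    thus ?thesis by (simp only: r2_def of_real_diff)
  qed
  show ?thesis
  proof (rule that)
    show "\<bar>r1\<bar> \<le> K / \<delta>"
      using Cauchy_inequality_open_ball[OF f_hol \<delta>, of n K 1] assms(2) d1 by simp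
    show "\<bar>r2\<bar> \<le> 2 * K / \<delta>\<^sup>2"
      using Cauchy_inequality_open_ball[OF f_hol \<delta>, of n K 2] assms(2) d2 by (simp add: numeral_2_eq_2)
    show "\<mu> n = real n * b1 + r1" by (simp add: r1_def)
    hence "\<mu> n = real n * b1 + r1" .
    thus "V n = real n * \<sigma>2 + (r2 + r1 - r1\<^sup>2)"
      unfolding r2_def \<sigma>2_def by (simp add: algebra_simps power2_eq_square)
  qed
qed

lemma mean_asymp: "eventually (\<lambda>n. \<bar>\<mu> n - real n * b1\<bar> \<le> K / \<delta>) sequentially"
  using ev_good
proof eventually_elim
  case (elim n)
  then obtain r1 where "\<bar>r1\<bar> \<le> K / \<delta>" "\<mu> n = real n * b1 + r1" using f_derivs[of n] by metis
  thus ?case by simp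
qed

lemma var_asymp: "eventually (\<lambda>n. \<bar>V n - real n * \<sigma>2\<bar> \<le> 2 * K / \<delta>\<^sup>2 + K / \<delta> + (K / \<delta>)\<^sup>2) sequentially"
  using ev_good
proof eventually_elim
  case (elim n)
  then obtain r1 r2 where r: "\<bar>r1\<bar> \<le> K / \<delta>" "\<bar>r2\<bar> \<le> 2 * K / \<delta>\<^sup>2" "V n = real n * \<sigma>2 + (r2 + r1 - r1\<^sup>2)"
    using f_derivs[of n] by metis
  have "\<bar>r1\<bar>\<^sup>2 \<le> (K / \<delta>)\<^sup>2" by (intro power_mono r) auto
  moreover have "\<bar>r2 + r1 - r1\<^sup>2\<bar> \<le> \<bar>r2\<bar> + \<bar>r1\<bar> + r1\<^sup>2"
    using zero_le_power2[of r1] by linarith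
  ultimately show ?case using r by simp
qed

lemma var_tendsto: "(\<lambda>n. V n / real n) \<longlonglongrightarrow> \<sigma>2"
proof -
  let ?C = "2 * K / \<delta>\<^sup>2 + K / \<delta> + (K / \<delta>)\<^sup>2"
  have "(\<lambda>n. V n / real n - \<sigma>2) \<longlonglongrightarrow> 0"
  proof (rule Lim_null_comparison)
    show "eventually (\<lambda>n. norm (V n / real n - \<sigma>2) \<le> ?C / real n) sequentially"
      using var_asymp eventually_gt_at_top[of 0]
    proof eventually_elim
      case (elim n)
      have "V n / real n - \<sigma>2 = (V n - real n * \<sigma>2) / real n" using elim by (simp add: field_simps)
      hence "norm (V n / real n - \<sigma>2) = \<bar>V n - real n * \<sigma>2\<bar> / real n" by simp
      thus ?case using divide_right_mono[OF elim(1), of "real n"] by simp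
    qed
    show "(\<lambda>n. ?C / real n) \<longlonglongrightarrow> 0" by real_asymp
  qed
  thus ?thesis by (simp add: LIM_zero_iff)
qed

lemma \<sigma>2_nonneg: "\<sigma>2 \<ge> 0"
proof (rule tendsto_lowerbound[OF var_tendsto])
  show "eventually (\<lambda>n. V n / real n \<ge> 0) sequentially"
    by (intro always_eventually allI divide_nonneg_nonneg) (auto simp: V_def)
qed auto

lemma f_tendsto_1:
  assumes u: "u \<longlonglongrightarrow> 1"
  shows "(\<lambda>n. f n (u n)) \<longlonglongrightarrow> 1"
proof -
  have "(\<lambda>n. f n (u n) - 1) \<longlonglongrightarrow> 0"
  proof (rule Lim_null_comparison)
    have "eventually (\<lambda>n. dist (u n) 1 < \<delta> / 2) sequentially"
      using tendstoD[OF u, of "\<delta> / 2"] \<delta> by simp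
    with ev_good show "eventually (\<lambda>n. norm (f n (u n) - 1) \<le> 2 * K * (norm (u n - 1) / \<delta>)) sequentially"
    proof eventually_elim
      case (elim n)
      have "norm (f n (1 + (u n - 1)) - (\<Sum>m<1. (deriv ^^ m) (\<lambda>s. f n (1 + s)) 0 / fact m * (u n - 1) ^ m)) \<le> 2 * K * (norm (u n - 1) / \<delta>) ^ 1"
      proof (rule Taylor_remainder_bound)
        have "(f n \<circ> (\<lambda>s. 1 + s)) holomorphic_on ball 0 \<delta>"
          by (intro holomorphic_on_compose holomorphic_intros holomorphic_on_subset[OF f_hol])
             (auto simp: dist_norm)
        thus "(\<lambda>s. f n (1 + s)) holomorphic_on ball 0 \<delta>" by (simp add: o_def)
        show "norm (f n (1 + w)) \<le> K" if "w \<in> ball 0 \<delta>" for w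
          using elim(1) that by (auto simp: dist_norm)
      qed (use \<delta> elim in \<open>auto simp: dist_norm\<close>)
      thus ?case using f_1 elim by simp
    qed
    have "(\<lambda>n. 2 * K * (norm (u n - 1) / \<delta>)) \<longlonglongrightarrow> 2 * K * (norm (1 - 1 :: complex) / \<delta>)"
      by (intro tendsto_intros u) (use \<delta> in auto)
    thus "(\<lambda>n. 2 * K * (norm (u n - 1) / \<delta>)) \<longlonglongrightarrow> 0" by simp
  qed
  thus ?thesis by (simp add: LIM_zero_iff)
qed

text \<open>\<open>b1\<close> and \<open>\<sigma>2\<close> arise as the first two cumulants of
  \<open>B\<close>, that is, as derivatives of log B(e^v) at v = 0. The radius is chosen such that
  B(e^v) stays within distance 1 of 1, where the principal logarithm is analytic.\<close>

lemma log_expansion: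
  obtains r C where "r > 0" "C \<ge> 0"
    "\<And>v :: complex. norm v \<le> r \<Longrightarrow> exp v \<in> ball 1 \<delta>"
    "\<And>v. norm v \<le> r \<Longrightarrow> exp (Ln (B (exp v))) = B (exp v)"
    "\<And>v. norm v \<le> r \<Longrightarrow> norm (Ln (B (exp v)) - (of_real b1 * v + of_real \<sigma>2 / 2 * v\<^sup>2)) \<le> C * norm v ^ 3"
proof -
  define h where "h = (\<lambda>v. Ln (B (exp v)))"
  have c1: "isCont (\<lambda>v::complex. exp v) 0" by (intro continuous_intros)
  have "((\<lambda>v::complex. exp v) \<longlongrightarrow> 1) (nhds 0)"
    using tendsto_exp[OF filterlim_ident[of "nhds (0::complex)"]] by simp
  hence "eventually (\<lambda>v::complex. exp v \<in> ball 1 \<delta>) (nhds 0)"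
    by (rule topological_tendstoD) (use \<delta> in auto)
  moreover have "isCont B 1"
    using holomorphic_on_imp_continuous_on[OF holB] \<delta> by (simp add: continuous_on_eq_continuous_at)
  hence "isCont (\<lambda>v. B (exp v)) 0" by (intro isCont_o2[OF c1]) auto
  hence "((\<lambda>v. B (exp v)) \<longlongrightarrow> 1) (nhds 0)"
    using B1 by (simp add: isCont_def tendsto_nhds_iff)
  hence "eventually (\<lambda>v. B (exp v) \<in> ball 1 1) (nhds 0)"
    by (rule topological_tendstoD) auto
  ultimately have "eventually (\<lambda>v. exp v \<in> ball 1 \<delta> \<and> B (exp v) \<in> ball 1 1) (nhds 0)"
    by (rule eventually_conj)
  then obtain r where r: "r > 0" "\<And>v :: complex. v \<in> ball 0 r \<Longrightarrow> exp v \<in> ball 1 \<delta>" "\<And>v. v \<in> ball 0 r \<Longrightarrow> B (exp v) \<in> ball 1 1"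
    unfolding eventually_nhds_metric by (auto simp: dist_commute)
  have np: "w \<notin> \<real>\<^sub>\<le>\<^sub>0" if "w \<in> ball 1 1" for w :: complex
  proof
    assume "w \<in> \<real>\<^sub>\<le>\<^sub>0"
    hence "Re w \<le> 0" by (auto elim!: nonpos_Reals_cases)
    moreover have "Re (1 - w) \<le> norm (1 - w)" by (rule complex_Re_le_cmod)
    ultimately show False using that by (simp add: dist_norm)
  qed
  have holh: "h holomorphic_on ball 0 r"
  proof -
    have "(B \<circ> exp) holomorphic_on ball 0 r"
      by (intro holomorphic_on_compose holomorphic_intros holomorphic_on_subset[OF holB]) (use r in auto)
    hence "(\<lambda>v. B (exp v)) holomorphic_on ball 0 r" by (simp add: o_def)
    thus ?thesis unfolding h_def by (intro holomorphic_intros) (use r np in auto)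
  qed
  have ev: "eventually (\<lambda>v. v \<in> ball 0 r) (nhds (0::complex))"
    using r by (intro eventually_nhds_in_open) auto
  have dB: "(B has_field_derivative deriv B u) (at u)" "(deriv B has_field_derivative deriv (deriv B) u) (at u)"
    if "u \<in> ball 1 \<delta>" for u
    using that by (auto intro!: holomorphic_derivI[OF holB] holomorphic_derivI[OF holomorphic_deriv[OF holB]])
  have one: "1 \<in> ball (1::complex) \<delta>" using \<delta> by simp
  have d1: "deriv h v = deriv B (exp v) * exp v / B (exp v)" if v: "v \<in> ball 0 r" for v
  proof -
    have "((\<lambda>v. B (exp v)) has_field_derivative deriv B (exp v) * exp v) (at v)"
      by (rule DERIV_chain2[where f = B and g = exp]) (use dB(1) r(2)[OF v] in auto)
    hence "((\<lambda>v. Ln (B (exp v))) has_field_derivative inverse (B (exp v)) * (deriv B (exp v) * exp v)) (at v)"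
      by (intro DERIV_chain2[where f = Ln and g = "\<lambda>v. B (exp v)"] has_field_derivative_Ln np r v)
    thus ?thesis unfolding h_def by (simp add: DERIV_imp_deriv divide_inverse mult_ac)
  qed
  have "deriv (deriv h) 0 = deriv (\<lambda>v. deriv B (exp v) * exp v / B (exp v)) 0"
    by (intro deriv_cong_ev eventually_mono[OF ev] d1) auto
  also have "\<dots> = of_real \<sigma>2"
  proof (rule DERIV_imp_deriv)
    have "((\<lambda>v. deriv B (exp v)) has_field_derivative (deriv (deriv B) (exp 0) * exp 0)) (at 0)"
      by (intro DERIV_chain2[where g = exp] dB(2)) (use one in \<open>auto intro!: derivative_eq_intros\<close>)
    moreover have "((\<lambda>v. B (exp v)) has_field_derivative (deriv B (exp 0) * exp 0)) (at 0)"
      by (intro DERIV_chain2[where g = exp] dB(1)) (use one in \<open>auto intro!: derivative_eq_intros\<close>)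
    ultimately show "((\<lambda>v. deriv B (exp v) * exp v / B (exp v)) has_field_derivative of_real \<sigma>2) (at 0)"
      by (auto intro!: derivative_eq_intros simp: B1 b1 b2 \<sigma>2_def power2_eq_square algebra_simps)
  qed
  finally have d2: "deriv (deriv h) 0 = of_real \<sigma>2" .
  have h0: "h 0 = 0" "deriv h 0 = of_real b1" using d1[of 0] r by (simp_all add: h_def B1 b1)
  have "continuous_on (cball 0 (r/2)) h"
    by (intro holomorphic_on_imp_continuous_on holomorphic_on_subset[OF holh]) (use r in auto)
  hence "bounded (h ` cball 0 (r/2))"
    by (intro compact_imp_bounded compact_continuous_image compact_cball)
  then obtain M where M: "\<And>v. v \<in> cball 0 (r/2) \<Longrightarrow> norm (h v) \<le> M" unfolding bounded_iff by blast
  have M0: "M \<ge> 0" using M[of 0] r h0 by simp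
  show ?thesis
  proof (rule that[of "r/4" "2 * M / (r/2)^3"])
    fix v :: complex assume v: "norm v \<le> r / 4"
    hence vr: "v \<in> ball 0 r" using r by auto
    show "exp v \<in> ball 1 \<delta>" "exp (Ln (B (exp v))) = B (exp v)"
      using r(2)[OF vr] Bnz by auto
    have "norm (h v - (\<Sum>m<3. (deriv ^^ m) h 0 / fact m * v ^ m)) \<le> 2 * M * (norm v / (r/2)) ^ 3"
      by (rule Taylor_remainder_bound[OF holomorphic_on_subset[OF holh]]) (use r v M in auto)
    also have "(\<Sum>m<3. (deriv ^^ m) h 0 / fact m * v ^ m) = of_real b1 * v + of_real \<sigma>2 / 2 * v\<^sup>2"
      by (simp add: numeral_3_eq_3 h0 d2 power2_eq_square)
    also have "2 * M * (norm v / (r/2)) ^ 3 = 2 * M / (r/2)^3 * norm v ^ 3"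
      by (simp add: power_divide power_mult_distrib)
    finally show "norm (Ln (B (exp v)) - (of_real b1 * v + of_real \<sigma>2 / 2 * v\<^sup>2)) \<le> 2 * M / (r/2)^3 * norm v ^ 3"
      by (simp add: h_def)
  qed (use r M0 in auto)
qed

text \<open>Levy's continuity theorem at v = i t / sqrt (V n). The characteristic function is f n
  (e^v) times the exponential of n log B(e^v) - \<mu> v. The linear terms leave a bounded multiple
  of v, the quadratic term tends to - t^2 / 2 because n v^2 converges, and the cubic remainder is n
  v^2 times a null sequence.\<close>

theorem clt:
  assumes "\<sigma>2 \<noteq> 0"
  shows "weak_conv_m (\<lambda>n. distr (measure_pmf (P n)) borel (\<lambda>x. (real (X x) - \<mu> n) / sqrt (V n))) std_normal_distribution"
proof (rule levy_continuity)
  show "real_distribution (distr (measure_pmf (P n)) borel (\<lambda>x. (real (X x) - \<mu> n) / sqrt (V n)))" for n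
    by (rule prob_space.real_distribution_distr[OF measure_pmf.prob_space_axioms]) simp
  show "real_distribution std_normal_distribution" by (rule real_dist_normal_dist)
  fix t :: real
  have \<sigma>: "\<sigma>2 > 0" using \<sigma>2_nonneg assms by simp
  define s where "s n = sqrt (V n)" for n
  define v where "v n = \<i> * of_real (t / s n)" for n
  have V_inf: "filterlim V at_top sequentially"
  proof -
    have "filterlim (\<lambda>n. V n / real n * real n) at_top sequentially"
      by (rule filterlim_tendsto_pos_mult_at_top[OF var_tendsto \<sigma> filterlim_real_sequentially])
    moreover have "eventually (\<lambda>n. V n / real n * real n = V n) sequentially"
      using eventually_gt_at_top[of 0] by eventually_elim simp
    ultimately show ?thesis by (rule filterlim_cong[OF refl refl, THEN iffD1, rotated])
  qed
  have s_inf: "filterlim s at_top sequentially"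
    unfolding s_def by (rule filterlim_compose[OF sqrt_at_top V_inf])
  have ts: "(\<lambda>n. t / s n) \<longlonglongrightarrow> 0"
    by (rule tendsto_divide_0[OF tendsto_const]) (rule filterlim_at_top_imp_at_infinity[OF s_inf])
  have v0: "v \<longlonglongrightarrow> 0"
    unfolding v_def using tendsto_mult_right_zero[OF tendsto_of_real[OF ts, where 'a = complex, simplified]] by simp
  have u1: "(\<lambda>n. exp (v n)) \<longlonglongrightarrow> 1" using tendsto_exp[OF v0] by simp
  have nV: "(\<lambda>n. real n / V n) \<longlonglongrightarrow> 1 / \<sigma>2"
    using tendsto_inverse[OF var_tendsto assms] by (simp add: inverse_eq_divide)
  have ev_pos: "eventually (\<lambda>n. V n > 0) sequentially" using V_inf by (simp add: filterlim_at_top_dense)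
  have nv2: "(\<lambda>n. of_nat n * (v n)\<^sup>2) \<longlonglongrightarrow> of_real (- t\<^sup>2 / \<sigma>2)"
  proof (rule Lim_transform_eventually)
    have "(\<lambda>n. - t\<^sup>2 * (real n / V n)) \<longlonglongrightarrow> - t\<^sup>2 * (1 / \<sigma>2)"
      by (intro tendsto_mult_left nV)
    thus "(\<lambda>n. complex_of_real (- t\<^sup>2 * (real n / V n))) \<longlonglongrightarrow> of_real (- t\<^sup>2 / \<sigma>2)"
      by (intro tendsto_of_real) simp
    show "eventually (\<lambda>n. complex_of_real (- t\<^sup>2 * (real n / V n)) = of_nat n * (v n)\<^sup>2) sequentially"
      using ev_pos
    proof eventually_elim
      case (elim n)
      have "(t / s n)\<^sup>2 = t\<^sup>2 / V n" using elim by (simp add: s_def power_divide)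
      hence "(v n)\<^sup>2 = - of_real (t\<^sup>2 / V n)"
        by (simp only: v_def power_mult_distrib power2_i of_real_power[symmetric]) simp
      thus ?case by simp
    qed
  qed
  obtain r C where rC: "r > 0" "C \<ge> 0"
    "\<And>v :: complex. norm v \<le> r \<Longrightarrow> exp v \<in> ball 1 \<delta>"
    "\<And>v. norm v \<le> r \<Longrightarrow> exp (Ln (B (exp v))) = B (exp v)"
    "\<And>v. norm v \<le> r \<Longrightarrow> norm (Ln (B (exp v)) - (of_real b1 * v + of_real \<sigma>2 / 2 * v\<^sup>2)) \<le> C * norm v ^ 3"
    using log_expansion by blast
  define h where "h w = Ln (B (exp w))" for w
  define e where "e n = h (v n) - (of_real b1 * v n + of_real \<sigma>2 / 2 * (v n)\<^sup>2)" for n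
  have ev_r: "eventually (\<lambda>n. norm (v n) \<le> r) sequentially"
    using tendstoD[OF v0 rC(1)] by eventually_elim simp
  have ne: "(\<lambda>n. of_nat n * e n) \<longlonglongrightarrow> 0"
  proof (rule Lim_null_comparison)
    show "eventually (\<lambda>n. norm (of_nat n * e n) \<le> C * norm (of_nat n * (v n)\<^sup>2) * norm (v n)) sequentially"
      using ev_r
    proof eventually_elim
      case (elim n)
      have "norm (of_nat n * e n) \<le> real n * (C * norm (v n) ^ 3)"
        unfolding e_def h_def norm_mult using rC(5)[OF elim] by (intro mult_mono) auto
      thus ?case by (simp add: norm_mult norm_power power2_eq_square power3_eq_cube mult_ac)
    qed
    show "(\<lambda>n. C * norm (of_nat n * (v n)\<^sup>2) * norm (v n)) \<longlonglongrightarrow> 0"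
      by (rule tendsto_eq_intros tendsto_norm nv2 v0 refl)+ simp
  qed
  have mean0: "(\<lambda>n. of_real (\<mu> n - real n * b1) * v n) \<longlonglongrightarrow> 0"
  proof (rule Lim_null_comparison)
    show "eventually (\<lambda>n. norm (of_real (\<mu> n - real n * b1) * v n) \<le> K / \<delta> * norm (v n)) sequentially"
      using mean_asymp by eventually_elim (simp only: norm_mult norm_of_real mult_right_mono norm_ge_zero)
    show "(\<lambda>n. K / \<delta> * norm (v n)) \<longlonglongrightarrow> 0"
      by (rule tendsto_mult_right_zero) (rule tendsto_norm_zero[OF v0])
  qed
  have "(\<lambda>n. f n (exp (v n)) * exp (of_nat n * e n + of_real \<sigma>2 / 2 * (of_nat n * (v n)\<^sup>2)
            - of_real (\<mu> n - real n * b1) * v n)) \<longlonglongrightarrow>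
        1 * exp (0 + of_real \<sigma>2 / 2 * of_real (- t\<^sup>2 / \<sigma>2) - 0)"
    by (intro tendsto_mult f_tendsto_1 u1 tendsto_exp tendsto_add tendsto_diff ne mean0 nv2 tendsto_const)
  also have "1 * exp (0 + of_real \<sigma>2 / 2 * of_real (- t\<^sup>2 / \<sigma>2) - 0) = char std_normal_distribution t"
    using assms by (simp add: char_std_normal_distribution exp_of_real[symmetric])
  finally have main: "(\<lambda>n. f n (exp (v n)) * exp (of_nat n * e n + of_real \<sigma>2 / 2 * (of_nat n * (v n)\<^sup>2)
            - of_real (\<mu> n - real n * b1) * v n)) \<longlonglongrightarrow> char std_normal_distribution t" .
  show "(\<lambda>n. char (distr (measure_pmf (P n)) borel (\<lambda>x. (real (X x) - \<mu> n) / sqrt (V n))) t)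
           \<longlonglongrightarrow> char std_normal_distribution t"
  proof (rule Lim_transform_eventually[OF main])
    show "eventually (\<lambda>n. f n (exp (v n)) * exp (of_nat n * e n + of_real \<sigma>2 / 2 * (of_nat n * (v n)\<^sup>2)
            - of_real (\<mu> n - real n * b1) * v n) =
          char (distr (measure_pmf (P n)) borel (\<lambda>x. (real (X x) - \<mu> n) / sqrt (V n))) t) sequentially"
      using ev_good ev_r
    proof eventually_elim
      case (elim n)
      have "char (distr (measure_pmf (P n)) borel (\<lambda>x. (real (X x) - \<mu> n) / sqrt (V n))) t
           = measure_pmf.expectation (P n) (\<lambda>x. iexp (t * ((real (X x) - \<mu> n) / s n)))"
        unfolding char_def s_def by (subst integral_distr) auto
      also have "\<dots> = (\<Sum>x\<in>set_pmf (P n). of_real (pmf (P n) x) * iexp (t * ((real (X x) - \<mu> n) / s n)))"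
        using elim by (subst integral_measure_pmf[of "set_pmf (P n)"]) (auto simp: scaleR_conv_of_real)
      also have "\<dots> = (\<Sum>x\<in>set_pmf (P n). of_real (pmf (P n) x) * (exp (v n) ^ X x * exp (- of_real (\<mu> n) * v n)))"
      proof (intro sum.cong refl arg_cong2[of _ _ _ _ "(*)"])
        fix x
        have "\<i> * of_real (t * ((real (X x) - \<mu> n) / s n)) = of_nat (X x) * v n + - of_real (\<mu> n) * v n"
          by (simp add: v_def algebra_simps diff_divide_distrib)
        thus "iexp (t * ((real (X x) - \<mu> n) / s n)) = exp (v n) ^ X x * exp (- of_real (\<mu> n) * v n)"
          by (simp only: exp_add exp_of_nat_mult)
      qed
      also have "\<dots> = \<phi> n (exp (v n)) * exp (- of_real (\<mu> n) * v n)"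
        by (simp add: \<phi>_def sum_distrib_right mult.assoc)
      also have "\<phi> n (exp (v n)) = f n (exp (v n)) * B (exp (v n)) ^ n"
        using Bnz[OF rC(3)[OF elim(2)]] by (simp add: f_def)
      also have "B (exp (v n)) ^ n = exp (of_nat n * h (v n))"
        using rC(4)[OF elim(2)] by (simp add: h_def exp_of_nat_mult)
      also have "f n (exp (v n)) * exp (of_nat n * h (v n)) * exp (- of_real (\<mu> n) * v n) =
          f n (exp (v n)) * exp (of_nat n * h (v n) + - of_real (\<mu> n) * v n)"
        by (simp only: exp_add mult.assoc)
      also have "of_nat n * h (v n) + - of_real (\<mu> n) * v n = of_nat n * e n + of_real \<sigma>2 / 2 * (of_nat n * (v n)\<^sup>2)
            - of_real (\<mu> n - real n * b1) * v n"
        by (simp add: e_def algebra_simps)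
      finally show ?case by simp
    qed
  qed
qed

end

subsection \<open>Generating functions of the levels\<close>

definition terms_at :: "nat \<Rightarrow> nat \<Rightarrow> nat \<Rightarrow> lterm set" where
  "terms_at k l n = {t. closed_at l t \<and> (\<forall>m\<in>node_levels l t. m \<le> k) \<and> term_size t = n}"

lemma finite_terms_at [simp, intro]: "finite (terms_at k l n)"
  by (rule finite_subset[OF _ finite_closed_at[of l n]]) (auto simp: terms_at_def)

lemma closed_terms_of_size_eq: "closed_terms_of_size k n = terms_at k 0 n"
  by (auto simp: closed_terms_of_size_def closed_terms_def terms_at_def)

lemma term_size_pos: "term_size t > 0"
  by (cases t) auto

lemma terms_at_0 [simp]: "terms_at k l 0 = {}"
  using term_size_pos by (force simp: terms_at_def)

lemma root_level_in_node_levels: "l \<in> node_levels l t"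
  by (cases t) auto

lemma terms_at_eq_empty: "l > k \<Longrightarrow> terms_at k l n = {}"
  using root_level_in_node_levels by (fastforce simp: terms_at_def)

lemma terms_at_Suc:
  assumes "l \<le> k"
  shows "terms_at k l (Suc n) = (if n = 0 then Var ` {1..l} else {}) \<union> Abs ` terms_at k (Suc l) n \<union>
     (\<Union>i\<in>{..n}. (\<lambda>(s, t). App s t) ` (terms_at k l i \<times> terms_at k l (n - i)))" (is "?A = ?B")
proof (intro equalityI subsetI)
  fix t assume t: "t \<in> ?A"
  show "t \<in> ?B"
  proof (cases t)
    case (App s1 s2)
    hence "s1 \<in> terms_at k l (term_size s1)" "s2 \<in> terms_at k l (n - term_size s1)" "term_size s1 \<le> n"
      using t by (auto simp: terms_at_def)
    thus ?thesis using App by auto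
  qed (use t in \<open>auto simp: terms_at_def image_iff\<close>)
next
  fix t assume "t \<in> ?B"
  thus "t \<in> ?A" using assms by (auto simp: terms_at_def split: if_splits)
qed

text \<open>The summand is arbitrary so that one decomposition of the terms serves both the
  multiplicative weight u^leaves and the additive count of leaves.\<close>

lemma sum_terms_at_Suc:
  fixes g :: "lterm \<Rightarrow> 'b::comm_monoid_add"
  assumes "l \<le> k"
  shows "(\<Sum>t\<in>terms_at k l (Suc n). g t) = (if n = 0 then \<Sum>i\<in>{1..l}. g (Var i) else 0) +
     (\<Sum>t\<in>terms_at k (Suc l) n. g (Abs t)) +
     (\<Sum>i\<le>n. \<Sum>s\<in>terms_at k l i. \<Sum>t\<in>terms_at k l (n - i). g (App s t))"
proof -
  let ?V = "if n = 0 then Var ` {1..l} else {}" and ?A = "Abs ` terms_at k (Suc l) n"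
  let ?C = "\<lambda>i. (\<lambda>(s, t). App s t) ` (terms_at k l i \<times> terms_at k l (n - i))"
  have "(\<Sum>t\<in>terms_at k l (Suc n). g t) = sum g ?V + sum g ?A + sum g (\<Union>i\<in>{..n}. ?C i)"
    unfolding terms_at_Suc[OF assms]
    by (subst sum.union_disjoint, simp, simp, force, subst sum.union_disjoint, simp, simp, force) simp
  also have "sum g ?V = (if n = 0 then \<Sum>i\<in>{1..l}. g (Var i) else 0)"
    by (auto simp: sum.reindex inj_on_def)
  also have "sum g ?A = (\<Sum>t\<in>terms_at k (Suc l) n. g (Abs t))"
    by (auto simp: sum.reindex inj_on_def)
  also have "sum g (\<Union>i\<in>{..n}. ?C i) = (\<Sum>i\<le>n. sum g (?C i))"
    by (intro sum.UNION_disjoint) (auto, auto simp: terms_at_def)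
  also have "\<dots> = (\<Sum>i\<le>n. \<Sum>s\<in>terms_at k l i. \<Sum>t\<in>terms_at k l (n - i). g (App s t))"
  proof (rule sum.cong[OF refl])
    fix i
    show "sum g (?C i) = (\<Sum>s\<in>terms_at k l i. \<Sum>t\<in>terms_at k l (n - i). g (App s t))"
      by (subst sum.reindex) (auto simp: inj_on_def sum.cartesian_product case_prod_unfold)
  qed
  finally show ?thesis .
qed

definition level_gf :: "nat \<Rightarrow> nat \<Rightarrow> complex \<Rightarrow> nat \<Rightarrow> complex fps" where
  "level_gf k L u l = Abs_fps (\<lambda>n. \<Sum>t\<in>terms_at k l n. u ^ leaves_at_from L l t)"

text \<open>Formally the derivative of \<open>level_gf\<close> in u at u = 1. At level 0 its
  coefficients, divided by the number of terms, are the means.\<close>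

definition level_count_gf :: "nat \<Rightarrow> nat \<Rightarrow> nat \<Rightarrow> complex fps" where
  "level_count_gf k L l = Abs_fps (\<lambda>n. \<Sum>t\<in>terms_at k l n. of_nat (leaves_at_from L l t))"

lemma H_gf_eq_level_gf: "H_gf k L u = level_gf k L u 0"
  by (simp add: H_gf_def level_gf_def closed_terms_of_size_eq leaves_at_def)

lemma level_gf_eq_0: "l > k \<Longrightarrow> level_gf k L u l = 0"
  by (simp add: level_gf_def terms_at_eq_empty fps_eq_iff)

lemma leaves_at_from_eq_0: "l > L \<Longrightarrow> leaves_at_from L l t = 0"
  by (induction t arbitrary: l) auto

lemma level_count_gf_eq_0: "l > L \<Longrightarrow> level_count_gf k L l = 0"
  by (simp add: level_count_gf_def leaves_at_from_eq_0 fps_eq_iff)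

lemma fps_nth_mult_atMost: "fps_nth (f * g) n = (\<Sum>i\<le>n. fps_nth f i * fps_nth g (n - i))"
  by (simp add: fps_mult_nth atLeast0AtMost)

lemma level_gf_rec:
  assumes "l \<le> k"
  shows "level_gf k L u l = fps_const (of_nat l * (if l = L then u else 1)) * fps_X + fps_X * level_gf k L u (Suc l) +
           fps_X * (level_gf k L u l * level_gf k L u l)"
proof (rule fps_ext)
  fix n
  show "fps_nth (level_gf k L u l) n = fps_nth (fps_const (of_nat l * (if l = L then u else 1)) * fps_X + fps_X * level_gf k L u (Suc l) +
           fps_X * (level_gf k L u l * level_gf k L u l)) n"
  proof (cases n)
    case 0
    thus ?thesis by (simp add: level_gf_def)
  next
    case (Suc m)
    have "fps_nth (level_gf k L u l * level_gf k L u l) m = (\<Sum>i\<le>m. \<Sum>s\<in>terms_at k l i. \<Sum>t\<in>terms_at k l (m - i).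
        u ^ leaves_at_from L l (App s t))"
      by (simp add: fps_nth_mult_atMost level_gf_def sum_product power_add)
    thus ?thesis unfolding Suc
      by (simp add: sum_terms_at_Suc[OF assms] level_gf_def)
  qed
qed

text \<open>A marked leaf of an application lies in one of the two halves, the other half being an
  arbitrary term: a product rule, and the recurrence becomes linear.\<close>

lemma level_count_gf_rec:
  assumes "l \<le> k"
  shows "level_count_gf k L l = fps_const (of_nat l * (if l = L then 1 else 0)) * fps_X + fps_X * level_count_gf k L (Suc l) +
           2 * fps_X * (level_gf k L 1 l * level_count_gf k L l)"
proof (rule fps_ext)
  fix n
  show "fps_nth (level_count_gf k L l) n = fps_nth (fps_const (of_nat l * (if l = L then 1 else 0)) * fps_X + fps_X * level_count_gf k L (Suc l) +
           2 * fps_X * (level_gf k L 1 l * level_count_gf k L l)) n"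
  proof (cases n)
    case 0
    thus ?thesis by (simp add: level_count_gf_def)
  next
    case (Suc m)
    have "fps_nth (2 * (level_gf k L 1 l * level_count_gf k L l)) m =
        fps_nth (level_count_gf k L l * level_gf k L 1 l + level_gf k L 1 l * level_count_gf k L l) m"
    proof -
      have "2 * (A * B) = B * A + A * B" for A B :: "complex fps" unfolding mult_2 by (simp add: mult.commute)
      thus ?thesis by (rule arg_cong)
    qed
    also have "\<dots> = (\<Sum>i\<le>m. \<Sum>s\<in>terms_at k l i. \<Sum>t\<in>terms_at k l (m - i).
        of_nat (leaves_at_from L l (App s t)))"
      unfolding fps_add_nth fps_nth_mult_atMost level_count_gf_def level_gf_def
      unfolding fps_nth_Abs_fps sum_product sum.distrib[symmetric] by simp
    finally have prod: "fps_nth (2 * (level_gf k L 1 l * level_count_gf k L l)) m = \<dots>" .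
    have "2 * fps_X * (level_gf k L 1 l * level_count_gf k L l) = fps_X * (2 * (level_gf k L 1 l * level_count_gf k L l))"
      by (simp only: mult.assoc mult.left_commute)
    hence "fps_nth (2 * fps_X * (level_gf k L 1 l * level_count_gf k L l)) (Suc m) =
        fps_nth (2 * (level_gf k L 1 l * level_count_gf k L l)) m"
      by (simp only: fps_X_mult_nth) simp
    thus ?thesis unfolding Suc fps_add_nth prod
      by (simp add: sum_terms_at_Suc[OF assms] level_count_gf_def)
  qed
qed

definition root_gf :: "nat \<Rightarrow> nat \<Rightarrow> complex \<Rightarrow> nat \<Rightarrow> complex fps" where
  "root_gf k L u l = 1 - 2 * fps_X * level_gf k L u l"

text \<open>Completing the square in the quadratic equation of the level, after multiplication by 4
  z. The series of the next level occurs linearly and is rewritten by its own root; this produces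
  the nesting.\<close>

lemma root_gf_square:
  assumes "l \<le> k"
  shows "root_gf k L u l * root_gf k L u l =
    1 - 2 * fps_X - fps_const (4 * (of_nat l * (if l = L then u else 1))) * fps_X ^ 2 + 2 * fps_X * root_gf k L u (Suc l)"
proof -
  define A where "A = level_gf k L u l"
  define c where "c = fps_const (of_nat l * (if l = L then u else 1))"
  have "A = c * fps_X + fps_X * level_gf k L u (Suc l) + fps_X * (A * A)"
    unfolding A_def c_def by (rule level_gf_rec[OF assms])
  hence "fps_X * (A * A) = A - c * fps_X - fps_X * level_gf k L u (Suc l)" by (simp add: algebra_simps)
  hence "4 * fps_X * (fps_X * (A * A)) = 4 * fps_X * (A - c * fps_X - fps_X * level_gf k L u (Suc l))" by simp
  moreover have "fps_const (4 * (of_nat l * (if l = L then u else 1))) = 4 * c"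
    unfolding c_def by (simp flip: fps_const_mult numeral_fps_const)
  ultimately show ?thesis
    unfolding root_gf_def A_def[symmetric] by (simp add: algebra_simps power2_eq_square)
qed

text \<open>No node lies beyond level k. At level k the value 1 cancels the linear terms - 2 z + 2
  z, which is why \<open>rad a z 0\<close> has no linear term.\<close>

lemma root_gf_Suc: "root_gf k L u (Suc k) = 1"
  by (simp add: root_gf_def level_gf_eq_0)

lemma root_gf_nth_0 [simp]: "fps_nth (root_gf k L u l) 0 = 1"
  by (simp add: root_gf_def mult.assoc)

lemma level_count_gf_mult_root_gf:
  assumes "l \<le> k"
  shows "level_count_gf k L l * root_gf k L 1 l =
     fps_const (of_nat l * (if l = L then 1 else 0)) * fps_X + fps_X * level_count_gf k L (Suc l)"
  using level_count_gf_rec[OF assms, of L] unfolding root_gf_def by (simp add: algebra_simps)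

text \<open>
  The index \<open>i\<close> counts from the deepest level, so \<open>rad (wt k L u) z i\<close> is the square of the value of
  \<open>root_gf k L u (k - i)\<close> at \<open>z\<close>.
\<close>

fun rad :: "(nat \<Rightarrow> complex) \<Rightarrow> complex \<Rightarrow> nat \<Rightarrow> complex" where
  "rad a z 0 = 1 - 4 * a 0 * z\<^sup>2"
| "rad a z (Suc i) = 1 - 2 * z - 4 * a (Suc i) * z\<^sup>2 + 2 * z * csqrt (rad a z i)"

definition wt :: "nat \<Rightarrow> nat \<Rightarrow> complex \<Rightarrow> nat \<Rightarrow> complex" where
  "wt k L u i = of_nat (k - i) * (if k - i = L then u else 1)"

text \<open>Formal power series have no zero divisors, so two square roots of \<open>F\<close>
  differ by a sign, and the constant term 1 decides it.\<close>

lemma has_fps_expansion_csqrt: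
  assumes F: "f has_fps_expansion F" and G: "G * G = F" "fps_nth G 0 = 1"
  shows "(\<lambda>z. csqrt (f z)) has_fps_expansion G"
proof -
  have F0: "fps_nth F 0 = 1" using G by auto
  have f0: "f 0 = 1" using has_fps_expansion_imp_0_eq_fps_nth_0[OF F] F0 by simp
  obtain s where s: "open s" "0 \<in> s" "f holomorphic_on s"
    using has_fps_expansion_imp_holomorphic[OF F] by metis
  define s' where "s' = s \<inter> f -` (- \<real>\<^sub>\<le>\<^sub>0)"
  have "open s'" unfolding s'_def
    using continuous_open_preimage[OF holomorphic_on_imp_continuous_on[OF s(3)] s(1), of "- \<real>\<^sub>\<le>\<^sub>0"]
    by (simp add: open_Compl)
  moreover have "0 \<in> s'" using s f0 by (auto simp: s'_def)
  moreover have "(\<lambda>z. csqrt (f z)) holomorphic_on s'"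
    by (intro holomorphic_intros holomorphic_on_subset[OF s(3)]) (auto simp: s'_def)
  ultimately have Q: "(\<lambda>z. csqrt (f z)) has_fps_expansion fps_expansion (\<lambda>z. csqrt (f z)) 0"
    by (rule has_fps_expansion_fps_expansion)
  define Q' where "Q' = fps_expansion (\<lambda>z. csqrt (f z)) 0"
  have "(\<lambda>z. csqrt (f z) * csqrt (f z)) has_fps_expansion Q' * Q'"
    unfolding Q'_def by (intro has_fps_expansion_mult Q)
  moreover have "(\<lambda>z. csqrt (f z) * csqrt (f z)) = f"
    by (rule ext) (metis power2_csqrt power2_eq_square)
  ultimately have "Q' * Q' = F" using F fps_expansion_unique_complex by metis
  hence "(G - Q') * (G + Q') = 0" using G(1) by (simp add: algebra_simps)
  moreover have "fps_nth Q' 0 = 1"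
    using has_fps_expansion_imp_0_eq_fps_nth_0[OF Q] f0 by (simp add: Q'_def)
  hence "fps_nth (G + Q') 0 \<noteq> 0" using G(2) by simp
  hence "G + Q' \<noteq> 0" by (metis fps_zero_nth)
  ultimately have "G = Q'" by simp
  thus ?thesis using Q by (simp add: Q'_def)
qed

lemma csqrt_rad_has_fps_expansion:
  assumes "i \<le> k"
  shows "(\<lambda>z. csqrt (rad (wt k L u) z i)) has_fps_expansion root_gf k L u (k - i)"
  using assms
proof (induction i)
  case 0
  have "(\<lambda>z. rad (wt k L u) z 0) has_fps_expansion 1 - fps_const (4 * wt k L u 0) * fps_X ^ 2"
    by (auto intro!: fps_expansion_intros)
  moreover have "root_gf k L u k * root_gf k L u k = 1 - fps_const (4 * wt k L u 0) * fps_X ^ 2"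
    using root_gf_square[of k k L u] by (simp add: root_gf_Suc wt_def)
  ultimately show ?case by (intro has_fps_expansion_csqrt[of _ "1 - fps_const (4 * wt k L u 0) * fps_X ^ 2"]) auto
next
  case (Suc i)
  have IH: "(\<lambda>z. csqrt (rad (wt k L u) z i)) has_fps_expansion root_gf k L u (k - i)" using Suc by simp
  let ?F = "1 - 2 * fps_X - fps_const (4 * wt k L u (Suc i)) * fps_X ^ 2 + 2 * fps_X * root_gf k L u (k - i)"
  have "(\<lambda>z. rad (wt k L u) z (Suc i)) has_fps_expansion ?F"
    unfolding rad.simps by (intro fps_expansion_intros IH)
  moreover have "root_gf k L u (k - Suc i) * root_gf k L u (k - Suc i) = ?F"
    using root_gf_square[of "k - Suc i" k L u] Suc.prems by (simp add: wt_def Suc_diff_Suc)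
  ultimately show ?case by (intro has_fps_expansion_csqrt[of _ ?F]) auto
qed

text \<open>For s = csqrt w one has |1 - s| = |1 - w| / |1 + s|. The assumption forces Re w to be at
  least \<sigma>^2, hence Re s to be at least \<sigma>, which bounds the denominator below by 1 +
  \<sigma>.\<close>

lemma norm_one_minus_csqrt_le:
  assumes "norm (1 - w) \<le> 1 - \<sigma>\<^sup>2" "0 \<le> \<sigma>"
  shows "norm (1 - csqrt w) \<le> 1 - \<sigma>"
proof -
  define s where "s = csqrt w"
  have sq: "s\<^sup>2 = w" by (simp add: s_def)
  have "Re w \<ge> \<sigma>\<^sup>2" using complex_Re_le_cmod[of "1 - w"] assms(1) by simp
  moreover have "Re w = (Re s)\<^sup>2 - (Im s)\<^sup>2" using sq by (metis Re_power2)
  ultimately have "\<sigma>\<^sup>2 \<le> (Re s)\<^sup>2" using zero_le_power2[of "Im s"] by linarith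
  moreover have "Re s \<ge> 0" using csqrt_principal[of w] by (auto simp: s_def)
  ultimately have "\<sigma> \<le> Re s" by (rule power2_le_imp_le)
  hence "1 + \<sigma> \<le> norm (1 + s)" using complex_Re_le_cmod[of "1 + s"] by simp
  hence "norm (1 - s) * (1 + \<sigma>) \<le> norm (1 - s) * norm (1 + s)" by (intro mult_left_mono) auto
  also have "\<dots> = norm (1 - w)" unfolding sq[symmetric] by (simp add: algebra_simps power2_eq_square flip: norm_mult)
  also have "\<dots> \<le> (1 - \<sigma>) * (1 + \<sigma>)" using assms(1) by (simp add: algebra_simps power2_eq_square)
  finally show ?thesis using assms(2) by (simp add: s_def)
qed

lemma not_nonpos_Reals_if_near_one:
  assumes "norm (1 - w :: complex) < 1"
  shows "w \<notin> \<real>\<^sub>\<le>\<^sub>0"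
proof
  assume "w \<in> \<real>\<^sub>\<le>\<^sub>0"
  hence "Re w \<le> 0" by (auto elim!: nonpos_Reals_cases)
  thus False using complex_Re_le_cmod[of "1 - w"] assms by simp
qed

text \<open>
  The numbers \<open>\<sigma> i\<close> are the values of the nested square roots at the positive real point \<open>r\<close>.
\<close>

locale real_tower =
  fixes a \<sigma> :: "nat \<Rightarrow> real" and r :: real and n :: nat
  assumes r_pos: "r > 0"
    and a_nonneg: "\<And>i. i \<le> n \<Longrightarrow> a i \<ge> 0"
    and \<sigma>_nonneg: "\<And>i. i \<le> n \<Longrightarrow> \<sigma> i \<ge> 0"
    and \<sigma>_0: "(\<sigma> 0)\<^sup>2 = 1 - 4 * a 0 * r\<^sup>2"
    and \<sigma>_Suc: "\<And>i. i < n \<Longrightarrow> (\<sigma> (Suc i))\<^sup>2 = 1 - 2 * r - 4 * a (Suc i) * r\<^sup>2 + 2 * r * \<sigma> i"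
begin

abbreviation "ca \<equiv> \<lambda>i. complex_of_real (a i)"

lemma rad_of_real:
  "i \<le> n \<Longrightarrow> rad ca (of_real r) i = of_real ((\<sigma> i)\<^sup>2)"
proof (induction i)
  case 0
  show ?case by (simp add: \<sigma>_0)
next
  case (Suc i)
  hence "rad ca (of_real r) i = of_real ((\<sigma> i)\<^sup>2)" by simp
  hence "csqrt (rad ca (of_real r) i) = of_real (\<sigma> i)"
    using \<sigma>_nonneg[of i] Suc.prems by (simp add: csqrt_of_real_nonneg del: of_real_power)
  thus ?case using \<sigma>_Suc[of i] Suc.prems by simp
qed

lemma csqrt_rad_of_real: "i \<le> n \<Longrightarrow> csqrt (rad ca (of_real r) i) = of_real (\<sigma> i)"
  using \<sigma>_nonneg[of i] by (simp add: rad_of_real csqrt_of_real_nonneg del: of_real_power)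

lemma \<sigma>_le_1: "i \<le> n \<Longrightarrow> \<sigma> i \<le> 1"
proof (induction i)
  case 0
  have "(\<sigma> 0)\<^sup>2 \<le> 1\<^sup>2" using \<sigma>_0 a_nonneg[of 0] by simp
  thus ?case by (rule power2_le_imp_le) simp
next
  case (Suc i)
  hence "2 * r * \<sigma> i \<le> 2 * r * 1" using r_pos by (intro mult_left_mono) auto
  moreover have "0 \<le> 4 * a (Suc i) * r\<^sup>2" using a_nonneg[of "Suc i"] Suc.prems by simp
  ultimately have "(\<sigma> (Suc i))\<^sup>2 \<le> 1\<^sup>2" using \<sigma>_Suc[of i] Suc.prems by simp
  thus ?case by (rule power2_le_imp_le) simp
qed

lemma rad_bounds_aux:
  assumes "norm z \<le> r" "i \<le> n" "r * norm (1 - rad ca z i) \<le> norm z * (1 - (\<sigma> i)\<^sup>2)"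
  shows "norm (1 - rad ca z i) \<le> 1 - (\<sigma> i)\<^sup>2" "norm (1 - csqrt (rad ca z i)) \<le> 1 - \<sigma> i"
proof -
  have "(\<sigma> i)\<^sup>2 \<le> 1" using \<sigma>_le_1[OF assms(2)] \<sigma>_nonneg[OF assms(2)] by (simp add: power_le_one)
  hence "norm z * (1 - (\<sigma> i)\<^sup>2) \<le> r * (1 - (\<sigma> i)\<^sup>2)" using assms(1) by (intro mult_right_mono) auto
  hence "r * norm (1 - rad ca z i) \<le> r * (1 - (\<sigma> i)\<^sup>2)" using assms(3) by linarith
  thus 1: "norm (1 - rad ca z i) \<le> 1 - (\<sigma> i)\<^sup>2" using r_pos by simp
  show "norm (1 - csqrt (rad ca z i)) \<le> 1 - \<sigma> i"
    by (rule norm_one_minus_csqrt_le[OF 1 \<sigma>_nonneg[OF assms(2)]])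
qed

text \<open>A bound of Schwarz type: 1 - rad vanishes at 0, so its size at \<open>r\<close> can be
  scaled by |z| / r. This factor gives a strict inequality inside the disc even for an index with
  \<open>\<sigma> i = 0\<close>.\<close>

lemma rad_bound_scaled:
  assumes z: "norm z \<le> r"
  shows "i \<le> n \<Longrightarrow> r * norm (1 - rad ca z i) \<le> norm z * (1 - (\<sigma> i)\<^sup>2)"
proof (induction i)
  case 0
  have "r * norm (1 - rad ca z 0) = 4 * a 0 * r * (norm z * norm z)"
    using a_nonneg[of 0] by (simp add: norm_mult norm_power power2_eq_square)
  also have "\<dots> \<le> 4 * a 0 * r * (norm z * r)"
    using z a_nonneg[of 0] r_pos by (intro mult_left_mono) auto
  also have "4 * a 0 * r * (norm z * r) = norm z * (1 - (\<sigma> 0)\<^sup>2)"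
    unfolding \<sigma>_0 by (simp add: power2_eq_square)
  finally show ?case .
next
  case (Suc i)
  hence b: "norm (1 - csqrt (rad ca z i)) \<le> 1 - \<sigma> i" using rad_bounds_aux(2)[OF z] by simp
  have eq: "1 - rad ca z (Suc i) = 2 * z * (1 - csqrt (rad ca z i)) + 4 * ca (Suc i) * z\<^sup>2"
    by (simp add: algebra_simps)
  have "norm (1 - rad ca z (Suc i)) \<le> norm (2 * z * (1 - csqrt (rad ca z i))) + norm (4 * ca (Suc i) * z\<^sup>2)"
    unfolding eq by (rule norm_triangle_ineq)
  also have "\<dots> = 2 * norm z * norm (1 - csqrt (rad ca z i)) + 4 * a (Suc i) * (norm z * norm z)"
    using a_nonneg[OF Suc.prems] by (simp add: norm_mult norm_power power2_eq_square)
  also have "\<dots> \<le> 2 * norm z * (1 - \<sigma> i) + 4 * a (Suc i) * (norm z * r)"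
    using a_nonneg[OF Suc.prems] z b by (intro add_mono mult_left_mono) auto
  finally have "r * norm (1 - rad ca z (Suc i)) \<le> r * (2 * norm z * (1 - \<sigma> i) + 4 * a (Suc i) * (norm z * r))"
    using r_pos by (intro mult_left_mono) auto
  also have "\<dots> = norm z * (1 - (\<sigma> (Suc i))\<^sup>2)"
    unfolding \<sigma>_Suc[OF Suc_le_lessD[OF Suc.prems]] by (simp add: algebra_simps power2_eq_square)
  finally show ?case .
qed

lemma rad_bounds:
  assumes "norm z \<le> r" "i \<le> n"
  shows "norm (1 - rad ca z i) \<le> 1 - (\<sigma> i)\<^sup>2" "norm (1 - csqrt (rad ca z i)) \<le> 1 - \<sigma> i"
  using rad_bounds_aux[OF assms rad_bound_scaled[OF assms]] by auto

lemma rad_notin_nonpos_Reals: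
  assumes "norm z \<le> r" "i \<le> n" "norm z < r \<or> \<sigma> i > 0"
  shows "rad ca z i \<notin> \<real>\<^sub>\<le>\<^sub>0"
proof (rule not_nonpos_Reals_if_near_one)
  show "norm (1 - rad ca z i) < 1"
  proof (cases "\<sigma> i > 0")
    case True
    have "(\<sigma> i)\<^sup>2 > 0" using True by simp
    thus ?thesis using rad_bounds(1)[OF assms(1,2)] by linarith
  next
    case False
    have "r * norm (1 - rad ca z i) \<le> norm z * (1 - (\<sigma> i)\<^sup>2)" by (rule rad_bound_scaled[OF assms(1,2)])
    also have "\<dots> \<le> norm z * 1" by (intro mult_left_mono) auto
    also have "\<dots> < r * 1" using False assms(3) by simp
    finally show ?thesis using r_pos by (simp del: mult_1_right)
  qed
qed

text \<open>If the radicand were real and nonpositive, the two summands of 1 - rad would attain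
  their bounds and be positive real multiples of each other's values at \<open>r\<close>. The
  quadratic one then gives z^2 = r^2, so z = - r, and the other one makes the preceding root 2 -
  \<sigma>, too far from 1. Index 0 is left out: its radicand is even in z and takes the same value
  at - r as at r.\<close>

lemma rad_notin_nonpos_Reals_boundary:
  assumes z: "norm z \<le> r" "z \<noteq> of_real r" and i: "Suc i \<le> n" and a: "a i > 0" "a (Suc i) > 0"
  shows "rad ca z (Suc i) \<notin> \<real>\<^sub>\<le>\<^sub>0"
proof
  assume "rad ca z (Suc i) \<in> \<real>\<^sub>\<le>\<^sub>0"
  then obtain x where x: "rad ca z (Suc i) = of_real x" "x \<le> 0" by (auto elim!: nonpos_Reals_cases)
  define p where "p = 2 * z * (1 - csqrt (rad ca z i))"
  define q where "q = 4 * ca (Suc i) * z\<^sup>2"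
  define A where "A = 2 * r * (1 - \<sigma> i)"
  define B where "B = 4 * a (Suc i) * r\<^sup>2"
  have b: "norm (1 - csqrt (rad ca z i)) \<le> 1 - \<sigma> i" using rad_bounds(2)[OF z(1)] i by simp
  have p: "norm p \<le> A"
    unfolding p_def A_def using z b r_pos by (simp add: norm_mult mult_mono)
  have "(norm z)\<^sup>2 \<le> r\<^sup>2" using z by (intro power_mono) auto
  hence q: "norm q \<le> B"
    unfolding q_def B_def using a by (simp add: norm_mult norm_power)
  have AB: "A + B = 1 - (\<sigma> (Suc i))\<^sup>2" unfolding A_def B_def using \<sigma>_Suc[of i] i by (simp add: algebra_simps)
  have "p + q = 1 - rad ca z (Suc i)" by (simp add: p_def q_def algebra_simps)
  hence pq: "p + q = of_real (1 - x)" by (simp only: x of_real_diff of_real_1)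
  have "Re p + Re q = 1 - x" using pq by (metis Re_complex_of_real plus_complex.simps(1))
  moreover have "Re p \<le> norm p" "Re q \<le> norm q" by (rule complex_Re_le_cmod)+
  ultimately have eqs: "Re p = A" "Re q = B" "norm p = A" "norm q = B"
    using p q AB x(2) zero_le_power2[of "\<sigma> (Suc i)"] by linarith+
  have "Im q = 0" using eqs cmod_power2[of q] by simp
  hence "q = of_real B" using eqs by (simp add: complex_eq_iff)
  hence "z\<^sup>2 = of_real (r\<^sup>2)" using a unfolding q_def B_def by simp
  hence "(z - of_real r) * (z + of_real r) = 0" by (simp add: algebra_simps power2_eq_square)
  hence zr: "z = - of_real r" using z(2) by (simp add: eq_neg_iff_add_eq_0)
  have "Im p = 0" using eqs cmod_power2[of p] by simp
  hence "p = of_real A" using eqs by (simp add: complex_eq_iff)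
  hence "- of_real (2 * r) * (1 - csqrt (rad ca z i)) = of_real (2 * r) * of_real (1 - \<sigma> i)"
    unfolding p_def A_def zr by simp
  hence "of_real (2 * r) * (csqrt (rad ca z i) - 1) = (of_real (2 * r) * of_real (1 - \<sigma> i) :: complex)"
    by (simp add: algebra_simps)
  hence "csqrt (rad ca z i) = of_real (2 - \<sigma> i)" using r_pos by simp
  hence rd: "rad ca z i = of_real ((2 - \<sigma> i)\<^sup>2)" by (metis of_real_power power2_csqrt)
  have \<sigma>: "0 \<le> \<sigma> i" "\<sigma> i \<le> 1" using \<sigma>_nonneg \<sigma>_le_1 i by auto
  have "(\<sigma> i)\<^sup>2 < 1"
  proof (cases i)
    case 0
    thus ?thesis using \<sigma>_0 a r_pos by simp
  next
    case (Suc m)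
    have "0 < 4 * a i * r\<^sup>2" using a r_pos by simp
    moreover have "2 * r * \<sigma> m \<le> 2 * r * 1" using \<sigma>_le_1[of m] i Suc r_pos by (intro mult_left_mono) auto
    ultimately show ?thesis using \<sigma>_Suc[of m] Suc i by simp
  qed
  hence "\<sigma> i \<noteq> 1" by auto
  hence s1: "\<sigma> i < 1" using \<sigma> by simp
  have "\<bar>1 - (2 - \<sigma> i)\<^sup>2\<bar> \<le> 1 - (\<sigma> i)\<^sup>2"
  proof -
    have "norm (1 - rad ca z i) = \<bar>1 - (2 - \<sigma> i)\<^sup>2\<bar>"
      unfolding rd by (metis norm_of_real of_real_1 of_real_diff)
    thus ?thesis using rad_bounds(1)[OF z(1), of i] i by simp
  qed
  hence "2 * (1 - \<sigma> i)\<^sup>2 \<le> 0" by (simp add: power2_eq_square algebra_simps)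
  thus False using s1 by simp
qed

end

text \<open>
  The difference quotient of \<open>rad\<close>, without a division by \<open>z - z'\<close>.
\<close>

fun rad_quot :: "(nat \<Rightarrow> complex) \<Rightarrow> complex \<Rightarrow> complex \<Rightarrow> nat \<Rightarrow> complex" where
  "rad_quot a z z' 0 = - 4 * a 0 * (z + z')"
| "rad_quot a z z' (Suc i) = - 2 - 4 * a (Suc i) * (z + z') + 2 * csqrt (rad a z i)
     + 2 * z' * rad_quot a z z' i / (csqrt (rad a z i) + csqrt (rad a z' i))"

lemma rad_diff:
  assumes "\<And>m. m < i \<Longrightarrow> csqrt (rad a z m) + csqrt (rad a z' m) \<noteq> 0"
  shows "rad a z i - rad a z' i = (z - z') * rad_quot a z z' i"
  using assms
proof (induction i)
  case 0
  show ?case by (simp add: algebra_simps power2_eq_square)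
next
  case (Suc i)
  let ?s = "csqrt (rad a z i)" and ?s' = "csqrt (rad a z' i)"
  have nz: "?s + ?s' \<noteq> 0" using Suc.prems by auto
  have "(?s - ?s') * (?s + ?s') = ?s\<^sup>2 - ?s'\<^sup>2" by (simp add: algebra_simps power2_eq_square)
  also have "\<dots> = (z - z') * rad_quot a z z' i" using Suc by simp
  finally have ss: "?s - ?s' = (z - z') * rad_quot a z z' i / (?s + ?s')" using nz by (simp add: field_simps)
  have "rad a z (Suc i) - rad a z' (Suc i) =
     (z - z') * (- 2 - 4 * a (Suc i) * (z + z') + 2 * ?s) + 2 * z' * (?s - ?s')"
    by (simp add: algebra_simps power2_eq_square)
  thus ?case unfolding ss by (simp add: algebra_simps)
qed

text \<open>On the diagonal \<open>rad_quot\<close> is the derivative of the radicand, and as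
  \<sigma> is at most 1 it is a sum of nonpositive terms. So the first zero of a radicand is
  simple.\<close>

lemma (in real_tower) rad_quot_neg:
  assumes "i \<le> n" "\<And>m. m < i \<Longrightarrow> \<sigma> m > 0" "a 0 > 0"
  shows "\<exists>d<0. rad_quot ca (of_real r) (of_real r) i = of_real d"
  using assms(1,2)
proof (induction i)
  case 0
  show ?case using assms(3) r_pos by (intro exI[of _ "- 4 * a 0 * (r + r)"]) auto
next
  case (Suc i)
  then obtain d where d: "d < 0" "rad_quot ca (of_real r) (of_real r) i = of_real d" by auto
  have s: "csqrt (rad ca (of_real r) i) = of_real (\<sigma> i)" "\<sigma> i > 0" "\<sigma> i \<le> 1" "a (Suc i) \<ge> 0"
    using csqrt_rad_of_real[of i] Suc.prems \<sigma>_le_1[of i] a_nonneg[of "Suc i"] by auto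
  let ?d = "- 2 - 4 * a (Suc i) * (r + r) + 2 * \<sigma> i + 2 * r * d / (\<sigma> i + \<sigma> i)"
  have "2 * r * d / (\<sigma> i + \<sigma> i) < 0" using r_pos d s by (intro divide_neg_pos mult_pos_neg) auto
  moreover have "4 * a (Suc i) * (r + r) \<ge> 0" using s r_pos by simp
  ultimately have "?d < 0" using s by linarith
  thus ?case using s d by (intro exI[of _ ?d]) auto
qed

section \<open>Regularity of the radicands and of their difference quotients\<close>

lemma nice_at_rad:
  assumes "nice_at Z s0 u0" "\<And>i. nice_at (\<lambda>s u. a u i) s0 u0"
    and "\<And>m. m < i \<Longrightarrow> rad (a u0) (Z s0 u0) m \<notin> \<real>\<^sub>\<le>\<^sub>0"
  shows "nice_at (\<lambda>s u. rad (a u) (Z s u) i) s0 u0"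
  using assms(3)
proof (induction i)
  case 0
  show ?case unfolding rad.simps by (intro nice_at_const nice_at_diff nice_at_mult nice_at_power assms)
next
  case (Suc i)
  hence "nice_at (\<lambda>s u. csqrt (rad (a u) (Z s u) i)) s0 u0" by (intro nice_at_csqrt) auto
  thus ?case unfolding rad.simps
    by (intro nice_at_const nice_at_diff nice_at_add nice_at_mult nice_at_power assms)
qed

lemma csqrt_Re_pos: "w \<notin> \<real>\<^sub>\<le>\<^sub>0 \<Longrightarrow> Re (csqrt w) > 0"
proof -
  assume w: "w \<notin> \<real>\<^sub>\<le>\<^sub>0"
  have "Re (csqrt w) \<noteq> 0"
  proof
    assume 0: "Re (csqrt w) = 0"
    have "w = (csqrt w)\<^sup>2" by simp
    also have "csqrt w = \<i> * of_real (Im (csqrt w))" using 0 by (simp add: complex_eq_iff)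
    finally have "w = of_real (- (Im (csqrt w))\<^sup>2)" by (simp add: power_mult_distrib)
    hence "w \<in> \<real>\<^sub>\<le>\<^sub>0" by (metis neg_le_0_iff_le nonpos_Reals_of_real_iff zero_le_power2)
    thus False using w by simp
  qed
  moreover have "Re (csqrt w) \<ge> 0" using csqrt_principal[of w] by auto
  ultimately show ?thesis by simp
qed

lemma csqrt_add_nonzero:
  assumes "v \<notin> \<real>\<^sub>\<le>\<^sub>0" "w \<notin> \<real>\<^sub>\<le>\<^sub>0"
  shows "csqrt v + csqrt w \<noteq> 0"
  using csqrt_Re_pos[OF assms(1)] csqrt_Re_pos[OF assms(2)]
  by (metis add_pos_pos less_irrefl plus_complex.simps(1) zero_complex.simps(1))

lemma nice_at_rad_quot:
  assumes Z: "nice_at Z s0 u0" "nice_at Z' s0 u0" and a: "\<And>i. nice_at (\<lambda>s u. a u i) s0 u0"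
    and "\<And>m. m < i \<Longrightarrow> rad (a u0) (Z s0 u0) m \<notin> \<real>\<^sub>\<le>\<^sub>0" "\<And>m. m < i \<Longrightarrow> rad (a u0) (Z' s0 u0) m \<notin> \<real>\<^sub>\<le>\<^sub>0"
  shows "nice_at (\<lambda>s u. rad_quot (a u) (Z s u) (Z' s u) i) s0 u0"
  using assms(4,5)
proof (induction i)
  case 0
  show ?case unfolding rad_quot.simps by (intro nice_at_const nice_at_add nice_at_mult Z a)
next
  case (Suc i)
  have S: "nice_at (\<lambda>s u. csqrt (rad (a u) (Z s u) i)) s0 u0" "nice_at (\<lambda>s u. csqrt (rad (a u) (Z' s u) i)) s0 u0"
    using Suc.prems by (intro nice_at_csqrt nice_at_rad Z a; simp)+
  have D: "nice_at (\<lambda>s u. rad_quot (a u) (Z s u) (Z' s u) i) s0 u0" using Suc by simp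
  show ?case unfolding rad_quot.simps
    by (intro nice_at_const nice_at_diff nice_at_add nice_at_mult nice_at_divide Z a S D csqrt_add_nonzero)
       (use Suc.prems in auto)
qed

lemma nice_at_fixed:
  assumes "nice_at F a b"
  obtains e where "e > 0" "(\<lambda>s. F s b) holomorphic_on ball a e"
  using assms unfolding nice_at_def by auto

lemma nice_at_eventually:
  assumes "nice_at F a b" "open V" "F a b \<in> V"
  obtains e where "e > 0" "\<And>s u. s \<in> ball a e \<Longrightarrow> u \<in> ball b e \<Longrightarrow> F s u \<in> V"
  using nice_at_open[OF assms zero_less_one] by blast

lemma nice_at_isCont_fst:
  assumes "nice_at F a b"
  shows "isCont (\<lambda>s. F s b) a"
proof -
  obtain e where e: "e > 0" "(\<lambda>s. F s b) holomorphic_on ball a e" by (rule nice_at_fixed[OF assms])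
  thus ?thesis using holomorphic_on_imp_continuous_on[OF e(2)] by (simp add: continuous_on_eq_continuous_at)
qed

lemma rad_has_field_derivative:
  assumes "\<And>m. m < i \<Longrightarrow> rad a z m \<notin> \<real>\<^sub>\<le>\<^sub>0"
  shows "((\<lambda>v. rad a v i) has_field_derivative rad_quot a z z i) (at z)"
  unfolding has_field_derivative_iff
proof (rule Lim_transform_eventually)
  have nd: "nice_at (\<lambda>s u. rad_quot a s z i) z 0"
    by (rule nice_at_rad_quot[where Z = "\<lambda>s u. s" and Z' = "\<lambda>s u. z" and a = "\<lambda>u. a"]) (use assms in auto)
  show "((\<lambda>v. rad_quot a v z i) \<longlongrightarrow> rad_quot a z z i) (at z)"
    using nice_at_isCont_fst[OF nd] by (simp add: isCont_def)
  have "\<exists>e>0. \<forall>v\<in>ball z e. \<forall>m<i. rad a v m \<notin> \<real>\<^sub>\<le>\<^sub>0"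
  proof -
    have "eventually (\<lambda>v. \<forall>m\<in>{..<i}. rad a v m \<notin> \<real>\<^sub>\<le>\<^sub>0) (nhds z)"
    proof (rule eventually_ball_finite)
      show "\<forall>m\<in>{..<i}. eventually (\<lambda>v. rad a v m \<notin> \<real>\<^sub>\<le>\<^sub>0) (nhds z)"
      proof
        fix m assume m: "m \<in> {..<i}"
        have "nice_at (\<lambda>s u. rad a s m) z 0"
          by (rule nice_at_rad[where Z = "\<lambda>s u. s" and a = "\<lambda>u. a"]) (use assms m in auto)
        moreover have "rad a z m \<in> - \<real>\<^sub>\<le>\<^sub>0" using assms m by auto
        ultimately obtain e where "e > 0" "\<And>s u. s \<in> ball z e \<Longrightarrow> u \<in> ball (0::complex) e \<Longrightarrow> rad a s m \<in> - \<real>\<^sub>\<le>\<^sub>0"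
          using nice_at_eventually[of "\<lambda>s u. rad a s m" z 0 "- \<real>\<^sub>\<le>\<^sub>0"] by (metis open_Compl closed_nonpos_Reals_complex)
        hence "\<forall>v\<in>ball z e. rad a v m \<notin> \<real>\<^sub>\<le>\<^sub>0" by (metis Compl_iff centre_in_ball)
        thus "eventually (\<lambda>v. rad a v m \<notin> \<real>\<^sub>\<le>\<^sub>0) (nhds z)"
          using \<open>e > 0\<close> by (metis (mono_tags, lifting) dist_commute eventually_nhds_metric mem_ball)
      qed
    qed auto
    thus ?thesis unfolding eventually_nhds_metric by (auto simp: dist_commute)
  qed
  then obtain e where e: "e > 0" "\<And>v m. v \<in> ball z e \<Longrightarrow> m < i \<Longrightarrow> rad a v m \<notin> \<real>\<^sub>\<le>\<^sub>0" by blast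
  have "eventually (\<lambda>v. v \<in> ball z e) (at z)" using e(1) by (intro eventually_at_in_open') auto
  moreover have "eventually (\<lambda>v. v \<noteq> z) (at z)" by (simp add: eventually_at_filter)
  ultimately show "eventually (\<lambda>v. rad_quot a v z i = (rad a v i - rad a z i) / (v - z)) (at z)"
  proof eventually_elim
    case (elim v)
    have "rad a v i - rad a z i = (v - z) * rad_quot a v z i"
      using assms e(2)[OF elim(1)] by (intro rad_diff csqrt_add_nonzero) auto
    thus ?case using elim(2) by simp
  qed
qed

section \<open>From the nested roots to the dominant singularity\<close>

definition real_wt :: "nat \<Rightarrow> nat \<Rightarrow> real \<Rightarrow> nat \<Rightarrow> real" where
  "real_wt k L u i = real (k - i) * (if k - i = L then u else 1)"

lemma wt_of_real: "wt k L (of_real u) = (\<lambda>i. complex_of_real (real_wt k L u i))"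
  by (rule ext) (simp add: wt_def real_wt_def)

text \<open>\<open>rho_tilde\<close> is defined by the series itself, while analyticity is known for
  the closed form of the outermost root. Passing from the root to the series is a shift of
  coefficients, which preserves the radius of convergence.\<close>

lemma level_gf_eval:
  assumes r: "r > 0" and hol: "(\<lambda>z. csqrt (rad (wt k L u) z k)) holomorphic_on ball 0 r"
  shows "ereal r \<le> fps_conv_radius (level_gf k L u 0)"
    and "\<And>z. norm z < r \<Longrightarrow> 1 - 2 * z * eval_fps (level_gf k L u 0) z = csqrt (rad (wt k L u) z k)"
proof -
  define f where "f = (\<lambda>z. csqrt (rad (wt k L u) z k))"
  define F where "F = root_gf k L u 0"
  define H where "H = level_gf k L u 0"
  have fF: "f has_fps_expansion F"
    using csqrt_rad_has_fps_expansion[of k k L u] unfolding f_def F_def by simp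
  have holf: "f holomorphic_on eball 0 (ereal r)" using hol unfolding f_def by simp
  have "f has_fps_expansion fps_expansion f 0"
    by (rule has_fps_expansion_fps_expansion[of "ball 0 r"]) (use r hol in \<open>auto simp: f_def\<close>)
  hence FE: "F = fps_expansion f 0" using fF fps_expansion_unique_complex by blast
  have cF: "ereal r \<le> fps_conv_radius F" unfolding FE by (rule conv_radius_fps_expansion[OF holf])
  have "F = 1 - 2 * fps_X * H" by (simp add: F_def H_def root_gf_def)
  hence H: "fps_const 2 * H = fps_shift 1 (1 - F)"
    by (simp add: fps_eq_iff mult.assoc numeral_fps_const)
  have "ereal r \<le> fps_conv_radius (1 - F)" using cF fps_conv_radius_diff[of 1 F] by simp
  also have "\<dots> = fps_conv_radius (fps_const 2 * H)" unfolding H by simp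
  also have "\<dots> = fps_conv_radius H" by (rule fps_conv_radius_cmult_left) auto
  finally have cH: "ereal r \<le> fps_conv_radius H" .
  thus "ereal r \<le> fps_conv_radius (level_gf k L u 0)" by (simp add: H_def)
  fix z :: complex assume z: "norm z < r"
  have zF: "ereal (norm z) < fps_conv_radius F" "ereal (norm z) < fps_conv_radius H"
    using z cF cH by (meson ereal_less_eq(3) less_le_trans less_ereal.simps(1))+
  have "F = 1 - fps_const 2 * fps_X * H" using \<open>F = 1 - 2 * fps_X * H\<close> by (simp add: numeral_fps_const)
  moreover have "ereal (norm z) < fps_conv_radius (fps_const 2 * fps_X * H)"
    using fps_conv_radius_mult[of "fps_const 2 * fps_X" H] fps_conv_radius_mult[of "fps_const (2::complex)" fps_X] zF(2)
    by (simp add: min_def split: if_splits)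
  ultimately have "eval_fps F z = 1 - eval_fps (fps_const 2 * fps_X * H) z"
    by (simp add: eval_fps_diff)
  also have "eval_fps (fps_const 2 * fps_X * H) z = eval_fps (fps_const 2 * fps_X) z * eval_fps H z"
    using zF fps_conv_radius_mult[of "fps_const (2::complex)" fps_X] by (intro eval_fps_mult) auto
  also have "eval_fps (fps_const 2 * fps_X) z = 2 * z" by (subst eval_fps_mult) auto
  finally have "eval_fps F z = 1 - 2 * z * eval_fps H z" .
  moreover have "eval_fps F z = f z" unfolding FE using eval_fps_expansion'[OF holf, of z] z by simp
  ultimately show "1 - 2 * z * eval_fps (level_gf k L u 0) z = csqrt (rad (wt k L u) z k)"
    by (simp add: f_def H_def)
qed

context real_tower
begin

lemma csqrt_rad_holomorphic_ball:
  assumes "i \<le> n"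
  shows "(\<lambda>z. csqrt (rad ca z i)) holomorphic_on ball 0 r"
proof -
  have "(\<lambda>z. csqrt (rad ca z i)) field_differentiable at z" if z: "z \<in> ball 0 r" for z
  proof -
    have nn: "rad ca z m \<notin> \<real>\<^sub>\<le>\<^sub>0" if "m \<le> n" for m
      using rad_notin_nonpos_Reals[of z m] z that by auto
    have "nice_at (\<lambda>s u. csqrt (rad ca s i)) z 0"
      by (intro nice_at_csqrt nice_at_rad[where Z = "\<lambda>s u. s" and a = "\<lambda>u. ca"])
         (use nn assms in auto)
    then obtain e where "e > 0" "(\<lambda>s. csqrt (rad ca s i)) holomorphic_on ball z e" by (rule nice_at_fixed)
    thus ?thesis by (meson centre_in_ball holomorphic_on_imp_differentiable_at open_ball)
  qed
  thus ?thesis by (simp add: holomorphic_on_open field_differentiable_def)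
qed

text \<open>An extension of the outermost root past \<open>r\<close> can be squared and solved for
  the next inner root, and so on down to the first vanishing index \<open>m\<close>. There the
  extension \<open>h\<close> satisfies h^2 = rad near \<open>r\<close>; as h vanishes at
  \<open>r\<close>, the derivative of h^2 is 0, whereas the zero of the radicand is simple. Zeros of
  later radicands do no harm.\<close>

lemma no_holomorphic_extension:
  assumes m: "m \<le> n" "\<sigma> m = 0" "\<And>i. i < m \<Longrightarrow> \<sigma> i > 0" and a0: "a 0 > 0"
    and g: "g holomorphic_on ball (of_real r) e" "e > 0"
      "\<And>z. z \<in> ball (of_real r) e \<Longrightarrow> norm z < r \<Longrightarrow> g z = csqrt (rad ca z n)"
  shows False
proof -
  let ?r = "complex_of_real r"
  have notin: "rad ca ?r i \<notin> \<real>\<^sub>\<le>\<^sub>0" if "i < m" for i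
    using m(3)[OF that] that m(1) by (subst rad_of_real) (auto simp del: of_real_power)
  have "nice_at (\<lambda>s u. rad ca s m) ?r 0"
    by (rule nice_at_rad[where Z = "\<lambda>s u. s" and a = "\<lambda>u. ca"]) (use notin in auto)
  then obtain e1 where e1: "e1 > 0" "(\<lambda>s. rad ca s m) holomorphic_on ball ?r e1" by (rule nice_at_fixed)
  define d where "d = min (min e e1) r"
  have d: "d > 0" "d \<le> e" "d \<le> e1" "d \<le> r" using g(2) e1(1) r_pos by (auto simp: d_def)
  have nz: "z \<noteq> 0" if "z \<in> ball ?r d" for z using that d(4) by auto
  have "\<exists>g. g holomorphic_on ball ?r d \<and> (\<forall>z\<in>ball ?r d. norm z < r \<longrightarrow> g z = csqrt (rad ca z m))"
    using m(1)
  proof (induction rule: inc_induct)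
    case base
    have "g holomorphic_on ball ?r d" by (rule holomorphic_on_subset[OF g(1)]) (use d in auto)
    moreover have "\<forall>z\<in>ball ?r d. norm z < r \<longrightarrow> g z = csqrt (rad ca z n)" using g(3) d by auto
    ultimately show ?case by blast
  next
    case (step i)
    then obtain h where h: "h holomorphic_on ball ?r d" "\<And>z. z \<in> ball ?r d \<Longrightarrow> norm z < r \<Longrightarrow> h z = csqrt (rad ca z (Suc i))"
      by blast
    define h' where "h' z = ((h z)\<^sup>2 - 1 + 2 * z + 4 * ca (Suc i) * z\<^sup>2) / (2 * z)" for z
    have "h' holomorphic_on ball ?r d"
      unfolding h'_def by (intro holomorphic_intros h(1)) (use nz in auto)
    moreover have "h' z = csqrt (rad ca z i)" if "z \<in> ball ?r d" "norm z < r" for z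
      using h(2)[OF that] nz[OF that(1)] by (simp add: h'_def)
    ultimately show ?case by blast
  qed
  then obtain h where h: "h holomorphic_on ball ?r d" "\<And>z. z \<in> ball ?r d \<Longrightarrow> norm z < r \<Longrightarrow> h z = csqrt (rad ca z m)"
    by blast
  have holR: "(\<lambda>z. rad ca z m) holomorphic_on ball ?r d"
    by (rule holomorphic_on_subset[OF e1(2)]) (use d in auto)
  have eq: "(h z)\<^sup>2 = rad ca z m" if "z \<in> ball ?r d" for z
  proof (rule analytic_continuation_open[where f = "\<lambda>z. (h z)\<^sup>2" and g = "\<lambda>z. rad ca z m" and s = "ball ?r d \<inter> ball 0 r" and s' = "ball ?r d"])
    have "of_real (r - d / 2) \<in> ball ?r d \<inter> ball 0 r"
      using d by (auto simp: dist_norm simp flip: of_real_diff)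
    thus "ball ?r d \<inter> ball 0 r \<noteq> {}" by blast
    show "(\<lambda>z. (h z)\<^sup>2) holomorphic_on ball ?r d" by (intro holomorphic_intros h)
  qed (use that holR h(2) in auto)
  have rin: "?r \<in> ball ?r d" using d by simp
  have "(h ?r)\<^sup>2 = 0" using eq[OF rin] rad_of_real[OF m(1)] m(2) by simp
  hence h0: "h ?r = 0" by simp
  have "(h has_field_derivative deriv h ?r) (at ?r)"
    using holomorphic_derivI[OF h(1) _ rin] by simp
  hence "((\<lambda>z. (h z)\<^sup>2) has_field_derivative 2 * h ?r * deriv h ?r) (at ?r)"
    by (auto intro!: derivative_eq_intros)
  hence "((\<lambda>z. (h z)\<^sup>2) has_field_derivative 0) (at ?r)" using h0 by simp
  hence "((\<lambda>z. rad ca z m) has_field_derivative 0) (at ?r)"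
    by (rule has_field_derivative_transform_within_open[of _ _ _ "ball ?r d"]) (use eq rin in auto)
  moreover have "((\<lambda>z. rad ca z m) has_field_derivative rad_quot ca ?r ?r m) (at ?r)"
    by (rule rad_has_field_derivative) (rule notin)
  ultimately have "rad_quot ca ?r ?r m = 0" using DERIV_unique by blast
  moreover obtain D where "D < 0" "rad_quot ca ?r ?r m = of_real D" using rad_quot_neg[OF m(1,3) a0] by blast
  ultimately show False by simp
qed

end

text \<open>The tower gives analyticity inside radius \<open>r\<close>, and the impossibility of an
  extension gives both the exact radius of convergence and the singularity at \<open>r\<close>.
  Uniqueness follows because a positive number on the circle is determined by its modulus.\<close>

lemma rho_tilde_eq:
  assumes tower: "real_tower (real_wt k L u) \<sigma> r k"
    and m: "m \<le> k" "\<sigma> m = 0" "\<And>i. i < m \<Longrightarrow> \<sigma> i > 0" and a0: "real_wt k L u 0 > 0"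
  shows "rho_tilde k L u = r"
proof -
  interpret real_tower "real_wt k L u" \<sigma> r k by fact
  define H where "H = level_gf k L (of_real u) 0"
  have hol: "(\<lambda>z. csqrt (rad (wt k L (of_real u)) z k)) holomorphic_on ball 0 r"
    unfolding wt_of_real by (rule csqrt_rad_holomorphic_ball) simp
  have cH: "ereal r \<le> fps_conv_radius H"
    and ev: "\<And>z. norm z < r \<Longrightarrow> 1 - 2 * z * eval_fps H z = csqrt (rad ca z k)"
    using level_gf_eval[OF r_pos hol] unfolding H_def wt_of_real by auto
  have noext: False
    if g: "g holomorphic_on ball (of_real r) e" "e > 0" "\<And>z. z \<in> ball (of_real r) e \<Longrightarrow> norm z < r \<Longrightarrow> g z = eval_fps H z" for g e
  proof -
    have "(\<lambda>z. 1 - 2 * z * g z) holomorphic_on ball (of_real r) e" by (intro holomorphic_intros g)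
    from no_holomorphic_extension[OF m a0 this g(2)] show False using g(3) ev by auto
  qed
  have conv: "fps_conv_radius H = ereal r"
  proof (rule ccontr)
    assume "fps_conv_radius H \<noteq> ereal r"
    hence "ereal r < fps_conv_radius H" using cH by simp
    hence "of_real r \<in> eball (0::complex) (fps_conv_radius H)" using r_pos by simp
    then obtain e where e: "e > 0" "ball (of_real r) e \<subseteq> eball (0::complex) (fps_conv_radius H)"
      by (meson open_eball open_contains_ball)
    have "eval_fps H holomorphic_on ball (of_real r) e"
      by (rule holomorphic_on_eval_fps) (use e in auto)
    thus False using noext e(1) by blast
  qed
  have sing: "is_singularity_on_circle H (of_real r)"
    unfolding is_singularity_on_circle_def
  proof (intro conjI notI)
    show "ereal (norm (complex_of_real r)) = fps_conv_radius H" using conv r_pos by simp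
    assume "\<exists>e>0. \<exists>g. g holomorphic_on ball (complex_of_real r) e \<and>
         (\<forall>z\<in>ball (complex_of_real r) e \<inter> eball 0 (fps_conv_radius H). g z = eval_fps H z)"
    then obtain e g where "e > 0" "g holomorphic_on ball (complex_of_real r) e"
      "\<And>z. z \<in> ball (complex_of_real r) e \<inter> ball 0 r \<Longrightarrow> g z = eval_fps H z" unfolding conv by auto
    thus False using noext[of g e] by auto
  qed
  show ?thesis
    unfolding rho_tilde_def H_gf_eq_level_gf H_def[symmetric]
  proof (rule the_equality)
    show "0 < r \<and> is_singularity_on_circle H (of_real r)" using sing r_pos by simp
    fix r' assume "0 < r' \<and> is_singularity_on_circle H (of_real r')"
    thus "r' = r" unfolding is_singularity_on_circle_def conv by auto
  qed
qed

subsection \<open>Location of the dominant singularity\<close>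

text \<open>
  At the first zero of the radicand \<open>j\<close> the radicand \<open>j - i\<close> has the square root \<open>pseq t i / x\<close>.
  The parameter interpolates between \<open>u_seq\<close> at \<open>t = 1\<close> and its shift at \<open>t = 0\<close>.
\<close>

fun pseq :: "real \<Rightarrow> nat \<Rightarrow> real" where
  "pseq t 0 = 0"
| "pseq t (Suc i) = (pseq t i)\<^sup>2 + t + real i"

lemma pseq_1: "pseq 1 i = real (u_seq i)"
  by (induction i) auto

lemma pseq_0_Suc: "pseq 0 (Suc i) = real (u_seq i)"
  by (induction i) auto

lemma pseq_nonneg: "t \<ge> 0 \<Longrightarrow> pseq t i \<ge> 0"
  by (cases i) auto

lemma pseq_pos: "t \<ge> 0 \<Longrightarrow> t > 0 \<or> i > 0 \<Longrightarrow> pseq t (Suc i) > 0"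
proof -
  assume "t \<ge> 0" "t > 0 \<or> i > 0"
  hence "t + real i > 0" by auto
  moreover have "(pseq t i)\<^sup>2 \<ge> 0" by simp
  ultimately show ?thesis unfolding pseq.simps by linarith
qed

lemma isCont_pseq: "isCont (\<lambda>t. pseq t i) t"
  by (induction i) (auto intro!: continuous_intros)

lemma of_nat_N_seq: "real (N_seq j) = (real (u_seq j))\<^sup>2 - real (u_seq j) + real j"
proof -
  have "u_seq j \<le> (u_seq j)\<^sup>2" by (simp add: power2_eq_square)
  thus ?thesis by (simp add: N_seq_def of_nat_diff)
qed

lemma le_N_seq: "j \<le> N_seq j"
  by (simp add: N_seq_def)

text \<open>Intermediate value theorem for the right-hand side as a function of t, which takes the
  values \<open>N_seq j\<close> at 0 and \<open>N_seq (Suc j)\<close> at 1. When k is the left end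
  value, t = 0 is chosen.\<close>

lemma N_seq_decomposition:
  assumes "N_seq j \<le> k" "k < N_seq (Suc j)"
  obtains t where "0 \<le> t" "t < 1" "real k = (pseq t (Suc j))\<^sup>2 - pseq t (Suc j) + real j + t"
    "t = 0 \<longleftrightarrow> k = N_seq j"
proof -
  define K where "K t = (pseq t (Suc j))\<^sup>2 - pseq t (Suc j) + real j + t" for t
  have K0: "K 0 = real (N_seq j)" by (simp only: K_def pseq_0_Suc of_nat_N_seq)
  have K1: "K 1 = real (N_seq (Suc j))" by (simp only: K_def pseq_1 of_nat_N_seq)
  have "\<exists>t\<ge>0. t \<le> 1 \<and> K t = real k"
    unfolding K_def[abs_def]
    by (rule IVT) (use assms K0 K1 in \<open>auto simp: K_def simp del: pseq.simps intro!: continuous_intros isCont_pseq\<close>)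
  then obtain t where t: "0 \<le> t" "t \<le> 1" "K t = real k" by auto
  show ?thesis
  proof (cases "k = N_seq j")
    case True
    thus ?thesis using that[of 0] K0 by (simp add: K_def)
  next
    case False
    have "t \<noteq> 0" using False t(3) K0 by auto
    moreover have "t \<noteq> 1" using assms t(3) K1 by auto
    ultimately show ?thesis using that[of t] t False by (simp add: K_def)
  qed
qed

text \<open>
  The square roots that follow a vanishing radicand, again multiplied by \<open>x\<close>.
\<close>

fun tail :: "real \<Rightarrow> nat \<Rightarrow> real" where
  "tail b 0 = 0"
| "tail b (Suc i) = sqrt (b + real i + tail b i)"

lemma tail_nonneg: "b \<ge> 0 \<Longrightarrow> tail b i \<ge> 0"
  by (induction i) auto

lemma tail_pos: "b > 0 \<Longrightarrow> tail b (Suc i) > 0"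
  using tail_nonneg[of b i] by (simp add: add_pos_nonneg)

lemma real_towerI:
  assumes x: "x > 0" and a: "\<And>i. i \<le> n \<Longrightarrow> a i \<ge> 0" and y: "\<And>i. i \<le> n \<Longrightarrow> y i \<ge> 0"
    and y0: "(y 0)\<^sup>2 = x\<^sup>2 - a 0" and yS: "\<And>i. i < n \<Longrightarrow> (y (Suc i))\<^sup>2 = x\<^sup>2 - x - a (Suc i) + y i"
  shows "real_tower a (\<lambda>i. y i / x) (1 / (2 * x)) n"
proof
  show "(y 0 / x)\<^sup>2 = 1 - 4 * a 0 * (1 / (2 * x))\<^sup>2"
    using x y0 by (simp add: power_divide power_mult_distrib field_simps)
  fix i assume i: "i < n"
  have "(y (Suc i) / x)\<^sup>2 = (x\<^sup>2 - x - a (Suc i) + y i) / x\<^sup>2" using yS[OF i] by (simp add: power_divide)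
  also have "\<dots> = 1 - 2 * (1 / (2 * x)) - 4 * a (Suc i) * (1 / (2 * x))\<^sup>2 + 2 * (1 / (2 * x)) * (y i / x)"
    using x by (simp add: power2_eq_square field_simps)
  finally show "(y (Suc i) / x)\<^sup>2 = 1 - 2 * (1 / (2 * x)) - 4 * a (Suc i) * (1 / (2 * x))\<^sup>2 + 2 * (1 / (2 * x)) * (y i / x)" .
qed (use assms in auto)

text \<open>
  For \<open>x = 1 / (2 z)\<close>, the square roots times \<open>x\<close> are computed by \<open>top_root\<close> from the first radicand
  on, and by \<open>bot_root\<close> backwards from the condition that the radicand \<open>J\<close> vanishes. Only at the index
  \<open>i\<close> of the marked level does the weight \<open>u\<close> enter, and matching the two there gives \<open>crit_weight\<close>: the
  value of \<open>u\<close> for which the radicand \<open>J\<close> vanishes at \<open>z\<close>. So \<open>crit_weight\<close> is an explicit inverse of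
  \<open>u \<mapsto> 1 / (2 \<rho>(u))\<close>.
\<close>

fun top_root :: "nat \<Rightarrow> nat \<Rightarrow> real \<Rightarrow> real" where
  "top_root k 0 x = sqrt (x\<^sup>2 - real k)"
| "top_root k (Suc m) x = sqrt (x\<^sup>2 - x - real (k - Suc m) + top_root k m x)"

fun top_rootc :: "nat \<Rightarrow> nat \<Rightarrow> complex \<Rightarrow> complex" where
  "top_rootc k 0 x = csqrt (x\<^sup>2 - of_nat k)"
| "top_rootc k (Suc m) x = csqrt (x\<^sup>2 - x - of_nat (k - Suc m) + top_rootc k m x)"

fun bot_root :: "nat \<Rightarrow> 'a::comm_ring_1 \<Rightarrow> nat \<Rightarrow> 'a" where
  "bot_root c x 0 = 0"
| "bot_root c x (Suc m) = (bot_root c x m)\<^sup>2 - (x\<^sup>2 - x - of_nat (c + m))"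

definition crit_weight :: "nat \<Rightarrow> nat \<Rightarrow> nat \<Rightarrow> real \<Rightarrow> real" where
  "crit_weight k J i x = (x\<^sup>2 - (if i = 0 then 0 else x - top_root k (i - 1) x) - (bot_root (k - J) x (J - i))\<^sup>2) / real (k - i)"

text \<open>The complex copy carries the analyticity needed for the inverse function; the real one
  is tied to \<open>rho_tilde\<close>. They agree at real points where the top roots are
  positive.\<close>

definition crit_weightc :: "nat \<Rightarrow> nat \<Rightarrow> nat \<Rightarrow> complex \<Rightarrow> complex" where
  "crit_weightc k J i x = (x\<^sup>2 - (if i = 0 then 0 else x - top_rootc k (i - 1) x) - (bot_root (k - J) x (J - i))\<^sup>2) / of_nat (k - i)"

section \<open>Regularity and monotonicity of the critical weight\<close>

lemma csqrt_of_real: "v \<ge> 0 \<Longrightarrow> csqrt (of_real v) = of_real (sqrt v)"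
  by simp

lemma isCont_top_root: "isCont (top_root k m) x"
  by (induction m) (auto intro!: continuous_intros)

lemma isCont_bot_root: "isCont (\<lambda>x::'a::real_normed_field. bot_root c x m) x"
  by (induction m) (auto intro!: continuous_intros)

lemma isCont_crit_weight: "i < k \<Longrightarrow> isCont (crit_weight k J i) x"
  unfolding crit_weight_def by (cases "i = 0") (auto intro!: continuous_intros isCont_top_root isCont_bot_root)

lemma bot_root_of_real: "bot_root c (of_real x :: 'a::{comm_ring_1,real_algebra_1}) m = of_real (bot_root c x m)"
  by (induction m) auto

lemma top_rootc_of_real: "(\<And>i. i \<le> m \<Longrightarrow> top_root k i x > 0) \<Longrightarrow> top_rootc k m (of_real x) = of_real (top_root k m x)"
proof (induction m)
  case 0
  have "x\<^sup>2 - real k > 0" using 0[of 0] by simp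
  hence "csqrt (of_real (x\<^sup>2 - real k)) = of_real (sqrt (x\<^sup>2 - real k))" by (intro csqrt_of_real) auto
  thus ?case by simp
next
  case (Suc m)
  have IH: "top_rootc k m (of_real x) = of_real (top_root k m x)" using Suc by simp
  have "x\<^sup>2 - x - real (k - Suc m) + top_root k m x > 0" using Suc.prems[of "Suc m"] by simp
  hence "csqrt (of_real (x\<^sup>2 - x - real (k - Suc m) + top_root k m x)) = of_real (sqrt (x\<^sup>2 - x - real (k - Suc m) + top_root k m x))"
    by (intro csqrt_of_real) auto
  thus ?case by (simp add: IH)
qed

lemma crit_weightc_of_real:
  assumes "\<And>m. m < i \<Longrightarrow> top_root k m x > 0"
  shows "crit_weightc k J i (of_real x) = of_real (crit_weight k J i x)"
proof (cases "i = 0")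
  case False
  hence "top_rootc k (i - 1) (of_real x) = of_real (top_root k (i - 1) x)" using assms by (intro top_rootc_of_real) auto
  thus ?thesis using False by (simp add: crit_weightc_def crit_weight_def bot_root_of_real)
qed (simp add: crit_weightc_def crit_weight_def bot_root_of_real)

lemma nice_at_top_rootc:
  assumes "\<And>i. i \<le> m \<Longrightarrow> top_root k i x > 0"
  shows "nice_at (\<lambda>z u. top_rootc k m z) (of_real x) u0"
  using assms
proof (induction m)
  case 0
  have "complex_of_real x ^ 2 - of_nat k = of_real (x\<^sup>2 - real k)" by simp
  moreover have "x\<^sup>2 - real k > 0" using 0[of 0] by simp
  ultimately have "complex_of_real x ^ 2 - of_nat k \<notin> \<real>\<^sub>\<le>\<^sub>0"
    by (metis less_le_not_le nonpos_Reals_of_real_iff)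
  thus ?case unfolding top_rootc.simps
    by (intro nice_at_csqrt nice_at_diff nice_at_power nice_at_fst nice_at_const)
next
  case (Suc m)
  have T: "top_rootc k m (of_real x) = of_real (top_root k m x)" using Suc by (intro top_rootc_of_real) auto
  have "complex_of_real x ^ 2 - of_real x - of_nat (k - Suc m) + top_rootc k m (of_real x) = of_real (x\<^sup>2 - x - real (k - Suc m) + top_root k m x)"
    by (simp add: T)
  moreover have "x\<^sup>2 - x - real (k - Suc m) + top_root k m x > 0" using Suc.prems[of "Suc m"] by simp
  ultimately have "complex_of_real x ^ 2 - of_real x - of_nat (k - Suc m) + top_rootc k m (of_real x) \<notin> \<real>\<^sub>\<le>\<^sub>0"
    by (metis less_le_not_le nonpos_Reals_of_real_iff)
  moreover have "nice_at (\<lambda>z u. top_rootc k m z) (of_real x) u0" using Suc by simp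
  ultimately show ?case unfolding top_rootc.simps
    by (intro nice_at_csqrt nice_at_add nice_at_diff nice_at_power nice_at_fst nice_at_const)
qed

lemma nice_at_bot_root: "nice_at (\<lambda>z u. bot_root c z m) x u0"
  by (induction m) (auto intro!: nice_at_diff nice_at_power)

lemma nice_at_crit_weightc:
  assumes "\<And>m. m < i \<Longrightarrow> top_root k m x > 0" "i < k"
  shows "nice_at (\<lambda>z u. crit_weightc k J i z) (of_real x) u0"
proof (cases "i = 0")
  case True
  show ?thesis unfolding crit_weightc_def using assms True
    by (auto intro!: nice_at_divide nice_at_diff nice_at_power nice_at_bot_root)
next
  case False
  have "nice_at (\<lambda>z u. top_rootc k (i - 1) z) (of_real x) u0" by (rule nice_at_top_rootc) (use assms False in auto)
  thus ?thesis unfolding crit_weightc_def using assms False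
    by (auto intro!: nice_at_divide nice_at_diff nice_at_power nice_at_bot_root)
qed

lemma top_rootc_has_field_derivative:
  assumes "\<And>i. i \<le> m \<Longrightarrow> top_root k i x > 0" "x > 1/2"
  shows "\<exists>D>0. (top_rootc k m has_field_derivative of_real D) (at (of_real x))"
  using assms(1)
proof (induction m)
  case 0
  define v where "v = x\<^sup>2 - real k"
  have v: "v > 0" using 0[of 0] by (simp add: v_def)
  have eq: "complex_of_real x ^ 2 - of_nat k = of_real v" by (simp add: v_def)
  have "complex_of_real v \<notin> \<real>\<^sub>\<le>\<^sub>0" using v by simp
  hence "((\<lambda>z. csqrt (z\<^sup>2 - of_nat k)) has_field_derivative (inverse (2 * csqrt (of_real v)) * (2 * of_real x))) (at (of_real x))"
    using eq by (intro DERIV_chain2[where f = csqrt] has_field_derivative_csqrt[THEN DERIV_cong])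
      (auto intro!: derivative_eq_intros)
  moreover have "inverse (2 * csqrt (of_real v)) * (2 * of_real x) = of_real (inverse (2 * sqrt v) * (2 * x))"
    using v by (simp add: csqrt_of_real field_simps)
  moreover have "top_rootc k 0 = (\<lambda>z. csqrt (z\<^sup>2 - of_nat k))" by (rule ext) simp
  ultimately have "(top_rootc k 0 has_field_derivative of_real (inverse (2 * sqrt v) * (2 * x))) (at (of_real x))"
    by (simp only:)
  moreover have "inverse (2 * sqrt v) * (2 * x) > 0" using v assms(2) by simp
  ultimately show ?case by blast
next
  case (Suc m)
  then obtain D where D: "D > 0" "(top_rootc k m has_field_derivative of_real D) (at (of_real x))" by auto
  define v where "v = x\<^sup>2 - x - real (k - Suc m) + top_root k m x"
  have v: "v > 0" using Suc.prems[of "Suc m"] by (simp add: v_def)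
  have "top_rootc k m (of_real x) = of_real (top_root k m x)" using Suc.prems by (intro top_rootc_of_real) auto
  hence eq: "complex_of_real x ^ 2 - of_real x - of_nat (k - Suc m) + top_rootc k m (of_real x) = of_real v" by (simp add: v_def)
  have "complex_of_real v \<notin> \<real>\<^sub>\<le>\<^sub>0" using v by simp
  hence "((\<lambda>z. csqrt (z\<^sup>2 - z - of_nat (k - Suc m) + top_rootc k m z)) has_field_derivative
     (inverse (2 * csqrt (of_real v)) * (2 * of_real x - 1 + of_real D))) (at (of_real x))"
    using eq by (intro DERIV_chain2[where f = csqrt] has_field_derivative_csqrt[THEN DERIV_cong])
      (auto intro!: derivative_eq_intros D(2))
  moreover have "inverse (2 * csqrt (of_real v)) * (2 * of_real x - 1 + of_real D) = of_real (inverse (2 * sqrt v) * (2 * x - 1 + D))"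
    using v by (simp add: csqrt_of_real field_simps)
  moreover have "top_rootc k (Suc m) = (\<lambda>z. csqrt (z\<^sup>2 - z - of_nat (k - Suc m) + top_rootc k m z))" by (rule ext) simp
  ultimately have "(top_rootc k (Suc m) has_field_derivative of_real (inverse (2 * sqrt v) * (2 * x - 1 + D))) (at (of_real x))"
    by (simp only:)
  moreover have "inverse (2 * sqrt v) * (2 * x - 1 + D) > 0" using v assms(2) D(1) by simp
  ultimately show ?case by blast
qed

lemma bot_root_has_field_derivative:
  assumes "\<And>i. i < m \<Longrightarrow> bot_root c x i \<ge> 0" "x > 1/2"
  shows "\<exists>D\<le>0. ((\<lambda>z::'a::real_normed_field. bot_root c z m) has_field_derivative of_real D) (at (of_real x))"
  using assms(1)
proof (induction m)
  case 0
  show ?case by (intro exI[of _ 0]) simp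
next
  case (Suc m)
  then obtain D where D: "D \<le> 0" "((\<lambda>z::'a. bot_root c z m) has_field_derivative of_real D) (at (of_real x))" by auto
  define D' where "D' = 2 * bot_root c x m * D - (2 * x - 1)"
  have "((\<lambda>z::'a. bot_root c z (Suc m)) has_field_derivative of_real D') (at (of_real x))"
    unfolding bot_root.simps by (auto intro!: derivative_eq_intros D(2) simp: D'_def bot_root_of_real)
  moreover have "D' \<le> 0" unfolding D'_def using D(1) Suc.prems[of m] assms(2)
  proof -
    have "2 * bot_root c x m * D \<le> 0" using D(1) Suc.prems[of m] by (intro mult_nonneg_nonpos) auto
    thus "2 * bot_root c x m * D - (2 * x - 1) \<le> 0" using assms(2) by linarith
  qed
  ultimately show ?case by blast
qed

text \<open>For x > 1/2 the quantities x^2 - x and the top roots increase, while the bottom roots,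
  as long as they are nonnegative, have nonpositive derivative. So every contribution to the
  derivative of the weight has the same sign, and the weight can be inverted locally.\<close>

lemma crit_weightc_has_field_derivative:
  assumes T: "\<And>m. m < i \<Longrightarrow> top_root k m x > 0" and p: "\<And>m. m \<le> J - i \<Longrightarrow> bot_root (k - J) x m \<ge> 0"
    and x: "x > 1/2" and i: "i < k"
  shows "\<exists>D>0. (crit_weightc k J i has_field_derivative of_real D) (at (of_real x))"
proof -
  obtain P where P: "P \<le> 0" "((\<lambda>z::complex. bot_root (k - J) z (J - i)) has_field_derivative of_real P) (at (of_real x))"
    using bot_root_has_field_derivative[of "J - i" "k - J" x] p x by auto
  have pp: "2 * bot_root (k - J) x (J - i) * P \<le> 0" using P(1) p by (intro mult_nonneg_nonpos) auto
  show ?thesis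
  proof (cases "i = 0")
    case True
    have "(crit_weightc k J i has_field_derivative of_real ((2 * x - 2 * bot_root (k - J) x (J - i) * P) / real (k - i))) (at (of_real x))"
    proof -
      have "crit_weightc k J i = (\<lambda>z. (z\<^sup>2 - (bot_root (k - J) z (J - i))\<^sup>2) / of_nat (k - i))"
        using True by (simp add: crit_weightc_def fun_eq_iff)
      thus ?thesis using i by (auto intro!: derivative_eq_intros P(2) simp: bot_root_of_real)
    qed
    moreover have "(2 * x - 2 * bot_root (k - J) x (J - i) * P) / real (k - i) > 0"
    proof (rule divide_pos_pos)
      show "2 * x - 2 * bot_root (k - J) x (J - i) * P > 0" using x pp by linarith
    qed (use i in simp)
    ultimately show ?thesis by blast
  next
    case False
    obtain D where D: "D > 0" "(top_rootc k (i - 1) has_field_derivative of_real D) (at (of_real x))"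
      using top_rootc_has_field_derivative[of "i - 1" k x] T x False by auto
    have "(crit_weightc k J i has_field_derivative of_real ((2 * x - 1 + D - 2 * bot_root (k - J) x (J - i) * P) / real (k - i))) (at (of_real x))"
    proof -
      have "crit_weightc k J i = (\<lambda>z. (z\<^sup>2 - (z - top_rootc k (i - 1) z) - (bot_root (k - J) z (J - i))\<^sup>2) / of_nat (k - i))"
        using False by (simp add: crit_weightc_def fun_eq_iff)
      thus ?thesis using i by (auto intro!: derivative_eq_intros P(2) D(2) simp: bot_root_of_real simp del: One_nat_def)
    qed
    moreover have "(2 * x - 1 + D - 2 * bot_root (k - J) x (J - i) * P) / real (k - i) > 0"
    proof (rule divide_pos_pos)
      show "2 * x - 1 + D - 2 * bot_root (k - J) x (J - i) * P > 0" using x pp D(1) by linarith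
    qed (use i in simp)
    ultimately show ?thesis by blast
  qed
qed

text \<open>All roots times x when the radicand \<open>J\<close> vanishes. The bottom root with
  argument q belongs to the index J - q, which lies at level k - J + q. The + 1 in the parameter of
  \<open>tail\<close> comes from the first index after \<open>J\<close>, at level k - J - 1.\<close>

definition crit_tower :: "nat \<Rightarrow> nat \<Rightarrow> nat \<Rightarrow> real \<Rightarrow> nat \<Rightarrow> real" where
  "crit_tower k J i x m = (if m < i then top_root k m x else if m \<le> J then bot_root (k - J) x (J - m)
     else tail (x\<^sup>2 - x - real (k - J) + 1) (m - J))"

lemma real_tower_param:
  assumes x: "x > 0" and iJ: "i \<le> J" "J \<le> k" "i < k" and T: "\<And>m. m < i \<Longrightarrow> top_root k m x > 0"
    and p: "\<And>m. m \<le> J - i \<Longrightarrow> bot_root (k - J) x m \<ge> 0" and b: "x\<^sup>2 - x - real (k - J) + 1 \<ge> 0"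
    and U: "crit_weight k J i x \<ge> 0"
  shows "real_tower (real_wt k (k - i) (crit_weight k J i x)) (\<lambda>m. crit_tower k J i x m / x) (1 / (2 * x)) k"
proof (rule real_towerI[OF x])
  define a where "a = real_wt k (k - i) (crit_weight k J i x)"
  have a: "a m = real (k - m)" if "m \<noteq> i" "m \<le> k" for m
    using that iJ by (auto simp: a_def real_wt_def)
  have ai: "a i = x\<^sup>2 - (if i = 0 then 0 else x - top_root k (i - 1) x) - (bot_root (k - J) x (J - i))\<^sup>2"
    using iJ by (simp add: a_def real_wt_def crit_weight_def)
  show "0 \<le> real_wt k (k - i) (crit_weight k J i x) m" for m using U by (simp add: real_wt_def)
  show "crit_tower k J i x m \<ge> 0" for m
    using T[of m] p[of "J - m"] tail_nonneg[OF b] by (auto simp: crit_tower_def)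
  show "(crit_tower k J i x 0)\<^sup>2 = x\<^sup>2 - real_wt k (k - i) (crit_weight k J i x) 0"
  proof (cases "i = 0")
    case True
    thus ?thesis using ai iJ by (simp add: crit_tower_def a_def)
  next
    case False
    have "(top_root k 0 x)\<^sup>2 = x\<^sup>2 - real k" using T[of 0] False by simp
    thus ?thesis using False a[of 0] by (simp add: crit_tower_def a_def del: top_root.simps)
  qed
  fix m assume m: "m < k"
  consider "Suc m < i" | "Suc m = i" | "i < Suc m" "Suc m \<le> J" | "J \<le> m" "i \<le> m" using iJ by linarith
  thus "(crit_tower k J i x (Suc m))\<^sup>2 = x\<^sup>2 - x - real_wt k (k - i) (crit_weight k J i x) (Suc m) + crit_tower k J i x m"
  proof cases
    case 1
    have "(top_root k (Suc m) x)\<^sup>2 = x\<^sup>2 - x - real (k - Suc m) + top_root k m x" using T[OF 1] by simp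
    thus ?thesis using 1 a[of "Suc m"] m by (simp add: crit_tower_def a_def del: top_root.simps)
  next
    \<comment> \<open>The two stretches meet at the marked index; \<open>crit_weight\<close> is this
      equation solved for the weight.\<close>
    case 2
    thus ?thesis using ai iJ by (auto simp: crit_tower_def a_def)
  next
    case 3
    have "J - m = Suc (J - Suc m)" using 3 by simp
    hence "bot_root (k - J) x (J - m) = (bot_root (k - J) x (J - Suc m))\<^sup>2 - (x\<^sup>2 - x - real (k - J + (J - Suc m)))"
      by simp
    moreover have "k - J + (J - Suc m) = k - Suc m" using 3 iJ by simp
    ultimately show ?thesis using 3 a[of "Suc m"] m by (simp add: crit_tower_def a_def)
  next
    case 4
    have "crit_tower k J i x (Suc m) = tail (x\<^sup>2 - x - real (k - J) + 1) (Suc (m - J))" using 4 by (simp add: crit_tower_def Suc_diff_le)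
    also have "\<dots>\<^sup>2 = x\<^sup>2 - x - real (k - J) + 1 + real (m - J) + tail (x\<^sup>2 - x - real (k - J) + 1) (m - J)"
      using tail_nonneg[OF b] b by simp
    also have "tail (x\<^sup>2 - x - real (k - J) + 1) (m - J) = crit_tower k J i x m" using 4 by (auto simp: crit_tower_def)
    finally show ?thesis using a[of "Suc m"] 4 m by (simp add: a_def of_nat_diff)
  qed
qed

text \<open>Positivity of all roots before the index \<open>J\<close> ensures that the zero there is
  the first one, and the condition on x^2 - x keeps the later roots real. The curve u \<mapsto>
  \<rho>(u) is thus described with x as its parameter.\<close>

lemma rho_tilde_param:
  assumes x: "x > 0" and iJ: "i \<le> J" "J \<le> k" "i < k" and T: "\<And>m. m < i \<Longrightarrow> top_root k m x > 0"
    and p: "\<And>m. 0 < m \<Longrightarrow> m \<le> J - i \<Longrightarrow> bot_root (k - J) x m > 0" and b: "x\<^sup>2 - x - real (k - J) + 1 \<ge> 0"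
    and U: "crit_weight k J i x > 0"
  shows "rho_tilde k (k - i) (crit_weight k J i x) = 1 / (2 * x)"
proof (rule rho_tilde_eq[where m = J])
  show "real_tower (real_wt k (k - i) (crit_weight k J i x)) (\<lambda>m. crit_tower k J i x m / x) (1 / (2 * x)) k"
  proof (rule real_tower_param)
    show "bot_root (k - J) x m \<ge> 0" if "m \<le> J - i" for m using p[of m] that by (cases m) (auto simp del: bot_root.simps(2))
  qed (use assms in auto)
  show "crit_tower k J i x J / x = 0" using iJ by (simp add: crit_tower_def)
  show "crit_tower k J i x m / x > 0" if "m < J" for m
    using that T[of m] p[of "J - m"] x by (auto simp: crit_tower_def)
  show "real_wt k (k - i) (crit_weight k J i x) 0 > 0" using U iJ by (simp add: real_wt_def)
qed (use iJ in auto)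

text \<open>The data supplied by \<open>N_seq_decomposition\<close>; \<open>j \<ge> 1\<close> holds
  for every k \<ge> 1 because N_0 = 0 and N_1 = 1. The radius of the tower at u = 1 will be 1 / (2
  x).\<close>

locale decomposition =
  fixes k j :: nat and t x :: real
  assumes k_pos: "k \<ge> 1" and j_pos: "j \<ge> 1" and jk: "j \<le> k" and t: "0 \<le> t" "t < 1"
    and x_def: "x = pseq t (Suc j)" and k_eq: "real k = x\<^sup>2 - x + real j + t"
begin

lemma x_ge_1: "x \<ge> 1"
proof -
  have "(pseq t j)\<^sup>2 \<ge> 0" "real j \<ge> 1" using j_pos by auto
  thus ?thesis unfolding x_def pseq.simps using t by linarith
qed

lemma x_sq: "x\<^sup>2 - x = real k - real j - t"
  using k_eq by simp

text \<open>By \<open>k_eq\<close> the first radicand is the square of \<open>pseq t j\<close>. Each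
  further one is the recursion of \<open>pseq\<close> read backwards, since x^2 - x minus a level is
  again - t minus an index of the sequence.\<close>

lemma top_root_eq: "m \<le> j \<Longrightarrow> top_root k m x = pseq t (j - m)"
proof (induction m)
  case 0
  have "x\<^sup>2 - real k = (pseq t j)\<^sup>2" using k_eq by (simp add: x_def)
  thus ?case using pseq_nonneg t by simp
next
  case (Suc m)
  have IH: "top_root k m x = pseq t (j - m)" using Suc by simp
  have "j - m = Suc (j - Suc m)" using Suc by simp
  hence "pseq t (j - m) = (pseq t (j - Suc m))\<^sup>2 + t + real (j - Suc m)" by simp
  hence "x\<^sup>2 - x - real (k - Suc m) + pseq t (j - m) = (pseq t (j - Suc m))\<^sup>2"
    using x_sq Suc.prems jk by (simp add: of_nat_diff)
  thus ?case using pseq_nonneg t IH by simp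
qed

lemma bot_root_eq: "bot_root (k - j) x m = pseq t m"
proof (induction m)
  case (Suc m)
  show ?case using x_sq jk by (simp add: Suc of_nat_diff)
qed simp

lemma crit_weight_eq_1:
  assumes "i \<le> j" "i < k"
  shows "crit_weight k j i x = 1"
proof (cases "i = 0")
  case True
  have "x\<^sup>2 - (pseq t j)\<^sup>2 = real k" using k_eq by (simp add: x_def)
  thus ?thesis using True k_pos by (simp add: crit_weight_def bot_root_eq)
next
  case False
  have "top_root k (i - 1) x = pseq t (j - (i - 1))" using assms by (intro top_root_eq) auto
  also have "j - (i - 1) = Suc (j - i)" using False assms by simp
  finally have "x\<^sup>2 - (x - top_root k (i - 1) x) - (pseq t (j - i))\<^sup>2 = real (k - i)"
    using x_sq assms by (simp add: of_nat_diff)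
  thus ?thesis using False assms by (simp add: crit_weight_def bot_root_eq)
qed

definition ystar :: "nat \<Rightarrow> real" where
  "ystar m = (if m \<le> j then pseq t (j - m) else tail (1 - t) (m - j))"

lemma tower_at_1: "real_tower (\<lambda>m. real (k - m)) (\<lambda>m. ystar m / x) (1 / (2 * x)) k"
proof (rule real_towerI)
  show "x > 0" using x_ge_1 by simp
  show "ystar i \<ge> 0" for i using pseq_nonneg t tail_nonneg by (simp add: ystar_def)
  show "(ystar 0)\<^sup>2 = x\<^sup>2 - real (k - 0)" using k_eq by (simp add: ystar_def x_def)
  fix m assume m: "m < k"
  show "(ystar (Suc m))\<^sup>2 = x\<^sup>2 - x - real (k - Suc m) + ystar m"
  proof (cases "m < j")
    case True
    have "j - m = Suc (j - Suc m)" using True by simp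
    hence "pseq t (j - m) = (pseq t (j - Suc m))\<^sup>2 + t + real (j - Suc m)" by simp
    thus ?thesis using True x_sq m by (simp add: ystar_def of_nat_diff)
  next
    case False
    have "Suc m - j = Suc (m - j)" using False by simp
    hence "ystar (Suc m) = tail (1 - t) (Suc (m - j))" using False by (simp add: ystar_def)
    also have "\<dots>\<^sup>2 = 1 - t + real (m - j) + tail (1 - t) (m - j)"
      using tail_nonneg[of "1 - t" "m - j"] t by simp
    also have "tail (1 - t) (m - j) = ystar m" using False by (auto simp: ystar_def)
    finally show ?thesis using False x_sq m by (simp add: of_nat_diff)
  qed
qed auto

text \<open>The exception at j - 1 stems from \<open>pseq t 1 = t\<close>. No second exception
  occurs, since \<open>tail (1 - t)\<close> is positive beyond j by t < 1.\<close>

lemma ystar_pos: "m \<noteq> j \<Longrightarrow> t > 0 \<or> m \<noteq> j - 1 \<Longrightarrow> ystar m > 0"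
proof -
  assume m: "m \<noteq> j" "t > 0 \<or> m \<noteq> j - 1"
  show ?thesis
  proof (cases "m < j")
    case True
    hence "j - m = Suc (j - Suc m)" by simp
    moreover have "pseq t (Suc (j - Suc m)) > 0" using t m True by (intro pseq_pos) auto
    ultimately show ?thesis using True by (simp add: ystar_def)
  next
    case False
    hence "m - j = Suc (m - Suc j)" using m by simp
    moreover have "tail (1 - t) (Suc (m - Suc j)) > 0" using t by (intro tail_pos) auto
    ultimately show ?thesis using False m by (simp add: ystar_def)
  qed
qed

lemma ystar_j: "ystar j = 0"
  by (simp add: ystar_def)

end

subsection \<open>Uniform singular expansions\<close>

abbreviation root_at :: "nat \<Rightarrow> complex \<Rightarrow> complex" where
  "root_at q w \<equiv> (1 - w) powr of_real (1 / real q)"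

lemma norm_root_at_power:
  assumes "q > 0" "w \<noteq> 1"
  shows "norm (root_at q w) ^ q = norm (1 - w)"
proof -
  have "root_at q w ^ q = 1 - w"
    using assms by (simp add: powr_def exp_of_nat_mult[symmetric])
  thus ?thesis by (metis norm_power)
qed

lemma delta_domain_mono: "c \<le> c' \<Longrightarrow> delta_domain c \<subseteq> delta_domain c'"
  unfolding delta_domain_def by (intro UN_mono subset_ball mult_right_mono) auto

text \<open>The closed disc minus a neighbourhood of 1 is compact, so there
  \<open>nice_at_compact\<close> supplies discs of one radius for all weights near \<open>b\<close>;
  close to 1 the expansion in the root takes over. A slim enough domain is covered by these two
  regions.\<close>

lemma uniform_singularity_data:
  assumes q: "q > 0" and \<Phi>: "nice_at \<Phi> 0 b" and e0: "e0 > 0"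
    and near: "\<And>w u. w \<in> delta_domain (1/3) \<Longrightarrow> u \<in> ball b e0 \<Longrightarrow> norm (root_at q w) < e0 \<Longrightarrow>
       F w u = \<Phi> (root_at q w) u / root_at q w ^ p"
    and far: "\<And>w. norm w \<le> 1 \<Longrightarrow> w \<noteq> 1 \<Longrightarrow> nice_at F w b"
  obtains c \<epsilon> \<delta> M where "0 < c" "c \<le> 1/3" "0 < \<epsilon>" "0 < \<delta>"
    "\<And>u. u \<in> ball b \<delta> \<Longrightarrow> (\<lambda>w. F w u) holomorphic_on delta_domain c"
    "\<And>u. u \<in> ball b \<delta> \<Longrightarrow> (\<lambda>s. \<Phi> s u) holomorphic_on ball 0 \<epsilon>"
    "\<And>u s. u \<in> ball b \<delta> \<Longrightarrow> s \<in> ball 0 \<epsilon> \<Longrightarrow> norm (\<Phi> s u) \<le> M"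
    "\<And>u w. u \<in> ball b \<delta> \<Longrightarrow> w \<in> delta_domain c \<Longrightarrow> norm (root_at q w) < \<epsilon> \<Longrightarrow>
       F w u = \<Phi> (root_at q w) u / root_at q w ^ p"
    "\<And>u w. u \<in> ball b \<delta> \<Longrightarrow> w \<in> delta_domain c \<Longrightarrow> norm (root_at q w) \<ge> \<epsilon> / 2 \<Longrightarrow> norm (F w u) \<le> M"
proof -
  obtain e1 M1 where e1: "0 < e1" "\<And>u. u \<in> ball b e1 \<Longrightarrow> (\<lambda>s. \<Phi> s u) holomorphic_on ball 0 e1"
    "\<And>u s. u \<in> ball b e1 \<Longrightarrow> s \<in> ball 0 e1 \<Longrightarrow> norm (\<Phi> s u) \<le> M1"
  proof (rule nice_at_compact[of "{0}" \<Phi> b])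
    fix e M
    assume "0 < e" "\<And>z u. z \<in> {0} \<Longrightarrow> u \<in> ball b e \<Longrightarrow> (\<lambda>s. \<Phi> s u) holomorphic_on ball z e"
      "\<And>z u s. z \<in> {0} \<Longrightarrow> u \<in> ball b e \<Longrightarrow> s \<in> ball z e \<Longrightarrow> norm (\<Phi> s u) \<le> M"
    thus thesis by (intro that[of e M]) blast+
  qed (use \<Phi> in auto)
  define \<epsilon> where "\<epsilon> = min e0 e1"
  \<comment> \<open>A root of norm at least \<epsilon>/2 means |1 - w| \<ge> 2 \<eta>; half of this
    is spent on moving from \<open>w\<close> to a centre in the unit disc.\<close>
  define \<eta> where "\<eta> = (\<epsilon> / 2) ^ q / 2"
  have \<epsilon>: "\<epsilon> > 0" "\<epsilon> \<le> e0" "\<epsilon> \<le> e1" using e0 e1 by (auto simp: \<epsilon>_def)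
  have \<eta>: "\<eta> > 0" using \<epsilon> by (simp add: \<eta>_def)
  define K where "K = cball 0 1 \<inter> {w::complex. \<eta> \<le> norm (1 - w)}"
  have "compact K" unfolding K_def
    by (intro compact_Int_closed compact_cball closed_Collect_le continuous_intros)
  moreover have "nice_at F w b" if "w \<in> K" for w
    using that \<eta> by (intro far) (auto simp: K_def)
  ultimately obtain e2 M2 where e2: "0 < e2" "\<And>z u. z \<in> K \<Longrightarrow> u \<in> ball b e2 \<Longrightarrow> (\<lambda>s. F s u) holomorphic_on ball z e2"
    "\<And>z u s. z \<in> K \<Longrightarrow> u \<in> ball b e2 \<Longrightarrow> s \<in> ball z e2 \<Longrightarrow> norm (F s u) \<le> M2"
    by (rule nice_at_compact) auto
  \<comment> \<open>A point of the domain lies within 2 c of its centre. So \<eta>/2 keeps the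
    centre in \<open>K\<close>, and e2/2 puts the point into the disc provided there.\<close>
  define c where "c = min (1/3) (min (\<eta> / 2) (e2 / 2))"
  define \<delta> where "\<delta> = min (min e0 e1) e2"
  define M where "M = max M1 M2"
  have c: "c > 0" "c \<le> 1/3" "c \<le> \<eta> / 2" "c \<le> e2 / 2" using \<eta> e2 by (auto simp: c_def)
  have \<delta>: "\<delta> > 0" "\<delta> \<le> e0" "\<delta> \<le> e1" "\<delta> \<le> e2" using e0 e1 e2 by (auto simp: \<delta>_def)
  have b\<delta>: "u \<in> ball b e0" "u \<in> ball b e1" "u \<in> ball b e2" if "u \<in> ball b \<delta>" for u using that \<delta> by auto
  have sub: "delta_domain c \<subseteq> delta_domain (1/3)" using c by (intro delta_domain_mono)
  have far': "\<exists>z\<in>K. w \<in> ball z e2" if w: "w \<in> delta_domain c" "norm (root_at q w) \<ge> \<epsilon> / 2" for w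
  proof -
    obtain z where z: "norm z < 1" "norm (w - z) < c * norm (1 - z)"
      using w(1) by (auto simp: delta_domain_def dist_norm norm_minus_commute)
    have z2: "norm (1 - z) \<le> 2" using norm_triangle_ineq4[of 1 z] z(1) by simp
    have "c * norm (1 - z) \<le> c * 2" using c z2 by (intro mult_left_mono) auto
    hence wz: "norm (w - z) < 2 * c" using z(2) by simp
    have "2 * \<eta> \<le> norm (1 - w)"
    proof -
      have "2 * \<eta> = (\<epsilon> / 2) ^ q" by (simp add: \<eta>_def)
      also have "\<dots> \<le> norm (root_at q w) ^ q" using w(2) \<epsilon> by (intro power_mono) auto
      also have "\<dots> = norm (1 - w)" using delta_domainD(3)[OF w(1) c(1,2)] q by (intro norm_root_at_power) auto
      finally show ?thesis .
    qed
    moreover have "norm (1 - w) \<le> norm (1 - z) + norm (w - z)"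
      using norm_triangle_ineq4[of "1 - z" "w - z"] by simp
    ultimately have "\<eta> \<le> norm (1 - z)" using wz c by simp
    hence "z \<in> K" using z by (simp add: K_def)
    moreover have "w \<in> ball z e2" using wz c by (simp add: dist_norm norm_minus_commute)
    ultimately show ?thesis by blast
  qed
  have near': "F w u = \<Phi> (root_at q w) u / root_at q w ^ p"
    if "u \<in> ball b \<delta>" "w \<in> delta_domain c" "norm (root_at q w) < \<epsilon>" for u w
    using near[of w u] that sub b\<delta> \<epsilon> by auto
  show ?thesis
  proof (rule that[OF c(1,2) \<epsilon>(1) \<delta>(1)])
    fix u assume u: "u \<in> ball b \<delta>"
    show hol\<Phi>: "(\<lambda>s. \<Phi> s u) holomorphic_on ball 0 \<epsilon>"
      by (rule holomorphic_on_subset[OF e1(2)]) (use u b\<delta> \<epsilon> in auto)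
    show "norm (\<Phi> s u) \<le> M" if "s \<in> ball 0 \<epsilon>" for s
      using e1(3)[of u s] that u b\<delta> \<epsilon> by (auto simp: M_def)
    show "norm (F w u) \<le> M" if "w \<in> delta_domain c" "norm (root_at q w) \<ge> \<epsilon> / 2" for w
      using far'[OF that] e2(3)[of _ u w] u b\<delta> by (fastforce simp: M_def)
    define N where "N = delta_domain c \<inter> (\<lambda>w. root_at q w) -` ball 0 \<epsilon>"
    have holr: "(\<lambda>w. root_at q w) holomorphic_on delta_domain c"
      by (intro holomorphic_intros) (use delta_domainD[OF _ c(1,2)] in auto)
    have "open N" unfolding N_def
      by (rule continuous_open_preimage[OF holomorphic_on_imp_continuous_on[OF holr]]) auto
    have "(\<lambda>w. F w u) field_differentiable at w" if w: "w \<in> delta_domain c" for w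
    proof (cases "norm (root_at q w) < \<epsilon>")
      case True
      hence wN: "w \<in> N" using w by (simp add: N_def)
      have r0: "root_at q v \<noteq> 0" if "v \<in> N" for v
        using delta_domainD(3)[OF _ c(1,2), of v] that by (auto simp: N_def)
      have "((\<lambda>s. \<Phi> s u) \<circ> (\<lambda>w. root_at q w)) holomorphic_on N"
        by (intro holomorphic_on_compose holomorphic_on_subset[OF holr] holomorphic_on_subset[OF hol\<Phi>])
           (auto simp: N_def)
      hence "(\<lambda>w. \<Phi> (root_at q w) u) holomorphic_on N" by (simp add: o_def)
      moreover have "(\<lambda>w. root_at q w ^ p) holomorphic_on N"
        by (intro holomorphic_on_power holomorphic_on_subset[OF holr]) (auto simp: N_def)
      ultimately have "(\<lambda>w. \<Phi> (root_at q w) u / root_at q w ^ p) holomorphic_on N"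
        by (rule holomorphic_on_divide) (use r0 in auto)
      moreover have "F v u = \<Phi> (root_at q v) u / root_at q v ^ p" if "v \<in> N" for v
        using that by (intro near' u) (auto simp: N_def)
      ultimately have "(\<lambda>w. F w u) holomorphic_on N" by (simp cong: holomorphic_cong)
      thus ?thesis using \<open>open N\<close> wN by (meson holomorphic_on_imp_differentiable_at)
    next
      case False
      hence "norm (root_at q w) \<ge> \<epsilon> / 2" using \<epsilon> by simp
      then obtain z where "z \<in> K" "w \<in> ball z e2" using far'[OF w] by blast
      thus ?thesis using e2(2)[of z u] u b\<delta> by (meson holomorphic_on_imp_differentiable_at open_ball)
    qed
    thus "(\<lambda>w. F w u) holomorphic_on delta_domain c"
      by (simp add: holomorphic_on_open field_differentiable_def)
  qed (use near' in blast)
qed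

lemma root_at_2: "w \<noteq> 1 \<Longrightarrow> root_at 2 w = csqrt (1 - w)"
  by (subst csqrt_conv_powr) auto

lemma root_at_4:
  assumes "w \<noteq> 1"
  shows "root_at 4 w = csqrt (csqrt (1 - w))" "root_at 4 w ^ 2 = csqrt (1 - w)"
proof -
  have e: "csqrt (1 - w) = exp (Ln (1 - w) / 2)" using assms by (subst csqrt_conv_powr) (auto simp: powr_def)
  have r: "root_at 4 w = exp (Ln (1 - w) / 4)" using assms by (simp add: powr_def)
  show sq: "root_at 4 w ^ 2 = csqrt (1 - w)"
    unfolding r e by (simp add: exp_double[symmetric] field_simps)
  have "\<bar>Im (Ln (1 - w) / 4)\<bar> < pi / 2"
    using Im_Ln_le_pi[of "1 - w"] mpi_less_Im_Ln[of "1 - w"] assms pi_gt_zero by (simp add: abs_if)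
  hence "Re (root_at 4 w) > 0" unfolding r Re_exp by (intro mult_pos_pos cos_gt_zero_pi) auto
  thus "root_at 4 w = csqrt (csqrt (1 - w))" using csqrt_unique[OF sq] by simp
qed

lemma uniform_coeff_bound:
  assumes \<Phi>: "nice_at \<Phi> 0 b" and e0: "e0 > 0"
    and near: "\<And>w u. w \<in> delta_domain (1/3) \<Longrightarrow> u \<in> ball b e0 \<Longrightarrow> norm (csqrt (1 - w)) < e0 \<Longrightarrow>
       F w u = \<Phi> (csqrt (1 - w)) u"
    and far: "\<And>w. norm w \<le> 1 \<Longrightarrow> w \<noteq> 1 \<Longrightarrow> nice_at F w b"
  obtains \<delta> K where "\<delta> > 0" "K \<ge> 0"
    "\<And>u A n. u \<in> ball b \<delta> \<Longrightarrow> (\<lambda>w. F w u) has_fps_expansion A \<Longrightarrow> n \<ge> 2 \<Longrightarrow> norm (fps_nth A n) \<le> K * real n powr (-3/2)"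
proof (rule uniform_singularity_data[of 2 \<Phi> b e0 F 0])
  show "F w u = \<Phi> (root_at 2 w) u / root_at 2 w ^ 0"
    if "w \<in> delta_domain (1/3)" "u \<in> ball b e0" "norm (root_at 2 w) < e0" for w u
    using near[of w u] that delta_domainD(3)[OF that(1)] root_at_2[of w] by simp
  fix c \<epsilon> \<delta> M
  assume c: "0 < c" "c \<le> 1/3" and \<epsilon>: "0 < \<epsilon>" and \<delta>: "0 < \<delta>"
    and 1: "\<And>u. u \<in> ball b \<delta> \<Longrightarrow> (\<lambda>w. F w u) holomorphic_on delta_domain c"
    and 2: "\<And>u. u \<in> ball b \<delta> \<Longrightarrow> (\<lambda>s. \<Phi> s u) holomorphic_on ball 0 \<epsilon>"
    and 3: "\<And>u s. u \<in> ball b \<delta> \<Longrightarrow> s \<in> ball 0 \<epsilon> \<Longrightarrow> norm (\<Phi> s u) \<le> M"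
    and 4: "\<And>u w. u \<in> ball b \<delta> \<Longrightarrow> w \<in> delta_domain c \<Longrightarrow> norm (root_at 2 w) < \<epsilon> \<Longrightarrow>
       F w u = \<Phi> (root_at 2 w) u / root_at 2 w ^ 0"
    and 5: "\<And>u w. u \<in> ball b \<delta> \<Longrightarrow> w \<in> delta_domain c \<Longrightarrow> norm (root_at 2 w) \<ge> \<epsilon> / 2 \<Longrightarrow> norm (F w u) \<le> M"
  have M: "M \<ge> 0" using 3[of b 0] \<delta> \<epsilon> norm_ge_zero[of "\<Phi> 0 b"] by (simp del: norm_ge_zero)
  show thesis
  proof (rule transfer_sqrt_bound[OF \<epsilon> c])
    fix C :: real
    assume C: "C \<ge> 0" and T: "\<And>(f :: complex \<Rightarrow> complex) (\<Phi> :: complex \<Rightarrow> complex) F M n.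
        f holomorphic_on delta_domain c \<Longrightarrow> f has_fps_expansion F \<Longrightarrow>
        \<Phi> holomorphic_on ball 0 \<epsilon> \<Longrightarrow> (\<And>s. s \<in> ball 0 \<epsilon> \<Longrightarrow> norm (\<Phi> s) \<le> M) \<Longrightarrow>
        (\<And>w. w \<in> delta_domain c \<Longrightarrow> norm (csqrt (1 - w)) < \<epsilon> \<Longrightarrow> f w = \<Phi> (csqrt (1 - w))) \<Longrightarrow>
        (\<And>w. w \<in> delta_domain c \<Longrightarrow> norm (csqrt (1 - w)) \<ge> \<epsilon> / 2 \<Longrightarrow> norm (f w) \<le> M) \<Longrightarrow>
        n \<ge> 2 \<Longrightarrow> norm (fps_nth F n) \<le> C * M * real n powr (-3/2)"
    show thesis
    proof (rule that[OF \<delta>, of "C * M"])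
      show "C * M \<ge> 0" using C M by simp
      fix u A and n :: nat assume u: "u \<in> ball b \<delta>" and A: "(\<lambda>w. F w u) has_fps_expansion A" and n: "n \<ge> 2"
      show "norm (fps_nth A n) \<le> C * M * real n powr (-3/2)"
      proof (rule T[OF 1[OF u] A 2[OF u] _ _ _ n])
        fix w assume w: "w \<in> delta_domain c"
        have r: "root_at 2 w = csqrt (1 - w)" using delta_domainD(3)[OF w c] root_at_2[of w] by simp
        show "norm (csqrt (1 - w)) < \<epsilon> \<Longrightarrow> F w u = \<Phi> (csqrt (1 - w)) u" using 4[OF u w] r by simp
        show "norm (csqrt (1 - w)) \<ge> \<epsilon> / 2 \<Longrightarrow> norm (F w u) \<le> M" using 5[OF u w] r by simp
      qed (use 3 u in auto)
    qed
  qed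
qed (use assms in auto)

lemma coeff_asymptotics:
  fixes p q m0 :: nat
  assumes q: "q > 0" and \<Phi>: "nice_at \<Phi> 0 b" and e0: "e0 > 0"
    and near: "\<And>w u. w \<in> delta_domain (1/3) \<Longrightarrow> u \<in> ball b e0 \<Longrightarrow> norm (root_at q w) < e0 \<Longrightarrow>
       F w u = \<Phi> (root_at q w) u / root_at q w ^ p"
    and far: "\<And>w. norm w \<le> 1 \<Longrightarrow> w \<noteq> 1 \<Longrightarrow> nice_at F w b"
    and A: "(\<lambda>w. F w b) has_fps_expansion A"
    and m0: "m0 < p + q" and int: "\<And>m. m < m0 \<Longrightarrow> (real m - real p) / real q \<in> \<nat>"
    and \<beta>: "\<beta> = (real m0 - real p) / real q"
  shows "(\<lambda>n. fps_nth A n * of_real (real n powr (\<beta> + 1))) \<longlonglongrightarrow>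
           (deriv ^^ m0) (\<lambda>s. \<Phi> s b) 0 / fact m0 * rGamma (- of_real \<beta>)"
proof (rule uniform_singularity_data[OF q \<Phi> e0 near far])
  fix c \<epsilon> \<delta> M
  assume *: "0 < c" "c \<le> 1/3" "0 < \<epsilon>" "0 < \<delta>"
    "\<And>u. u \<in> ball b \<delta> \<Longrightarrow> (\<lambda>w. F w u) holomorphic_on delta_domain c"
    "\<And>u. u \<in> ball b \<delta> \<Longrightarrow> (\<lambda>s. \<Phi> s u) holomorphic_on ball 0 \<epsilon>"
    "\<And>u s. u \<in> ball b \<delta> \<Longrightarrow> s \<in> ball 0 \<epsilon> \<Longrightarrow> norm (\<Phi> s u) \<le> M"
    "\<And>u w. u \<in> ball b \<delta> \<Longrightarrow> w \<in> delta_domain c \<Longrightarrow> norm (root_at q w) < \<epsilon> \<Longrightarrow>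
       F w u = \<Phi> (root_at q w) u / root_at q w ^ p"
    "\<And>u w. u \<in> ball b \<delta> \<Longrightarrow> w \<in> delta_domain c \<Longrightarrow> norm (root_at q w) \<ge> \<epsilon> / 2 \<Longrightarrow> norm (F w u) \<le> M"
  have b: "b \<in> ball b \<delta>" using *(4) by simp
  show ?thesis
    by (rule transfer_asymptotics[OF q *(3,1,2) *(5)[OF b] A *(6)[OF b] *(7)[OF b] *(8)[OF b] *(9)[OF b] m0 int \<beta>])
qed auto

text \<open>
  The square roots of the radicands from the index \<open>j\<close> on, as functions of the root \<open>y\<close> at \<open>j\<close>. Unlike
  \<open>csqrt (rad a z i)\<close>, this is analytic at \<open>y = 0\<close>.
\<close>

fun chain :: "(nat \<Rightarrow> complex) \<Rightarrow> complex \<Rightarrow> complex \<Rightarrow> nat \<Rightarrow> nat \<Rightarrow> complex" where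
  "chain a z y j 0 = y"
| "chain a z y j (Suc i) = csqrt (1 - 2 * z - 4 * a (j + Suc i) * z\<^sup>2 + 2 * z * chain a z y j i)"

lemma chain_eq: "y = csqrt (rad a z j) \<Longrightarrow> chain a z y j i = csqrt (rad a z (j + i))"
  by (induction i) auto

lemma nice_at_chain:
  assumes Z: "nice_at Z s0 u0" and a: "\<And>i. nice_at (\<lambda>s u. a u i) s0 u0" and y: "nice_at y s0 u0"
    and y0: "y s0 u0 = csqrt (rad (a u0) (Z s0 u0) j)"
    and "\<And>m. m < i \<Longrightarrow> rad (a u0) (Z s0 u0) (j + Suc m) \<notin> \<real>\<^sub>\<le>\<^sub>0"
  shows "nice_at (\<lambda>s u. chain (a u) (Z s u) (y s u) j i) s0 u0"
  using assms(5)
proof (induction i)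
  case (Suc i)
  hence IH: "nice_at (\<lambda>s u. chain (a u) (Z s u) (y s u) j i) s0 u0" by simp
  show ?case unfolding chain.simps
  proof (rule nice_at_csqrt)
    show "nice_at (\<lambda>s u. 1 - 2 * Z s u - 4 * a u (j + Suc i) * (Z s u)\<^sup>2 + 2 * Z s u * chain (a u) (Z s u) (y s u) j i) s0 u0"
      by (intro nice_at_const nice_at_diff nice_at_add nice_at_mult nice_at_power Z a IH)
    show "1 - 2 * Z s0 u0 - 4 * a u0 (j + Suc i) * (Z s0 u0)\<^sup>2 + 2 * Z s0 u0 * chain (a u0) (Z s0 u0) (y s0 u0) j i \<notin> \<real>\<^sub>\<le>\<^sub>0"
      using Suc.prems[of i] by (simp add: chain_eq[OF y0])
  qed
qed (use y in simp)

text \<open>As \<open>Z\<close> is stationary at \<open>s0\<close>, only \<open>y\<close>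
  contributes to first order, and each later root multiplies the derivative by a nonzero factor. In
  the applications \<open>Z\<close> depends on s through s^2 or s^4, and this derivative is the
  leading coefficient of the singular expansion.\<close>

lemma chain_has_nonzero_derivative:
  assumes Z: "(Z has_field_derivative 0) (at s0)" "Z s0 \<noteq> 0"
    and y: "(y has_field_derivative D) (at s0)" "D \<noteq> 0" and y0: "y s0 = csqrt (rad a (Z s0) j)"
    and "\<And>m. m < i \<Longrightarrow> rad a (Z s0) (j + Suc m) \<notin> \<real>\<^sub>\<le>\<^sub>0"
  shows "\<exists>D. D \<noteq> 0 \<and> ((\<lambda>s. chain a (Z s) (y s) j i) has_field_derivative D) (at s0)"
  using assms(6)
proof (induction i)
  case 0
  show ?case using y by auto
next
  case (Suc i)
  then obtain E where E: "E \<noteq> 0" "((\<lambda>s. chain a (Z s) (y s) j i) has_field_derivative E) (at s0)" by auto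
  define g where "g = (\<lambda>s. 1 - 2 * Z s - 4 * a (j + Suc i) * (Z s)\<^sup>2 + 2 * Z s * chain a (Z s) (y s) j i)"
  have g0: "g s0 = rad a (Z s0) (j + Suc i)" by (simp add: g_def chain_eq[OF y0])
  have np: "g s0 \<notin> \<real>\<^sub>\<le>\<^sub>0" using Suc.prems[of i] g0 by simp
  have dg: "(g has_field_derivative (2 * Z s0 * E)) (at s0)"
    unfolding g_def by (auto intro!: derivative_eq_intros Z(1) E(2))
  have "((\<lambda>s. csqrt (g s)) has_field_derivative inverse (2 * csqrt (g s0)) * (2 * Z s0 * E)) (at s0)"
    by (rule DERIV_chain2[where f = csqrt, OF has_field_derivative_csqrt[OF np] dg])
  moreover have "(\<lambda>s. csqrt (g s)) = (\<lambda>s. chain a (Z s) (y s) j (Suc i))" by (simp add: g_def)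
  moreover have "inverse (2 * csqrt (g s0)) * (2 * Z s0 * E) \<noteq> 0" using np Z(2) E(1) by auto
  ultimately show ?case by metis
qed

lemma nice_at_eventually_all:
  fixes n :: nat
  assumes "\<And>m. m < n \<Longrightarrow> nice_at (F m) a b" "open V" "\<And>m. m < n \<Longrightarrow> F m a b \<in> V"
  shows "\<exists>e>0. \<forall>m<n. \<forall>s\<in>ball a e. \<forall>u\<in>ball b e. F m s u \<in> V"
  using assms(1,3)
proof (induction n)
  case 0
  show ?case by (intro exI[of _ 1]) auto
next
  case (Suc n)
  then obtain e where e: "e > 0" "\<And>m s u. m < n \<Longrightarrow> s \<in> ball a e \<Longrightarrow> u \<in> ball b e \<Longrightarrow> F m s u \<in> V"
    by (metis less_Suc_eq)
  obtain e' where e': "e' > 0" "\<And>s u. s \<in> ball a e' \<Longrightarrow> u \<in> ball b e' \<Longrightarrow> F n s u \<in> V"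
    using nice_at_eventually[of "F n" a b V] Suc.prems assms(2) by (metis lessI)
  show ?case
    by (intro exI[of _ "min e e'"]) (use e e' in \<open>auto simp: less_Suc_eq\<close>)
qed

lemma nice_at_wt: "nice_at (\<lambda>s u. wt k L u i) a b"
proof (rule nice_at_const_fst[OF open_UNIV])
  show "continuous_on UNIV (\<lambda>u. wt k L u i)"
  proof (cases "k - i = L")
    case True
    have "continuous_on UNIV (\<lambda>u. of_nat (k - i) * u :: complex)" by (intro continuous_intros)
    thus ?thesis by (rule continuous_on_eq) (use True in \<open>simp add: wt_def\<close>)
  qed (simp add: wt_def)
qed simp

text \<open>The first two assumptions put s into a sector of half-angle 60 degrees, where |Im s| < 2
  Re s because tan 60 = sqrt 3 is less than 2. The slopes 2 and 1/2 multiply to 1, so the product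
  remains in the right half-plane.\<close>

lemma Re_mult_csqrt_pos:
  assumes s: "Re (s\<^sup>2) > - norm (s\<^sup>2) / 2" "Re s \<ge> 0" "\<bar>Im g\<bar> < Re g / 2"
  shows "Re (s * g) > 0"
proof -
  have "(Re s)\<^sup>2 - (Im s)\<^sup>2 > - ((Re s)\<^sup>2 + (Im s)\<^sup>2) / 2"
    using s(1) unfolding norm_power cmod_power2 Re_power2 .
  moreover have "B < 4 * A" if "A - B > - (A + B) / 2" "0 \<le> A" for A B :: real
    using that by (simp add: field_simps)
  ultimately have "(Im s)\<^sup>2 < 4 * (Re s)\<^sup>2" using zero_le_power2 by blast
  hence "\<bar>Im s\<bar>\<^sup>2 < (2 * Re s)\<^sup>2" by (simp add: power_mult_distrib)
  hence Is: "\<bar>Im s\<bar> < 2 * Re s" by (rule power2_less_imp_less) (use s(2) in simp)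
  have "\<bar>Im s * Im g\<bar> = \<bar>Im s\<bar> * \<bar>Im g\<bar>" by (rule abs_mult)
  also have "\<dots> \<le> (2 * Re s) * \<bar>Im g\<bar>" using Is by (intro mult_right_mono) auto
  also have "\<dots> < (2 * Re s) * (Re g / 2)" using Is s(3) by (intro mult_strict_left_mono) auto
  finally have "\<bar>Im s * Im g\<bar> < Re s * Re g" by simp
  thus ?thesis by simp
qed

text \<open>Principal roots multiply as long as the product of the roots stays in the right
  half-plane; the aperture of \<open>delta_domain (1/3)\<close> is matched to this.\<close>

lemma csqrt_square_mult:
  assumes "w \<in> delta_domain (1/3)" "\<bar>Im (csqrt g)\<bar> < Re (csqrt g) / 2"
  shows "csqrt ((1 - w) * g) = csqrt (1 - w) * csqrt g"
proof (rule csqrt_unique)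
  show "(csqrt (1 - w) * csqrt g)\<^sup>2 = (1 - w) * g" by (simp add: power_mult_distrib)
  show "0 < Re (csqrt (1 - w) * csqrt g) \<or> Re (csqrt (1 - w) * csqrt g) = 0 \<and> 0 \<le> Im (csqrt (1 - w) * csqrt g)"
    using Re_mult_csqrt_pos[of "csqrt (1 - w)" "csqrt g"] delta_domainD(1)[OF assms(1)] csqrt_principal[of "1 - w"] assms(2)
    by auto
qed

lemma root_gf_nth_Suc: "fps_nth (root_gf k L u l) (Suc n) = - 2 * fps_nth (level_gf k L u l) n"
  by (simp add: root_gf_def mult.assoc numeral_fps_const)

lemma has_fps_expansion_scale:
  fixes \<rho> :: complex
  assumes "f has_fps_expansion A"
  shows "(\<lambda>w. f (\<rho> * w)) has_fps_expansion Abs_fps (\<lambda>n. \<rho> ^ n * fps_nth A n)"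
proof -
  have "(\<lambda>w. \<rho> * w) has_fps_expansion fps_const \<rho> * fps_X" by (intro fps_expansion_intros)
  with assms have "(f \<circ> (\<lambda>w. \<rho> * w)) has_fps_expansion fps_compose A (fps_const \<rho> * fps_X)"
    by (rule has_fps_expansion_compose) simp
  thus ?thesis by (simp add: o_def fps_compose_linear)
qed

lemma csqrt_rad_scaled_has_fps_expansion:
  "(\<lambda>w. csqrt (rad (wt k L u) (\<rho> * w) k)) has_fps_expansion Abs_fps (\<lambda>n. \<rho> ^ n * fps_nth (root_gf k L u 0) n)"
  using has_fps_expansion_scale[OF csqrt_rad_has_fps_expansion[of k k L u], of \<rho>] by simp

lemma nice_at_deriv_fst:
  assumes "nice_at F a b"
  shows "((\<lambda>s. F s b) has_field_derivative deriv (\<lambda>s. F s b) a) (at a)"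
  using nice_at_fixed[OF assms] by (metis centre_in_ball holomorphic_derivI open_ball)

subsection \<open>The square-root case\<close>

text \<open>Two situations are covered at once: for a marked index after j the function
  \<open>\<rho>\<close> is constant, otherwise it is the branch obtained by inverting
  \<open>crit_weightc\<close>. The common requirement is that the radicand j vanishes along
  \<open>\<rho>\<close>.\<close>

locale sqrt_case = decomposition +
  fixes i :: nat and \<rho> :: "complex \<Rightarrow> complex" and d :: real
  assumes t_pos: "t > 0" and ik: "i \<le> k" and d: "d > 0" and hol\<rho>: "\<rho> holomorphic_on ball 1 d"
    and \<rho>_1: "\<rho> 1 = of_real (1 / (2 * x))" and \<rho>_nz: "\<And>u. u \<in> ball 1 d \<Longrightarrow> \<rho> u \<noteq> 0"
    and rad_\<rho>: "\<And>u. u \<in> ball 1 d \<Longrightarrow> rad (wt k (k - i) u) (\<rho> u) j = 0"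
begin

abbreviation "r \<equiv> 1 / (2 * x)"
abbreviation "a \<equiv> \<lambda>u. wt k (k - i) u"

sublocale tower: real_tower "\<lambda>m. real (k - m)" "\<lambda>m. ystar m / x" r k
  by (rule tower_at_1)

lemma a_1: "a 1 = (\<lambda>m. complex_of_real (real (k - m)))"
  by (rule ext) (simp add: wt_def)

lemma j_less_k: "j < k"
proof -
  have "real k - real j = x * (x - 1) + t" using k_eq by (simp add: algebra_simps power2_eq_square)
  moreover have "x * (x - 1) \<ge> 0" using x_ge_1 by simp
  ultimately show ?thesis using t_pos by simp
qed

lemma \<sigma>_pos: "m \<noteq> j \<Longrightarrow> ystar m / x > 0"
  using ystar_pos[of m] t_pos x_ge_1 by simp

lemma rad_at_r:
  assumes "m \<le> k" "m \<noteq> j"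
  shows "rad (a 1) (of_real r) m \<notin> \<real>\<^sub>\<le>\<^sub>0"
proof -
  have "norm (complex_of_real r) \<le> r" using tower.r_pos by (simp only: norm_of_real)
  from tower.rad_notin_nonpos_Reals[OF this assms(1)] show ?thesis
    unfolding a_1 using \<sigma>_pos[OF assms(2)] by blast
qed

text \<open>Only the index j is delicate, all other \<open>\<sigma>\<close> being positive. There
  the equality case of the triangle inequality applies, since j \<ge> 1 and, by j < k, the levels
  belonging to j - 1 and j are positive.\<close>

lemma rad_at_boundary:
  assumes w: "norm w \<le> 1" "w \<noteq> 1" and m: "m \<le> k"
  shows "rad (a 1) (of_real r * w) m \<notin> \<real>\<^sub>\<le>\<^sub>0"
proof -
  have n: "norm (of_real r * w) \<le> r"
    using mult_left_mono[OF w(1), of r] tower.r_pos by (simp only: norm_mult norm_of_real) simp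
  show ?thesis
  proof (cases "m = j")
    case False
    thus ?thesis unfolding a_1 using tower.rad_notin_nonpos_Reals[OF n m] \<sigma>_pos[OF False] by simp
  next
    case True
    obtain j' where j': "j = Suc j'" using j_pos by (cases j) auto
    have "of_real r * w \<noteq> of_real r" using w tower.r_pos by auto
    thus ?thesis unfolding a_1 True j'
      by (intro tower.rad_notin_nonpos_Reals_boundary n) (use j_less_k j' in auto)
  qed
qed

lemma nice_\<rho>: "nice_at (\<lambda>s u. \<rho> u) s0 1"
  by (rule nice_at_const_fst[of "ball 1 d"]) (use d holomorphic_on_imp_continuous_on[OF hol\<rho>] in auto)

text \<open>
  For \<open>z = zz s u\<close> the radicand \<open>j\<close> is \<open>s\<^sup>2 G s u\<close>.
\<close>

definition "zz s u = \<rho> u * (1 - s\<^sup>2)"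
definition "G s u = - \<rho> u * rad_quot (a u) (zz s u) (\<rho> u) j"
definition "\<Phi> s u = chain (a u) (zz s u) (s * csqrt (G s u)) j (k - j)"
definition "F w u = csqrt (rad (a u) (\<rho> u * w) k)"

lemma nice_zz: "nice_at zz s0 1"
  unfolding zz_def by (intro nice_at_mult nice_at_diff nice_at_const nice_at_power nice_at_fst nice_\<rho>)

lemma zz_0: "zz 0 u = \<rho> u"
  by (simp add: zz_def)

lemma nice_G: "nice_at G 0 1"
proof -
  have "nice_at (\<lambda>s u. rad_quot (a u) (zz s u) (\<rho> u) j) 0 1"
    by (rule nice_at_rad_quot[where Z = zz and Z' = "\<lambda>s. \<rho>" and a = a])
       (use rad_at_r j_less_k in \<open>auto intro: nice_zz nice_\<rho> nice_at_wt simp: zz_0 \<rho>_1 simp del: of_real_divide\<close>)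
  from nice_at_mult[OF nice_at_mult[OF nice_at_const[of "-1"] nice_\<rho>] this]
  have "nice_at (\<lambda>s u. - 1 * \<rho> u * rad_quot (a u) (zz s u) (\<rho> u) j) 0 1" .
  thus ?thesis by (simp add: G_def[abs_def])
qed

lemma G_pos: "\<exists>g>0. G 0 1 = of_real g"
proof -
  obtain D where D: "D < 0" "rad_quot (a 1) (of_real r) (of_real r) j = of_real D"
    using tower.rad_quot_neg[of j] \<sigma>_pos j_less_k unfolding a_1 by auto
  have "G 0 1 = of_real (- r * D)" using D(2) by (simp add: G_def zz_0 \<rho>_1)
  moreover have "- r * D > 0" using D(1) tower.r_pos by (intro mult_neg_neg) (simp_all only: neg_less_0_iff_less)
  ultimately show ?thesis by blast
qed

lemma G_notin: "G 0 1 \<notin> \<real>\<^sub>\<le>\<^sub>0"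
  using G_pos by auto

lemma nice_csqrt_G: "nice_at (\<lambda>s u. csqrt (G s u)) 0 1"
  by (rule nice_at_csqrt[OF nice_G G_notin])

lemma rad_r_j: "rad (a 1) (of_real r) j = 0"
  using rad_\<rho>[of 1] d by (simp add: \<rho>_1)

lemma nice_\<Phi>: "nice_at \<Phi> 0 1"
  unfolding \<Phi>_def[abs_def]
proof (rule nice_at_chain[where a = a])
  show "nice_at (\<lambda>s u. s * csqrt (G s u)) 0 1" by (intro nice_at_mult nice_at_fst nice_csqrt_G)
  show "0 * csqrt (G 0 1) = csqrt (rad (a 1) (zz 0 1) j)" using rad_r_j by (simp add: zz_0 \<rho>_1)
  show "rad (a 1) (zz 0 1) (j + Suc m) \<notin> \<real>\<^sub>\<le>\<^sub>0" if "m < k - j" for m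
    using rad_at_r[of "j + Suc m"] that by (simp add: zz_0 \<rho>_1)
qed (intro nice_zz nice_at_wt)+

lemma nice_F: "norm w \<le> 1 \<Longrightarrow> w \<noteq> 1 \<Longrightarrow> nice_at F w 1"
  unfolding F_def[abs_def]
  by (rule nice_at_csqrt, rule nice_at_rad[where Z = "\<lambda>w u. \<rho> u * w" and a = a])
     (use rad_at_boundary in \<open>auto intro!: nice_at_mult nice_\<rho> nice_at_fst nice_at_wt simp: \<rho>_1 simp del: of_real_divide\<close>)

text \<open>Subtracting the vanishing radicand at \<open>\<rho> u\<close> and applying
  \<open>rad_diff\<close> extracts the factor 1 - w. The remaining factor \<open>G\<close> is close
  to a positive number, so the principal root of the product splits; \<open>chain\<close> transports
  the result to the outermost root.\<close>

lemma near: "\<exists>e>0. \<forall>w\<in>delta_domain (1/3). \<forall>u\<in>ball 1 e. norm (csqrt (1 - w)) < e \<longrightarrow> F w u = \<Phi> (csqrt (1 - w)) u"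
proof -
  have "\<exists>e>0. \<forall>m<j. \<forall>s\<in>ball 0 e. \<forall>u\<in>ball 1 e. rad (a u) (zz s u) m \<in> - \<real>\<^sub>\<le>\<^sub>0"
  proof (rule nice_at_eventually_all)
    fix m assume m: "m < j"
    show "nice_at (\<lambda>s u. rad (a u) (zz s u) m) 0 1"
      by (rule nice_at_rad[where Z = zz and a = a])
         (use rad_at_r m j_less_k in \<open>auto intro: nice_zz nice_at_wt simp: zz_0 \<rho>_1 simp del: of_real_divide\<close>)
    show "rad (a 1) (zz 0 1) m \<in> - \<real>\<^sub>\<le>\<^sub>0" using rad_at_r[of m] m j_less_k by (simp add: zz_0 \<rho>_1)
  qed (auto intro: open_Compl)
  then obtain e1 where e1: "e1 > 0" "\<And>m s u. m < j \<Longrightarrow> s \<in> ball 0 e1 \<Longrightarrow> u \<in> ball 1 e1 \<Longrightarrow> rad (a u) (zz s u) m \<notin> \<real>\<^sub>\<le>\<^sub>0"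
    by auto
  define V where "V = {g. \<bar>Im g\<bar> < Re g / 2}"
  have "open V" unfolding V_def by (intro open_Collect_less continuous_intros) auto
  moreover have "csqrt (G 0 1) \<in> V"
    using G_pos by (auto simp: V_def)
  ultimately obtain e2 where e2: "e2 > 0" "\<And>s u. s \<in> ball 0 e2 \<Longrightarrow> u \<in> ball 1 e2 \<Longrightarrow> csqrt (G s u) \<in> V"
    using nice_at_eventually[OF nice_csqrt_G] by blast
  define e where "e = min d (min e1 e2)"
  have e: "e > 0" "e \<le> d" "e \<le> e1" "e \<le> e2" using d e1 e2 by (auto simp: e_def)
  have "F w u = \<Phi> (csqrt (1 - w)) u"
    if w: "w \<in> delta_domain (1/3)" and u: "u \<in> ball 1 e" and s: "norm (csqrt (1 - w)) < e" for w u
  proof -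
    define s where "s = csqrt (1 - w)"
    have s2: "s\<^sup>2 = 1 - w" by (simp add: s_def)
    have z: "zz s u = \<rho> u * w" by (simp add: zz_def s2)
    have nm: "rad (a u) (zz s u) m \<notin> \<real>\<^sub>\<le>\<^sub>0" "rad (a u) (\<rho> u) m \<notin> \<real>\<^sub>\<le>\<^sub>0" if "m < j" for m
      using e1(2)[OF that, of s u] e1(2)[OF that, of 0 u] e s u by (auto simp: s_def zz_0)
    have "rad (a u) (zz s u) j = rad (a u) (zz s u) j - rad (a u) (\<rho> u) j"
      using rad_\<rho>[of u] u e by simp
    also have "\<dots> = (zz s u - \<rho> u) * rad_quot (a u) (zz s u) (\<rho> u) j"
      by (intro rad_diff csqrt_add_nonzero nm)
    also have "\<dots> = (1 - w) * G s u" by (simp add: G_def z algebra_simps)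
    finally have "csqrt (rad (a u) (zz s u) j) = s * csqrt (G s u)"
      using csqrt_square_mult[OF w, of "G s u"] e2(2)[of s u] s u e by (simp add: s_def V_def)
    from chain_eq[OF this[symmetric], of "k - j"] show ?thesis
      unfolding F_def \<Phi>_def s_def[symmetric] z using j_less_k by simp
  qed
  thus ?thesis using e(1) by blast
qed

lemma coeff_bound:
  obtains \<delta> K where "\<delta> > 0" "K \<ge> 0" "\<And>(u :: complex) n. u \<in> ball 1 \<delta> \<Longrightarrow> n \<ge> 2 \<Longrightarrow>
    norm (\<rho> u) ^ n * norm (fps_nth (root_gf k (k - i) u 0) n) \<le> K * real n powr (-3/2)"
proof -
  obtain e where e: "e > 0" "\<And>w (u :: complex). w\<in>delta_domain (1/3) \<Longrightarrow> u\<in>ball 1 e \<Longrightarrow> norm (csqrt (1 - w)) < e \<Longrightarrow> F w u = \<Phi> (csqrt (1 - w)) u"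
    using near by blast
  show ?thesis
  proof (rule uniform_coeff_bound[OF nice_\<Phi> e nice_F])
    fix \<delta> K :: real
    assume *: "\<delta> > 0" "K \<ge> 0" "\<And>(u :: complex) A n. u \<in> ball 1 \<delta> \<Longrightarrow> (\<lambda>w. F w u) has_fps_expansion A \<Longrightarrow> n \<ge> 2 \<Longrightarrow> norm (fps_nth A n) \<le> K * real n powr (-3/2)"
    show thesis
    proof (rule that[OF *(1,2)])
      fix u :: complex and n :: nat assume "u \<in> ball 1 \<delta>" "n \<ge> 2"
      from *(3)[OF this(1) csqrt_rad_scaled_has_fps_expansion[of k "k - i" u "\<rho> u", folded F_def] this(2)]
      show "norm (\<rho> u) ^ n * norm (fps_nth (root_gf k (k - i) u 0) n) \<le> K * real n powr (-3/2)"
        by (simp add: norm_mult norm_power)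
    qed
  qed
qed

text \<open>Since the limit is nonzero, this bounds the number of terms from below, which normalises
  the probability generating functions.\<close>

lemma coeff_limit:
  obtains c where "c \<noteq> 0" "(\<lambda>n. of_real r ^ n * fps_nth (root_gf k (k - i) 1 0) n * of_real (real n powr (3/2))) \<longlonglongrightarrow> c"
proof -
  obtain e where e: "e > 0" "\<And>w (u :: complex). w\<in>delta_domain (1/3) \<Longrightarrow> u\<in>ball 1 e \<Longrightarrow> norm (csqrt (1 - w)) < e \<Longrightarrow> F w u = \<Phi> (csqrt (1 - w)) u"
    using near by blast
  have near2: "F w u = \<Phi> (root_at 2 w) u / root_at 2 w ^ 0"
    if "w \<in> delta_domain (1/3)" "u \<in> ball 1 e" "norm (root_at 2 w) < e" for w u
    using e(2)[of w u] that delta_domainD(3)[OF that(1)] root_at_2[of w] by simp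
  have A: "(\<lambda>w. F w 1) has_fps_expansion Abs_fps (\<lambda>n. of_real r ^ n * fps_nth (root_gf k (k - i) 1 0) n)"
    using csqrt_rad_scaled_has_fps_expansion[of k "k - i" 1 "of_real r"] unfolding F_def \<rho>_1 .
  have "(\<lambda>n. fps_nth (Abs_fps (\<lambda>n. of_real r ^ n * fps_nth (root_gf k (k - i) 1 0) n)) n * of_real (real n powr (1/2 + 1))) \<longlonglongrightarrow>
           (deriv ^^ 1) (\<lambda>s. \<Phi> s 1) 0 / fact 1 * rGamma (- of_real (1/2))"
    by (rule coeff_asymptotics[OF _ nice_\<Phi> e(1) near2 nice_F A]) auto
  hence lim: "(\<lambda>n. of_real r ^ n * fps_nth (root_gf k (k - i) 1 0) n * of_real (real n powr (3/2))) \<longlonglongrightarrow>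
           deriv (\<lambda>s. \<Phi> s 1) 0 * rGamma (- of_real (1/2))"
    by simp
  have "\<exists>D. D \<noteq> 0 \<and> ((\<lambda>s. \<Phi> s 1) has_field_derivative D) (at 0)"
    unfolding \<Phi>_def
  proof (rule chain_has_nonzero_derivative)
    show "((\<lambda>s. zz s 1) has_field_derivative 0) (at 0)"
      unfolding zz_def by (auto intro!: derivative_eq_intros)
    show "zz 0 1 \<noteq> 0" using tower.r_pos x_ge_1 by (simp add: zz_0 \<rho>_1)
    show "((\<lambda>s. s * csqrt (G s 1)) has_field_derivative csqrt (G 0 1)) (at 0)"
      using DERIV_mult[OF DERIV_ident nice_at_deriv_fst[OF nice_csqrt_G]] by simp
    show "csqrt (G 0 1) \<noteq> 0" using G_notin by auto
    show "0 * csqrt (G 0 1) = csqrt (rad (a 1) (zz 0 1) j)" using rad_r_j by (simp add: zz_0 \<rho>_1)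
    show "rad (a 1) (zz 0 1) (j + Suc m) \<notin> \<real>\<^sub>\<le>\<^sub>0" if "m < k - j" for m
      using rad_at_r[of "j + Suc m"] that by (simp add: zz_0 \<rho>_1)
  qed
  hence "deriv (\<lambda>s. \<Phi> s 1) 0 \<noteq> 0" using DERIV_imp_deriv by blast
  moreover have "rGamma (- of_real (1/2)) \<noteq> (0::complex)"
  proof -
    have "- complex_of_real (1/2) \<notin> \<int>\<^sub>\<le>\<^sub>0"
    proof
      assume "- complex_of_real (1/2) \<in> \<int>\<^sub>\<le>\<^sub>0"
      then obtain m where m: "- complex_of_real (1/2) = of_int m" by (elim nonpos_Ints_cases)
      hence "Re (- complex_of_real (1/2)) = real_of_int m" by simp
      hence "real_of_int (2 * m) = real_of_int (-1)" by simp
      hence "2 * m = -1" by (simp only: of_int_eq_iff)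
      thus False by presburger
    qed
    thus ?thesis by (simp add: rGamma_eq_zero_iff)
  qed
  ultimately show ?thesis using that[OF _ lim] by simp
qed

end

section \<open>The analytic branch of the singularity near u = 1\<close>

lemma has_real_derivative_of_complex:
  fixes f :: "complex \<Rightarrow> complex" and g :: "real \<Rightarrow> real"
  assumes f: "(f has_field_derivative F) (at (of_real y))"
    and eq: "eventually (\<lambda>x. f (of_real x) = of_real (g x)) (nhds y)"
  shows "(g has_real_derivative Re F) (at y)" "F = of_real (deriv g y)"
proof -
  have v: "((\<lambda>x. f (of_real x)) has_vector_derivative F) (at y)"
    by (rule has_vector_derivative_real_field[OF f])
  have v': "((\<lambda>x. complex_of_real (g x)) has_vector_derivative F) (at y)"
  proof -
    obtain S where S: "open S" "y \<in> S" "\<And>x. x \<in> S \<Longrightarrow> f (of_real x) = of_real (g x)"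
      using eq unfolding eventually_nhds by blast
    show ?thesis by (rule has_vector_derivative_transform_within_open[OF v S(1,2)]) (use S(3) in auto)
  qed
  have "((\<lambda>x. Re (complex_of_real (g x))) has_vector_derivative Re F) (at y)"
    by (rule bounded_linear.has_vector_derivative[OF bounded_linear_Re v'])
  thus g: "(g has_real_derivative Re F) (at y)" by (simp add: has_real_derivative_iff_has_vector_derivative)
  have "((\<lambda>x. Im (complex_of_real (g x))) has_vector_derivative Im F) (at y)"
    by (rule bounded_linear.has_vector_derivative[OF bounded_linear_Im v'])
  hence "((\<lambda>x. 0) has_real_derivative Im F) (at y)" by (simp add: has_real_derivative_iff_has_vector_derivative)
  hence "Im F = 0" using DERIV_const DERIV_unique by blast
  moreover have "deriv g y = Re F" using g by (rule DERIV_imp_deriv)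
  ultimately show "F = of_real (deriv g y)" by (simp add: complex_eq_iff)
qed

text \<open>The condition for normality speaks of real derivatives of \<open>B_tilde\<close>, the
  quasi-power argument of complex derivatives of an analytic \<open>B\<close>. Agreement on a real
  neighbourhood identifies the two, up to second order.\<close>

lemma derivs_of_real_restriction:
  fixes f :: "complex \<Rightarrow> complex" and g :: "real \<Rightarrow> real"
  assumes hol: "f holomorphic_on ball (of_real y) e" and e: "e > 0"
    and eq: "eventually (\<lambda>x. f (of_real x) = of_real (g x)) (nhds y)"
  shows "deriv f (of_real y) = of_real (deriv g y)" "deriv (deriv f) (of_real y) = of_real (deriv (deriv g) y)"
proof -
  obtain S where S: "open S" "y \<in> S" "\<And>x. x \<in> S \<Longrightarrow> f (of_real x) = of_real (g x)"
    using eq unfolding eventually_nhds by blast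
  have d1: "deriv f (of_real x) = of_real (deriv g x)" if "x \<in> S \<inter> ball y e" for x
  proof (rule has_real_derivative_of_complex(2))
    have "complex_of_real x \<in> ball (of_real y) e" using that by (simp add: dist_of_real)
    thus "(f has_field_derivative deriv f (of_real x)) (at (of_real x))" by (rule holomorphic_derivI[OF hol open_ball])
    show "eventually (\<lambda>x. f (of_real x) = of_real (g x)) (nhds x)"
      using S that unfolding eventually_nhds by blast
  qed
  show "deriv f (of_real y) = of_real (deriv g y)" using d1[of y] S e by simp
  show "deriv (deriv f) (of_real y) = of_real (deriv (deriv g) y)"
  proof (rule has_real_derivative_of_complex(2))
    show "(deriv f has_field_derivative deriv (deriv f) (of_real y)) (at (of_real y))"
      by (rule holomorphic_derivI[OF holomorphic_deriv[OF hol open_ball] open_ball]) (use e in simp)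
    have "open (S \<inter> ball y e)" "y \<in> S \<inter> ball y e" using S e by auto
    thus "eventually (\<lambda>x. deriv f (of_real x) = of_real (deriv g x)) (nhds y)"
      using d1 unfolding eventually_nhds by blast
  qed
qed

text \<open>A positive derivative at the single point x puts f x strictly between the values at x -
  h and x + h; the intermediate value theorem does the rest. It turns statements parametrised by y
  near x into statements about all u near f x.\<close>

lemma eventually_preimage_of_increasing:
  fixes f :: "real \<Rightarrow> real"
  assumes cont: "\<And>y. isCont f y" and D: "(f has_real_derivative D) (at x)" "D > 0"
    and P: "eventually P (nhds x)"
  shows "eventually (\<lambda>u. \<exists>y. P y \<and> f y = u) (nhds (f x))"
proof -
  obtain e where e: "e > 0" "\<And>y. dist y x < e \<Longrightarrow> P y" using P unfolding eventually_nhds_metric by auto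
  obtain d1 where d1: "d1 > 0" "\<And>h. h > 0 \<Longrightarrow> h < d1 \<Longrightarrow> f x < f (x + h)"
    using DERIV_pos_inc_right[OF D] by auto
  obtain d2 where d2: "d2 > 0" "\<And>h. h > 0 \<Longrightarrow> h < d2 \<Longrightarrow> f (x - h) < f x"
    using DERIV_pos_inc_left[OF D] by auto
  define h where "h = min e (min d1 d2) / 2"
  have h: "h > 0" "h < e" "h < d1" "h < d2" using e d1 d2 by (auto simp: h_def)
  have "f x \<in> {f (x - h)<..<f (x + h)}" using d1(2)[of h] d2(2)[of h] h by auto
  hence "eventually (\<lambda>u. u \<in> {f (x - h)<..<f (x + h)}) (nhds (f x))"
    by (intro eventually_nhds_in_open) auto
  thus ?thesis
  proof eventually_elim
    case (elim u)
    have "\<exists>y\<ge>x - h. y \<le> x + h \<and> f y = u"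
      by (rule IVT) (use elim h cont in auto)
    then obtain y where y: "x - h \<le> y" "y \<le> x + h" "f y = u" by blast
    hence "P y" using h by (intro e) (auto simp: dist_real_def)
    thus ?case using y by blast
  qed
qed

text \<open>Complex counterpart of \<open>real_towerI\<close>: a sequence satisfying the scaled
  recursion consists of the principal roots as soon as its quotients by z have positive real
  part.\<close>

lemma rad_param:
  assumes z: "z \<noteq> 0" and y0: "(y 0)\<^sup>2 = z\<^sup>2 - a 0"
    and yS: "\<And>m. m < j \<Longrightarrow> (y (Suc m))\<^sup>2 = z\<^sup>2 - z - a (Suc m) + y m"
    and Re: "\<And>m. m < j \<Longrightarrow> Re (y m / z) > 0"
  shows "m \<le> j \<Longrightarrow> rad a (1 / (2 * z)) m = (y m / z)\<^sup>2"
proof (induction m)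
  case 0
  show ?case using z y0 by (simp add: power_divide power_mult_distrib field_simps)
next
  case (Suc m)
  have "rad a (1 / (2 * z)) m = (y m / z)\<^sup>2" using Suc by simp
  hence "csqrt (rad a (1 / (2 * z)) m) = y m / z" using Re[of m] Suc.prems by (intro csqrt_unique) auto
  hence "rad a (1 / (2 * z)) (Suc m) = 1 - 1 / z - a (Suc m) / z\<^sup>2 + y m / z\<^sup>2"
    using z by (simp add: power_divide power_mult_distrib power2_eq_square)
  also have "\<dots> = (z\<^sup>2 - z - a (Suc m) + y m) / z\<^sup>2" using z by (simp add: field_simps power2_eq_square)
  also have "\<dots> = (y (Suc m) / z)\<^sup>2" using yS[of m] Suc.prems by (simp add: power_divide)
  finally show ?case .
qed

definition crit_towerc :: "nat \<Rightarrow> nat \<Rightarrow> nat \<Rightarrow> complex \<Rightarrow> nat \<Rightarrow> complex" where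
  "crit_towerc k j i z m = (if m < i then top_rootc k m z else bot_root (k - j) z (j - m))"

lemma rad_crit_weightc:
  assumes z: "z \<noteq> 0" and ij: "i \<le> j" "j \<le> k" "i < k" and Re: "\<And>m. m < j \<Longrightarrow> Re (crit_towerc k j i z m / z) > 0"
  shows "rad (wt k (k - i) (crit_weightc k j i z)) (1 / (2 * z)) j = 0"
proof -
  define a where "a = wt k (k - i) (crit_weightc k j i z)"
  have a: "a m = of_nat (k - m)" if "m \<noteq> i" "m \<le> k" for m
    using that ij by (auto simp: a_def wt_def)
  have ai: "a i = z\<^sup>2 - (if i = 0 then 0 else z - top_rootc k (i - 1) z) - (bot_root (k - j) z (j - i))\<^sup>2"
    using ij by (simp add: a_def wt_def crit_weightc_def)
  have "rad a (1 / (2 * z)) j = (crit_towerc k j i z j / z)\<^sup>2"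
  proof (rule rad_param[OF z, where y = "crit_towerc k j i z" and m = j and j = j])
    show "(crit_towerc k j i z 0)\<^sup>2 = z\<^sup>2 - a 0"
      using ai a[of 0] by (cases "i = 0") (auto simp: crit_towerc_def)
    fix m assume m: "m < j"
    consider "Suc m < i" | "Suc m = i" | "i < Suc m" by linarith
    thus "(crit_towerc k j i z (Suc m))\<^sup>2 = z\<^sup>2 - z - a (Suc m) + crit_towerc k j i z m"
    proof cases
      case 1
      thus ?thesis using a[of "Suc m"] ij by (simp add: crit_towerc_def)
    next
      case 2
      thus ?thesis using ai by (auto simp: crit_towerc_def)
    next
      case 3
      have "j - m = Suc (j - Suc m)" using m by simp
      hence "bot_root (k - j) z (j - m) = (bot_root (k - j) z (j - Suc m))\<^sup>2 - (z\<^sup>2 - z - of_nat (k - j + (j - Suc m)))" by simp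
      moreover have "k - j + (j - Suc m) = k - Suc m" using m ij by simp
      ultimately show ?thesis using 3 a[of "Suc m"] ij m by (simp add: crit_towerc_def)
    qed
  qed (use Re in auto)
  thus ?thesis using ij by (simp add: crit_towerc_def a_def)
qed

text \<open>\<open>\<xi>\<close> is the local inverse of \<open>crit_weightc\<close> at x, where the
  derivative D is positive, and stands for 1 / (2 \<rho>). That the radicand j vanishes along it
  comes from the complex tower; its agreement with \<open>rho_tilde\<close> at real weights comes
  from the real one.\<close>

lemma (in decomposition) inverse_function:
  assumes t0: "t > 0" and i: "i \<le> j" and jk': "j < k"
  obtains \<xi> d where "d > 0" "\<xi> holomorphic_on ball 1 d" "\<xi> 1 = of_real x" "\<And>u. u \<in> ball 1 d \<Longrightarrow> \<xi> u \<noteq> 0"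
    "\<And>u. u \<in> ball 1 d \<Longrightarrow> rad (wt k (k - i) u) (1 / (2 * \<xi> u)) j = 0"
    "\<exists>D>0. deriv \<xi> 1 = of_real D"
    "eventually (\<lambda>u. \<xi> (of_real u) = of_real (1 / (2 * rho_tilde k (k - i) u))) (nhds 1)"
proof -
  have ik: "i < k" using i jk' by simp
  have T: "top_root k m x > 0" if "m < i" for m
  proof -
    have "j - m = Suc (j - Suc m)" using that i by simp
    thus ?thesis using top_root_eq[of m] that i t t0 pseq_pos[of t "j - Suc m"] by simp
  qed
  have p: "bot_root (k - j) x m > 0" if "m > 0" for m
    using bot_root_eq[of m] pseq_pos[of t "m - 1"] that t0 by (cases m) (auto simp del: bot_root.simps pseq.simps)
  have p0: "bot_root (k - j) x m \<ge> 0" for m using bot_root_eq[of m] pseq_nonneg[of t m] t by simp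
  have xpos: "x > 1/2" using x_ge_1 by simp
  obtain D where D: "D > 0" "(crit_weightc k j i has_field_derivative of_real D) (at (of_real x))"
    using crit_weightc_has_field_derivative[of i k x j] T p0 xpos ik by blast
  have U1: "crit_weightc k j i (of_real x) = 1" using crit_weightc_of_real[of i k x j] T crit_weight_eq_1[OF i ik] by simp
  have "\<exists>e>0. \<forall>m<j. \<forall>z\<in>ball (of_real x) e. \<forall>u\<in>ball (0::complex) e. crit_towerc k j i z m / z \<in> {w. 0 < Re w}"
  proof (rule nice_at_eventually_all)
    fix m assume m: "m < j"
    have y: "crit_towerc k j i (of_real x) m = of_real (if m < i then top_root k m x else bot_root (k - j) x (j - m))"
      using top_rootc_of_real[of m k x] T by (auto simp: crit_towerc_def bot_root_of_real)
    have "nice_at (\<lambda>z u. crit_towerc k j i z m) (of_real x) 0"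
      unfolding crit_towerc_def using T by (cases "m < i") (auto intro!: nice_at_top_rootc nice_at_bot_root)
    thus "nice_at (\<lambda>z u. crit_towerc k j i z m / z) (of_real x) 0"
      by (rule nice_at_divide[OF _ nice_at_fst]) (use x_ge_1 in auto)
    have "(if m < i then top_root k m x else bot_root (k - j) x (j - m)) > 0" using T p m by auto
    thus "crit_towerc k j i (of_real x) m / of_real x \<in> {w. 0 < Re w}"
      unfolding y using x_ge_1 by (simp add: Re_divide_of_real)
  qed (auto intro: open_halfspace_Re_gt)
  then obtain e1 where e1: "e1 > 0"
    and e1': "\<forall>m<j. \<forall>z\<in>ball (of_real x) e1. \<forall>u\<in>ball (0::complex) e1. crit_towerc k j i z m / z \<in> {w. 0 < Re w}"
    by blast
  have Re_crit_towerc: "Re (crit_towerc k j i z m / z) > 0" if "m < j" "z \<in> ball (of_real x) e1" for m z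
    using e1'[rule_format, OF that, of 0] e1 by simp
  obtain e2 where e2: "e2 > 0" "crit_weightc k j i holomorphic_on ball (of_real x) e2"
    by (rule nice_at_fixed[OF nice_at_crit_weightc[of i k x j 0]]) (use T ik in auto)
  define e where "e = min (min e1 e2) x"
  have e: "e > 0" "e \<le> e1" "e \<le> e2" "e \<le> x" using e1 e2 x_ge_1 by (auto simp: e_def)
  have holU: "crit_weightc k j i holomorphic_on ball (of_real x) e" by (rule holomorphic_on_subset[OF e2(2)]) (use e in auto)
  have "deriv (crit_weightc k j i) (of_real x) \<noteq> 0" using DERIV_imp_deriv[OF D(2)] D(1) by simp
  then obtain s where s: "s > 0" "ball (of_real x) s \<subseteq> ball (complex_of_real x) e"
    "open (crit_weightc k j i ` ball (of_real x) s)" "inj_on (crit_weightc k j i) (ball (of_real x) s)"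
    using has_complex_derivative_locally_invertible[OF holU _ open_ball] e(1) by (metis centre_in_ball)
  have holUs: "crit_weightc k j i holomorphic_on ball (of_real x) s" by (rule holomorphic_on_subset[OF holU s(2)])
  obtain \<xi> where \<xi>: "\<xi> holomorphic_on crit_weightc k j i ` ball (of_real x) s"
    "\<And>z. z \<in> ball (of_real x) s \<Longrightarrow> deriv (crit_weightc k j i) z * deriv \<xi> (crit_weightc k j i z) = 1"
    "\<And>z. z \<in> ball (of_real x) s \<Longrightarrow> \<xi> (crit_weightc k j i z) = z"
    using holomorphic_has_inverse[OF holUs open_ball s(4)] by metis
  have xs: "of_real x \<in> ball (complex_of_real x) s" using s(1) by simp
  have "1 \<in> crit_weightc k j i ` ball (of_real x) s" using U1 xs by (metis imageI)
  then obtain d where d: "d > 0" "ball 1 d \<subseteq> crit_weightc k j i ` ball (of_real x) s"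
    using s(3) by (meson open_contains_ball)
  have \<xi>in: "\<xi> u \<in> ball (of_real x) s \<and> crit_weightc k j i (\<xi> u) = u" if "u \<in> ball 1 d" for u
    using that d(2) \<xi>(3) by auto
  have nz: "z \<noteq> 0" if "z \<in> ball (of_real x) s" for z :: complex
    using that s(2) e(4) by (auto simp: subset_iff)
  show ?thesis
  proof (rule that[OF d(1)])
    show "\<xi> holomorphic_on ball 1 d" by (rule holomorphic_on_subset[OF \<xi>(1) d(2)])
    show "\<xi> 1 = of_real x" using \<xi>(3)[OF xs] U1 by simp
    show "\<xi> u \<noteq> 0" if "u \<in> ball 1 d" for u using nz \<xi>in[OF that] by blast
    show "rad (wt k (k - i) u) (1 / (2 * \<xi> u)) j = 0" if "u \<in> ball 1 d" for u
    proof -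
      have "\<xi> u \<in> ball (of_real x) e1" using \<xi>in[OF that] s(2) e(2) by auto
      hence "rad (wt k (k - i) (crit_weightc k j i (\<xi> u))) (1 / (2 * \<xi> u)) j = 0"
        using Re_crit_towerc nz \<xi>in[OF that] i jk ik by (intro rad_crit_weightc) auto
      thus ?thesis using \<xi>in[OF that] by simp
    qed
    have "deriv (crit_weightc k j i) (of_real x) = of_real D" by (rule DERIV_imp_deriv[OF D(2)])
    hence "of_real D * deriv \<xi> 1 = 1" using \<xi>(2)[OF xs] U1 by simp
    hence "deriv \<xi> 1 = of_real (1 / D)" using D(1) by (simp add: field_simps)
    thus "\<exists>D>0. deriv \<xi> 1 = of_real D" using D(1) by (metis zero_less_divide_1_iff)
    \<comment> \<open>The hypotheses of \<open>rho_tilde_param\<close>, all of them strict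
      inequalities that hold at y = x and hence nearby. For the bottom roots this is where t > 0
      enters.\<close>
    have ev: "eventually (\<lambda>y. (\<forall>m\<in>{..<i}. top_root k m y > 0) \<and> (\<forall>m\<in>{1..j-i}. bot_root (k - j) y m > 0) \<and>
        y\<^sup>2 - y - real (k - j) + 1 > 0 \<and> crit_weight k j i y > 0 \<and> dist y x < s \<and> y > 0) (nhds x)"
    proof (intro eventually_conj eventually_ball_finite ballI)
      show "eventually (\<lambda>y. top_root k m y > 0) (nhds x)" if "m \<in> {..<i}" for m
        using isCont_top_root[of x k m] T[of m] that by (intro order_tendstoD(1)) (auto simp: isCont_def tendsto_nhds_iff simp del: top_root.simps)
      show "eventually (\<lambda>y. bot_root (k - j) y m > 0) (nhds x)" if "m \<in> {1..j-i}" for m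
        using isCont_bot_root[of x "k - j" m] p[of m] that by (intro order_tendstoD(1)) (auto simp: isCont_def tendsto_nhds_iff simp del: bot_root.simps)
      have "((\<lambda>y. y\<^sup>2 - y - real (k - j) + 1) \<longlongrightarrow> x\<^sup>2 - x - real (k - j) + 1) (nhds x)"
        by (intro tendsto_intros filterlim_ident)
      moreover have "x\<^sup>2 - x - real (k - j) + 1 > 0" using x_sq t jk by (simp add: of_nat_diff)
      ultimately show "eventually (\<lambda>y. y\<^sup>2 - y - real (k - j) + 1 > 0) (nhds x)" by (rule order_tendstoD(1))
      show "eventually (\<lambda>y. crit_weight k j i y > 0) (nhds x)"
        using isCont_crit_weight[OF ik, where J = j and x = x] crit_weight_eq_1[OF i ik] by (intro order_tendstoD(1)) (auto simp: isCont_def tendsto_nhds_iff)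
      show "eventually (\<lambda>y. dist y x < s) (nhds x)" using s(1) unfolding eventually_nhds_metric by auto
      show "eventually (\<lambda>y. y > 0) (nhds x)" by (intro order_tendstoD(1)[OF filterlim_ident]) (use x_ge_1 in simp)
    qed auto
    have evU: "eventually (\<lambda>y. crit_weightc k j i (of_real y) = of_real (crit_weight k j i y)) (nhds x)"
      using ev by eventually_elim (auto intro: crit_weightc_of_real)
    have "(crit_weight k j i has_real_derivative D) (at x)"
      using has_real_derivative_of_complex(1)[OF D(2) evU] by simp
    from eventually_preimage_of_increasing[OF isCont_crit_weight[OF ik] this D(1) eventually_conj[OF ev evU]]
    have "eventually (\<lambda>u. \<exists>y. (((\<forall>m\<in>{..<i}. top_root k m y > 0) \<and> (\<forall>m\<in>{1..j-i}. bot_root (k - j) y m > 0) \<and>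
        y\<^sup>2 - y - real (k - j) + 1 > 0 \<and> crit_weight k j i y > 0 \<and> dist y x < s \<and> y > 0) \<and> crit_weightc k j i (of_real y) = of_real (crit_weight k j i y)) \<and> crit_weight k j i y = u) (nhds 1)"
      using crit_weight_eq_1[OF i ik] by simp
    thus "eventually (\<lambda>u. \<xi> (of_real u) = of_real (1 / (2 * rho_tilde k (k - i) u))) (nhds 1)"
    proof eventually_elim
      case (elim u)
      then obtain y where y: "\<forall>m\<in>{..<i}. top_root k m y > 0" "\<forall>m\<in>{1..j-i}. bot_root (k - j) y m > 0"
        "y\<^sup>2 - y - real (k - j) + 1 > 0" "crit_weight k j i y > 0" "dist y x < s" "y > 0"
        "crit_weightc k j i (of_real y) = of_real (crit_weight k j i y)" "crit_weight k j i y = u"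
        by blast
      have "rho_tilde k (k - i) (crit_weight k j i y) = 1 / (2 * y)"
        by (rule rho_tilde_param) (use y i jk ik in auto)
      moreover have "complex_of_real y \<in> ball (of_real x) s" using y(5) by (simp add: dist_of_real dist_commute)
      hence "\<xi> (of_real u) = of_real y" using \<xi>(3) y(7,8) by metis
      ultimately show ?case using y(6,8) by simp
    qed
  qed
qed

section \<open>Normal limit and moments in the square-root case\<close>

context sqrt_case
begin

definition "B u = of_real r / \<rho> u"

text \<open>The generating function is a quotient of two coefficients: the uniform upper bound
  applies to the numerator, the limit at u = 1 to the denominator. The factors n^(3/2) cancel and
  the powers of \<open>\<rho>\<close> combine to a power of \<open>B\<close>.\<close>

lemma quasi_powers_bound:
  obtains \<delta> K where "\<delta> > 0" "\<delta> \<le> d" "eventually (\<lambda>n. finite (set_pmf (random_term k n)) \<and>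
    (\<forall>u\<in>ball 1 \<delta>. norm (\<Sum>s\<in>set_pmf (random_term k n). of_real (pmf (random_term k n) s) * u ^ leaves_at (k - i) s)
       \<le> K * norm (B u) ^ n)) sequentially"
proof -
  obtain \<delta> K where \<delta>: "\<delta> > 0" and K: "K \<ge> 0" and bd: "\<And>(u :: complex) n. u \<in> ball 1 \<delta> \<Longrightarrow> n \<ge> 2 \<Longrightarrow>
    norm (\<rho> u) ^ n * norm (fps_nth (root_gf k (k - i) u 0) n) \<le> K * real n powr (-3/2)"
    using coeff_bound by blast
  obtain c where c: "c \<noteq> 0" "(\<lambda>n. of_real r ^ n * fps_nth (root_gf k (k - i) 1 0) n * of_real (real n powr (3/2))) \<longlonglongrightarrow> c"
    using coeff_limit by blast
  have "B 1 = 1" using tower.r_pos by (simp add: B_def \<rho>_1)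
  have "continuous_on (ball 1 d) B"
    unfolding B_def by (intro continuous_intros holomorphic_on_imp_continuous_on hol\<rho>) (use \<rho>_nz in auto)
  hence "isCont B 1" using d by (simp add: continuous_on_eq_continuous_at)
  hence "(B \<longlongrightarrow> 1) (nhds 1)" using \<open>B 1 = 1\<close> by (simp add: isCont_def tendsto_nhds_iff)
  hence "eventually (\<lambda>u. B u \<in> ball 0 2) (nhds 1)" by (rule topological_tendstoD) auto
  then obtain e where e: "e > 0" "\<And>u. u \<in> ball 1 e \<Longrightarrow> norm (B u) < 2"
    unfolding eventually_nhds_metric by (auto simp: dist_commute)
  define \<delta>' where "\<delta>' = min (min \<delta> e) d"
  have \<delta>': "\<delta>' > 0" "\<delta>' \<le> \<delta>" "\<delta>' \<le> e" "\<delta>' \<le> d" using \<delta> e d by (auto simp: \<delta>'_def)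
  have "eventually (\<lambda>n. norm (of_real r ^ n * fps_nth (root_gf k (k - i) 1 0) n * of_real (real n powr (3/2))) > norm c / 2) sequentially"
    using c by (intro order_tendstoD(1)[OF tendsto_norm[OF c(2)]]) auto
  hence "eventually (\<lambda>n. norm (of_real r ^ Suc n * fps_nth (root_gf k (k - i) 1 0) (Suc n) * of_real (real (Suc n) powr (3/2))) > norm c / 2) sequentially"
    by (subst eventually_sequentially_Suc)
  hence ev: "eventually (\<lambda>n. finite (set_pmf (random_term k n)) \<and>
    (\<forall>u\<in>ball 1 \<delta>'. norm (\<Sum>s\<in>set_pmf (random_term k n). of_real (pmf (random_term k n) s) * u ^ leaves_at (k - i) s)
       \<le> (4 * K / norm c) * norm (B u) ^ n)) sequentially"
    using eventually_gt_at_top[of 0]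
  proof eventually_elim
    case (elim n)
    \<comment> \<open>Coefficient n + 1 of the root series is - 2 times coefficient n of the series
      of terms. The surplus factor \<open>B u\<close> is absorbed by the bound 2 on its
      norm.\<close>
    define N where "N = Suc n"
    define X where "X = real N powr (3/2)"
    define W where "W u = (\<Sum>s\<in>terms_at k 0 n. u ^ leaves_at (k - i) s)" for u :: complex
    have X: "X > 0" by (simp add: X_def N_def)
    have WN: "fps_nth (root_gf k (k - i) u 0) N = -2 * W u" for u
      unfolding N_def root_gf_nth_Suc by (simp add: level_gf_def W_def leaves_at_def)
    have lower: "norm c / 2 < r ^ N * (2 * norm (W 1)) * X"
    proof -
      have "norm (complex_of_real r) = r" using tower.r_pos by (simp only: norm_of_real abs_of_pos)
      thus ?thesis using elim(1) X unfolding N_def[symmetric] WN X_def[symmetric] norm_mult norm_power by simp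
    qed
    hence W1: "norm (W 1) > 0" using c(1) by (cases "W 1 = 0") auto
    have W1c: "W 1 = of_nat (card (terms_at k 0 n))" by (simp add: W_def)
    hence ne: "terms_at k 0 n \<noteq> {}" using W1 by auto
    have set: "set_pmf (random_term k n) = terms_at k 0 n"
      unfolding random_term_def closed_terms_of_size_eq using ne by (intro set_pmf_of_set) auto
    have pmf: "pmf (random_term k n) s = 1 / real (card (terms_at k 0 n))" if "s \<in> terms_at k 0 n" for s
      unfolding random_term_def closed_terms_of_size_eq using ne that by (subst pmf_of_set) (auto simp: indicator_def)
    have sum: "(\<Sum>s\<in>set_pmf (random_term k n). of_real (pmf (random_term k n) s) * u ^ leaves_at (k - i) s) = W u / W 1" for u
      unfolding set W1c W_def sum_divide_distrib by (intro sum.cong refl) (simp add: pmf)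
    have "norm (W u / W 1) \<le> (4 * K / norm c) * norm (B u) ^ n" if u: "u \<in> ball 1 \<delta>'" for u
    proof -
      have u\<delta>: "u \<in> ball 1 \<delta>" "u \<in> ball 1 d" "u \<in> ball 1 e" using u \<delta>' by auto
      have \<rho>p: "norm (\<rho> u) > 0" using \<rho>_nz[OF u\<delta>(2)] by simp
      have upper: "norm (\<rho> u) ^ N * (2 * norm (W u)) * X \<le> K"
      proof -
        have "norm (\<rho> u) ^ N * (2 * norm (W u)) \<le> K * real N powr (-3/2)"
          using bd[OF u\<delta>(1), of N, unfolded WN] elim(2) by (simp add: norm_mult N_def)
        also have "real N powr (-3/2) = 1 / X" by (simp add: X_def powr_minus_divide N_def)
        finally show ?thesis using X by (simp add: field_simps)
      qed
      have "norm c / 2 * (norm (\<rho> u) ^ N * (2 * norm (W u)) * X) \<le> (r ^ N * (2 * norm (W 1)) * X) * K"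
        using lower upper X zero_le_power[OF less_imp_le[OF tower.r_pos], of N]
        by (intro mult_mono) (auto intro!: mult_nonneg_nonneg simp del: zero_le_power_eq power_one_over)
      hence "norm c * norm (\<rho> u) ^ N * norm (W u) \<le> 2 * K * (r ^ N * norm (W 1))"
        using X by (simp add: mult_ac)
      hence "norm (W u) / norm (W 1) \<le> 2 * K / norm c * (r ^ N / norm (\<rho> u) ^ N)"
      proof -
        have "w / v \<le> 2 * K / b * (R / p)" if "b * p * w \<le> 2 * K * (R * v)" "v > 0" "p > 0" "b > 0" for w v R p b :: real
          using that by (simp add: field_simps)
        from this[OF _ W1] show ?thesis using c(1) \<rho>p \<open>norm c * _ * _ \<le> _\<close> by simp
      qed
      also have "r ^ N / norm (\<rho> u) ^ N = norm (B u) ^ N"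
      proof -
        have "norm (B u) = r / norm (\<rho> u)" unfolding B_def norm_divide
          using tower.r_pos by (simp only: norm_of_real abs_of_pos)
        thus ?thesis by (simp only: power_divide)
      qed
      also have "\<dots> = norm (B u) * norm (B u) ^ n" by (simp add: N_def)
      also have "2 * K / norm c * (norm (B u) * norm (B u) ^ n) \<le> 2 * K / norm c * (2 * norm (B u) ^ n)"
        using e(2)[OF u\<delta>(3)] K by (intro mult_left_mono mult_right_mono) auto
      finally show ?thesis by (simp add: norm_divide)
    qed
    moreover have "finite (set_pmf (random_term k n))" unfolding set by simp
    ultimately show ?case unfolding sum by blast
  qed
  show ?thesis by (rule that[OF \<delta>'(1,4) ev])
qed

lemma quasi_powers_instance:
  assumes "deriv B 1 = of_real b1" "deriv (deriv B) 1 = of_real b2"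
  obtains \<delta> K where "quasi_powers (random_term k) (leaves_at (k - i)) B \<delta> K b1 b2"
proof -
  obtain \<delta> K where *: "\<delta> > 0" "\<delta> \<le> d" "eventually (\<lambda>n. finite (set_pmf (random_term k n)) \<and>
    (\<forall>u\<in>ball 1 \<delta>. norm (\<Sum>s\<in>set_pmf (random_term k n). of_real (pmf (random_term k n) s) * u ^ leaves_at (k - i) s)
       \<le> K * norm (B u) ^ n)) sequentially"
    by (rule quasi_powers_bound)
  have sub: "ball 1 \<delta> \<subseteq> ball (1::complex) d" using *(2) by auto
  have "quasi_powers (random_term k) (leaves_at (k - i)) B \<delta> K b1 b2"
  proof
    show "B holomorphic_on ball 1 \<delta>"
      unfolding B_def[abs_def] by (intro holomorphic_intros holomorphic_on_subset[OF hol\<rho> sub]) (use \<rho>_nz sub in auto)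
    show "B 1 = 1" using tower.r_pos by (simp add: B_def \<rho>_1)
    show "B u \<noteq> 0" if "u \<in> ball 1 \<delta>" for u
      using \<rho>_nz[of u] that sub tower.r_pos x_ge_1 by (auto simp: B_def)
  qed (use * assms in \<open>auto elim: eventually_mono\<close>)
  thus ?thesis by (rule that)
qed

end

lemma rad_cong: "(\<And>m. m \<le> i \<Longrightarrow> a m = b m) \<Longrightarrow> rad a z i = rad b z i"
  by (induction i) auto

lemma asymp_equiv_linear:
  fixes f :: "nat \<Rightarrow> real"
  assumes "eventually (\<lambda>n. \<bar>f n - real n * c\<bar> \<le> C) sequentially" "c > 0"
  shows "f \<sim>[at_top] (\<lambda>n. c * real n)"
proof (rule asymp_equivI')
  have "(\<lambda>n. f n / (c * real n) - 1) \<longlonglongrightarrow> 0"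
  proof (rule Lim_null_comparison)
    show "eventually (\<lambda>n. norm (f n / (c * real n) - 1) \<le> C / (c * real n)) sequentially"
      using assms(1) eventually_gt_at_top[of 0]
    proof eventually_elim
      case (elim n)
      have "f n / (c * real n) - 1 = (f n - real n * c) / (c * real n)" using elim(2) assms(2) by (simp add: field_simps)
      hence "norm (f n / (c * real n) - 1) = \<bar>f n - real n * c\<bar> / (c * real n)"
        using elim(2) assms(2) by (simp add: abs_mult)
      thus ?case using divide_right_mono[OF elim(1), of "c * real n"] assms(2) by simp
    qed
    show "(\<lambda>n. C / (c * real n)) \<longlonglongrightarrow> 0" using assms(2) by real_asymp
  qed
  thus "(\<lambda>n. f n / (c * real n)) \<longlonglongrightarrow> 1" by (simp add: LIM_zero_iff)
qed

lemma proportional_to_nI: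
  assumes "eventually (\<lambda>n. \<bar>f n - real n * c\<bar> \<le> C) sequentially" "c > 0"
  shows "proportional_to_n f"
  unfolding proportional_to_n_def using asymp_equiv_linear[OF assms] assms(2) by blast

lemma proportional_to_n_imp_bigtheta:
  assumes "proportional_to_n f"
  shows "f \<in> \<Theta>(\<lambda>n. real n)"
proof -
  obtain c where c: "c > 0" "f \<sim>[at_top] (\<lambda>n. c * real n)" using assms unfolding proportional_to_n_def by blast
  have "f \<in> \<Theta>(\<lambda>n. c * real n)" by (rule asymp_equiv_imp_bigtheta[OF c(2)])
  thus ?thesis using c(1) by simp
qed

context decomposition
begin

text \<open>With the constant \<open>\<rho>\<close> one has B = 1, hence \<open>b1 = 0\<close>, and
  \<open>mean_asymp\<close> turns into a bound on the mean.\<close>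

lemma mean_leaves_bounded_sqrt:
  assumes t0: "t > 0" and L: "L < k - j"
  shows "mean_leaves k L \<in> O(\<lambda>n. 1)"
proof -
  define i where "i = k - L"
  have i: "i \<le> k" "j < i" "k - i = L" using L by (auto simp: i_def)
  interpret tw: real_tower "\<lambda>m. real (k - m)" "\<lambda>m. ystar m / x" "1 / (2 * x)" k by (rule tower_at_1)
  interpret sqrt_case k j t x i "\<lambda>u. of_real (1 / (2 * x))" 1
  proof unfold_locales
    fix u
    have "rad (wt k (k - i) u) (of_real (1 / (2 * x))) j = rad tw.ca (of_real (1 / (2 * x))) j"
      using i by (intro rad_cong) (auto simp: wt_def)
    also have "\<dots> = 0" using tw.rad_of_real[OF jk] ystar_j by simp
    finally show "rad (wt k (k - i) u) (of_real (1 / (2 * x))) j = 0" .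
  qed (use t0 i x_ge_1 in auto)
  have B1: "B = (\<lambda>u. 1)"
  proof
    fix u show "B u = 1" unfolding B_def using x_ge_1 by simp
  qed
  obtain \<delta> K where "quasi_powers (random_term k) (leaves_at (k - i)) B \<delta> K 0 0"
    by (rule quasi_powers_instance[of 0 0]) (simp_all only: B1 deriv_const of_real_0)
  then interpret quasi_powers "random_term k" "leaves_at (k - i)" B \<delta> K 0 0 .
  have "\<mu> = mean_leaves k (k - i)" by (rule ext) (simp only: \<mu>_def mean_leaves_def)
  hence "\<mu> = mean_leaves k L" unfolding i(3) .
  thus ?thesis using mean_asymp by (intro bigoI[of _ "K / \<delta>"]) simp
qed

text \<open>The slope of the mean is b1 = \<xi>'(1) / x, positive because the critical weight
  increases. The slope of the variance is nonnegative as a limit of nonnegative numbers, so being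
  nonzero makes it positive.\<close>

lemma leaves_linear_sqrt:
  assumes t0: "t > 0" and L: "k - j \<le> L" "L \<le> k"
  shows "proportional_to_n (mean_leaves k L)"
    and "deriv (deriv (B_tilde k L)) 1 + deriv (B_tilde k L) 1 - (deriv (B_tilde k L) 1)\<^sup>2 \<noteq> 0 \<Longrightarrow>
       leaves_asymp_normal k L \<and> proportional_to_n (var_leaves k L)"
proof -
  define i where "i = k - L"
  have i: "i \<le> j" "i \<le> k" "k - i = L" using L jk by (auto simp: i_def)
  have jk': "j < k"
  proof -
    have "real k - real j = x * (x - 1) + t" using k_eq by (simp add: algebra_simps power2_eq_square)
    moreover have "x * (x - 1) \<ge> 0" using x_ge_1 by simp
    ultimately show ?thesis using t0 by simp
  qed
  obtain \<xi> d where d: "d > 0" and \<xi>: "\<xi> holomorphic_on ball 1 d" "\<xi> 1 = of_real x" "\<And>u. u \<in> ball 1 d \<Longrightarrow> \<xi> u \<noteq> 0"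
    "\<And>u. u \<in> ball 1 d \<Longrightarrow> rad (wt k (k - i) u) (1 / (2 * \<xi> u)) j = 0"
    "\<exists>D>0. deriv \<xi> 1 = of_real D"
    "eventually (\<lambda>u. \<xi> (of_real u) = of_real (1 / (2 * rho_tilde k (k - i) u))) (nhds 1)"
  proof (rule inverse_function[OF t0 i(1) jk'])
    fix \<xi> d
    assume "0 < d" "\<xi> holomorphic_on ball 1 d" "\<xi> 1 = of_real x" "\<And>u. u \<in> ball 1 d \<Longrightarrow> \<xi> u \<noteq> 0"
      "\<And>u. u \<in> ball 1 d \<Longrightarrow> rad (wt k (k - i) u) (1 / (2 * \<xi> u)) j = 0"
      "\<exists>D>0. deriv \<xi> 1 = of_real D"
      "eventually (\<lambda>u. \<xi> (of_real u) = of_real (1 / (2 * rho_tilde k (k - i) u))) (nhds 1)"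
    thus thesis by (rule that)
  qed
  interpret sqrt_case k j t x i "\<lambda>u. 1 / (2 * \<xi> u)" d
  proof
    show "(\<lambda>u. 1 / (2 * \<xi> u)) holomorphic_on ball 1 d"
      by (rule holomorphic_on_divide[OF holomorphic_on_const holomorphic_on_mult[OF holomorphic_on_const \<xi>(1)]])
         (use \<xi>(3) in simp)
    show "1 / (2 * \<xi> 1) = of_real (1 / (2 * x))" by (simp add: \<xi>(2))
    show "1 / (2 * \<xi> u) \<noteq> 0" if "u \<in> ball 1 d" for u using \<xi>(3)[OF that] by simp
    show "rad (wt k (k - i) u) (1 / (2 * \<xi> u)) j = 0" if "u \<in> ball 1 d" for u by (rule \<xi>(4)[OF that])
  qed (fact t0 i(2) d)+
  have B: "B = (\<lambda>u. \<xi> u / of_real x)"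
  proof
    fix u show "B u = \<xi> u / of_real x" unfolding B_def by simp
  qed
  have holB: "B holomorphic_on ball (of_real 1) d" unfolding B
    using holomorphic_on_divide[OF \<xi>(1) holomorphic_on_const] x_ge_1 by simp
  have "\<xi> (of_real 1) = of_real (1 / (2 * rho_tilde k L 1))"
    using eventually_nhds_x_imp_x[OF \<xi>(6)] i(3) by simp
  hence "complex_of_real x = of_real (1 / (2 * rho_tilde k L 1))" using \<xi>(2) by simp
  hence x_eq: "x = 1 / (2 * rho_tilde k L 1)" by (simp only: of_real_eq_iff)
  have Bt: "eventually (\<lambda>u. B (of_real u) = of_real (B_tilde k L u)) (nhds 1)"
    using \<xi>(6)
  proof eventually_elim
    case (elim u)
    have "B (of_real u) = of_real (1 / (2 * rho_tilde k L u) / x)" using elim i(3) by (simp add: B)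
    also have "1 / (2 * rho_tilde k L u) / x = B_tilde k L u" using x_eq x_ge_1 by (simp add: B_tilde_def)
    finally show ?case .
  qed
  define b1 where "b1 = deriv (B_tilde k L) 1"
  define b2 where "b2 = deriv (deriv (B_tilde k L)) 1"
  have b: "deriv B 1 = of_real b1" "deriv (deriv B) 1 = of_real b2"
    using derivs_of_real_restriction[OF holB d Bt] by (simp_all add: b1_def b2_def)
  obtain D where D: "D > 0" "deriv \<xi> 1 = of_real D" using \<xi>(5) by blast
  have "(\<xi> has_field_derivative of_real D) (at 1)"
    using holomorphic_derivI[OF \<xi>(1) open_ball, of 1] d D(2) by simp
  hence "deriv B 1 = of_real (D / x)" unfolding B
    using DERIV_imp_deriv[OF DERIV_cdivide[of \<xi> "of_real D" 1 UNIV "of_real x"]] by simp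
  hence "b1 = D / x" using b(1) by (simp only: of_real_eq_iff)
  hence b1_pos: "b1 > 0" using D(1) x_ge_1 by simp
  obtain \<delta> K where "quasi_powers (random_term k) (leaves_at (k - i)) B \<delta> K b1 b2"
    by (rule quasi_powers_instance[OF b])
  then interpret Q: quasi_powers "random_term k" "leaves_at (k - i)" B \<delta> K b1 b2 .
  have "Q.\<mu> = mean_leaves k (k - i)" "Q.V = var_leaves k (k - i)"
    by (rule ext, simp only: Q.\<mu>_def mean_leaves_def Q.V_def var_leaves_def)+
  hence mv: "Q.\<mu> = mean_leaves k L" "Q.V = var_leaves k L" unfolding i(3) by auto
  show "proportional_to_n (mean_leaves k L)"
    using proportional_to_nI[OF Q.mean_asymp b1_pos] by (simp add: mv)
  assume "deriv (deriv (B_tilde k L)) 1 + deriv (B_tilde k L) 1 - (deriv (B_tilde k L) 1)\<^sup>2 \<noteq> 0"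
  hence s: "Q.\<sigma>2 \<noteq> 0" unfolding Q.\<sigma>2_def unfolding b1_def b2_def .
  hence "Q.\<sigma>2 > 0" using Q.\<sigma>2_nonneg by simp
  hence "proportional_to_n (var_leaves k L)"
    using proportional_to_nI[OF Q.var_asymp] by (simp add: mv)
  moreover have "leaves_asymp_normal k L"
    using Q.clt[OF s, unfolded mv] unfolding leaves_asymp_normal_def i(3) .
  ultimately show "leaves_asymp_normal k L \<and> proportional_to_n (var_leaves k L)" by blast
qed

end

subsection \<open>Two radicands that vanish together\<close>

lemma has_real_derivative_zero_at_right:
  fixes g :: "real \<Rightarrow> real"
  assumes D: "(g has_real_derivative D) (at x)" and ev: "eventually (\<lambda>y. g y = c) (at_right x)" and c: "g x = c"
  shows "D = 0"
proof -
  have "((\<lambda>y. (g y - g x) / (y - x)) \<longlongrightarrow> D) (at_right x)"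
    using D unfolding has_field_derivative_iff by (rule filterlim_mono[OF _ order_refl at_le]) auto
  moreover have "((\<lambda>y. (g y - g x) / (y - x)) \<longlongrightarrow> 0) (at_right x)"
    by (rule tendsto_eventually) (use ev c in \<open>auto elim: eventually_mono\<close>)
  ultimately show ?thesis by (rule tendsto_unique[rotated]) simp
qed

lemma has_real_derivative_zero_at_left:
  fixes g :: "real \<Rightarrow> real"
  assumes D: "(g has_real_derivative D) (at x)" and ev: "eventually (\<lambda>y. g y = c) (at_left x)" and c: "g x = c"
  shows "D = 0"
proof -
  have "((\<lambda>y. (g y - g x) / (y - x)) \<longlongrightarrow> D) (at_left x)"
    using D unfolding has_field_derivative_iff by (rule filterlim_mono[OF _ order_refl at_le]) auto
  moreover have "((\<lambda>y. (g y - g x) / (y - x)) \<longlongrightarrow> 0) (at_left x)"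
    by (rule tendsto_eventually) (use ev c in \<open>auto elim: eventually_mono\<close>)
  ultimately show ?thesis by (rule tendsto_unique[rotated]) simp
qed

definition smooth2_at :: "(real \<Rightarrow> real) \<Rightarrow> real \<Rightarrow> bool" where
  "smooth2_at f x \<longleftrightarrow> eventually (\<lambda>y. (f has_real_derivative deriv f y) (at y)) (nhds x) \<and>
     (deriv f has_real_derivative deriv (deriv f) x) (at x)"

lemma smooth2_at_crit_weight:
  assumes T: "\<And>m. m < i \<Longrightarrow> top_root k m x > 0" and i: "i < k"
  shows "smooth2_at (crit_weight k J i) x"
proof -
  have "eventually (\<lambda>y. \<forall>m\<in>{..<i}. top_root k m y > 0) (nhds x)"
  proof (intro eventually_ball_finite ballI)
    show "eventually (\<lambda>y. top_root k m y > 0) (nhds x)" if "m \<in> {..<i}" for m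
      using isCont_top_root[of x k m] T[of m] that by (intro order_tendstoD(1)) (auto simp: isCont_def tendsto_nhds_iff simp del: top_root.simps)
  qed auto
  hence evU: "eventually (\<lambda>y. crit_weightc k J i (of_real y) = of_real (crit_weight k J i y)) (nhds x)"
    by eventually_elim (auto intro: crit_weightc_of_real)
  then obtain S where S: "open S" "x \<in> S" "\<And>y. y \<in> S \<Longrightarrow> crit_weightc k J i (of_real y) = of_real (crit_weight k J i y)"
    unfolding eventually_nhds by blast
  obtain e where e: "e > 0" "crit_weightc k J i holomorphic_on ball (of_real x) e"
    by (rule nice_at_fixed[OF nice_at_crit_weightc[of i k x J 0]]) (use T i in auto)
  have d: "(crit_weight k J i has_real_derivative Re (deriv (crit_weightc k J i) (of_real y))) (at y)"
    "deriv (crit_weightc k J i) (of_real y) = of_real (deriv (crit_weight k J i) y)" if "y \<in> S \<inter> ball x e" for y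
  proof -
    have "complex_of_real y \<in> ball (of_real x) e" using that by (simp add: dist_of_real)
    hence 1: "(crit_weightc k J i has_field_derivative deriv (crit_weightc k J i) (of_real y)) (at (of_real y))"
      by (rule holomorphic_derivI[OF e(2) open_ball])
    have 2: "eventually (\<lambda>y. crit_weightc k J i (of_real y) = of_real (crit_weight k J i y)) (nhds y)"
      using S that unfolding eventually_nhds by blast
    show "(crit_weight k J i has_real_derivative Re (deriv (crit_weightc k J i) (of_real y))) (at y)"
      "deriv (crit_weightc k J i) (of_real y) = of_real (deriv (crit_weight k J i) y)"
      using has_real_derivative_of_complex[OF 1 2] by auto
  qed
  have evS: "eventually (\<lambda>y. y \<in> S \<inter> ball x e) (nhds x)"
    using S e by (intro eventually_nhds_in_open) auto
  have "eventually (\<lambda>y. (crit_weight k J i has_real_derivative deriv (crit_weight k J i) y) (at y)) (nhds x)"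
    using evS by eventually_elim (use d in force)
  moreover have "(deriv (crit_weightc k J i) has_field_derivative deriv (deriv (crit_weightc k J i)) (of_real x)) (at (of_real x))"
    by (rule holomorphic_derivI[OF holomorphic_deriv[OF e(2) open_ball] open_ball]) (use e in simp)
  hence "(deriv (crit_weight k J i) has_real_derivative Re (deriv (deriv (crit_weightc k J i)) (of_real x))) (at x)"
    by (rule has_real_derivative_of_complex(1)) (use evS d(2) in \<open>auto elim: eventually_mono\<close>)
  hence "(deriv (crit_weight k J i) has_real_derivative deriv (deriv (crit_weight k J i)) x) (at x)"
    using DERIV_imp_deriv by force
  ultimately show ?thesis unfolding smooth2_at_def by blast
qed

text \<open>
  A function whose inverse is given by different branches on the two sides of a point can only be
  twice differentiable there if the branches agree to second order.
\<close>

lemma two_sided_inverse_second_derivs: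
  fixes X U1 U2 :: "real \<Rightarrow> real"
  assumes X: "twice_differentiable_at X 1" and U: "smooth2_at U1 x" "smooth2_at U2 x" "U1 x = 1" "U2 x = 1"
    and inv: "eventually (\<lambda>y. X (U1 y) = y) (at_right x)" "eventually (\<lambda>y. X (U2 y) = y) (at_left x)"
  shows "deriv (deriv U1) x = deriv (deriv U2) x"
proof -
  have X1: "eventually (\<lambda>u. (X has_real_derivative deriv X u) (at u)) (nhds 1)"
    using X unfolding twice_differentiable_at_def
    by (auto elim!: eventually_mono simp: DERIV_deriv_iff_real_differentiable)
  have X2: "(deriv X has_real_derivative deriv (deriv X) 1) (at 1)"
    using X unfolding twice_differentiable_at_def by (simp add: DERIV_deriv_iff_real_differentiable)
  \<comment> \<open>Differentiating X (U y) = y on an open one-sided neighbourhood gives X'(U) U' =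
    1 there, and at x by continuity. This product is differentiable at x and constant on one side,
    so its derivative X'' U'^2 + X' U'' is 0; the first derivatives of both branches are 1 /
    X'(1).\<close>
  have main: "eventually (\<lambda>y. deriv X (U y) * deriv U y = 1) F \<and> deriv X 1 * deriv U x = 1 \<and>
       ((\<lambda>y. deriv X (U y) * deriv U y) has_real_derivative
          deriv (deriv X) 1 * deriv U x * deriv U x + deriv X 1 * deriv (deriv U) x) (at x)"
    if sm: "smooth2_at U x" and Ux: "U x = 1" and iv: "eventually (\<lambda>y. X (U y) = y) F"
      and F: "F = at_right x \<or> F = at_left x" for U F
  proof -
    have dU: "eventually (\<lambda>y. (U has_real_derivative deriv U y) (at y)) (nhds x)"
      "(deriv U has_real_derivative deriv (deriv U) x) (at x)" using sm unfolding smooth2_at_def by auto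
    have Ux': "(U has_real_derivative deriv U x) (at x)" using eventually_nhds_x_imp_x[OF dU(1)] .
    hence contU: "(U \<longlongrightarrow> 1) (nhds x)" using DERIV_isCont[OF Ux'] Ux by (simp add: isCont_def tendsto_nhds_iff)
    have evX: "eventually (\<lambda>y. (X has_real_derivative deriv X (U y)) (at (U y))) (nhds x)"
      using X1 contU by (rule eventually_compose_filterlim)
    have Fle: "F \<le> nhds x" using F by (auto simp: at_within_def)
    have "eventually (\<lambda>y. eventually (\<lambda>y. X (U y) = y) (nhds y)) F"
      using F
    proof
      assume F: "F = at_right x"
      then obtain b where b: "b > x" "\<And>y. y > x \<Longrightarrow> y < b \<Longrightarrow> X (U y) = y"
        using iv by (auto simp: eventually_at_right_field)
      have "eventually (\<lambda>y. y \<in> {x<..<b}) F" unfolding F using eventually_at_right_real[OF b(1)] .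
      thus ?thesis
        by eventually_elim (auto simp: eventually_nhds intro!: exI[of _ "{x<..<b}"] b(2))
    next
      assume F: "F = at_left x"
      then obtain b where b: "b < x" "\<And>y. y > b \<Longrightarrow> y < x \<Longrightarrow> X (U y) = y"
        using iv by (auto simp: eventually_at_left_field)
      have "eventually (\<lambda>y. y \<in> {b<..<x}) F" unfolding F using eventually_at_left_real[OF b(1)] .
      thus ?thesis
        by eventually_elim (auto simp: eventually_nhds intro!: exI[of _ "{b<..<x}"] b(2))
    qed
    moreover have "eventually (\<lambda>y. (U has_real_derivative deriv U y) (at y)) F" using dU(1) Fle by (rule filter_leD[rotated])
    moreover have "eventually (\<lambda>y. (X has_real_derivative deriv X (U y)) (at (U y))) F" using evX Fle by (rule filter_leD[rotated])
    ultimately have ev1: "eventually (\<lambda>y. deriv X (U y) * deriv U y = 1) F"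
    proof eventually_elim
      case (elim y)
      have "((\<lambda>y. X (U y)) has_real_derivative deriv X (U y) * deriv U y) (at y)"
        by (rule DERIV_chain2[OF elim(3,2)])
      hence "((\<lambda>y. y) has_real_derivative deriv X (U y) * deriv U y) (at y)"
        using elim(1) by (subst (asm) DERIV_cong_ev[OF refl _ refl]) auto
      thus ?case using DERIV_ident DERIV_unique by blast
    qed
    have D: "((\<lambda>y. deriv X (U y) * deriv U y) has_real_derivative
          deriv (deriv X) 1 * deriv U x * deriv U x + deriv X 1 * deriv (deriv U) x) (at x)"
      using DERIV_mult[OF DERIV_chain2[of "deriv X" "deriv (deriv X) 1" U x "deriv U x"] dU(2)] X2 Ux' Ux
      by (simp add: mult_ac add_ac)
    have "((\<lambda>y. deriv X (U y) * deriv U y) \<longlongrightarrow> deriv X 1 * deriv U x) F"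
    proof -
      have "isCont (\<lambda>y. deriv X (U y) * deriv U y) x" by (rule DERIV_isCont[OF D])
      hence "((\<lambda>y. deriv X (U y) * deriv U y) \<longlongrightarrow> deriv X 1 * deriv U x) (nhds x)"
        by (simp add: isCont_def tendsto_nhds_iff Ux)
      thus ?thesis by (rule filterlim_mono[OF _ order_refl Fle])
    qed
    moreover have "((\<lambda>y. deriv X (U y) * deriv U y) \<longlongrightarrow> 1) F" by (rule tendsto_eventually[OF ev1])
    moreover have "F \<noteq> bot" using F by (metis trivial_limit_at_left_real trivial_limit_at_right_real)
    ultimately have "deriv X 1 * deriv U x = 1" using tendsto_unique by blast
    with ev1 D show ?thesis by blast
  qed
  note m1 = main[OF U(1,3) inv(1) disjI1[OF refl]]
  note m2 = main[OF U(2,4) inv(2) disjI2[OF refl]]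
  have "deriv (deriv X) 1 * deriv U1 x * deriv U1 x + deriv X 1 * deriv (deriv U1) x = 0"
    by (rule has_real_derivative_zero_at_right[OF m1[THEN conjunct2, THEN conjunct2] m1[THEN conjunct1]])
       (use m1 U in simp)
  moreover have "deriv (deriv X) 1 * deriv U2 x * deriv U2 x + deriv X 1 * deriv (deriv U2) x = 0"
    by (rule has_real_derivative_zero_at_left[OF m2[THEN conjunct2, THEN conjunct2] m2[THEN conjunct1]])
       (use m2 U in simp)
  moreover have X0: "deriv X 1 \<noteq> 0" using m1 by auto
  hence "deriv U1 x = deriv U2 x" using m1 m2 by (metis mult_cancel_left)
  ultimately have "deriv X 1 * deriv (deriv U1) x = deriv X 1 * deriv (deriv U2) x" by (metis add_left_imp_eq)
  thus ?thesis using X0 by simp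
qed

lemma bot_root_poly: "\<exists>p. \<forall>y::real. poly p y = bot_root c y m"
proof (induction m)
  case 0
  show ?case by (intro exI[of _ 0]) simp
next
  case (Suc m)
  then obtain p where "\<forall>y::real. poly p y = bot_root c y m" by blast
  hence "\<forall>y::real. poly (p^2 - [:- real (c + m), -1, 1:]) y = bot_root c y (Suc m)"
    by (simp add: algebra_simps power2_eq_square)
  thus ?case by blast
qed

text \<open>
  The two branches of \<open>crit_weight\<close> differ by a multiple of \<open>(bot_root c y 1)\<^sup>2\<close>, and \<open>bot_root c y 1\<close>
  has a simple zero, whence they agree to first but not to second order.
\<close>

lemma bot_root_diff:
  "bot_root c y (Suc (Suc m)) - bot_root (Suc c) y (Suc m) =
     (bot_root c y (Suc 0))\<^sup>2 * (\<Prod>q=1..m. bot_root c y (Suc q) + bot_root (Suc c) y q)" for y :: real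
proof (induction m)
  case (Suc m)
  have "bot_root c y (Suc (Suc (Suc m))) - bot_root (Suc c) y (Suc (Suc m)) = (bot_root c y (Suc (Suc m)))\<^sup>2 - (bot_root (Suc c) y (Suc m))\<^sup>2"
    by (simp add: algebra_simps)
  also have "\<dots> = (bot_root c y (Suc (Suc m)) - bot_root (Suc c) y (Suc m)) * (bot_root c y (Suc (Suc m)) + bot_root (Suc c) y (Suc m))"
    by (simp only: algebra_simps power2_eq_square)
  also have "\<dots> = (bot_root c y (Suc 0))\<^sup>2 * (\<Prod>q=1..Suc m. bot_root c y (Suc q) + bot_root (Suc c) y q)"
    by (simp only: Suc.IH prod.cl_ivl_Suc) simp
  finally show ?case .
qed (simp add: algebra_simps)

text \<open>\<open>B_tilde\<close> is a multiple of the function X = 1 / (2 \<rho>), of which the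
  critical weights for the radicands j - 1 and j are one-sided inverses at x. A second derivative of
  X would force their second derivatives to agree, but these differ.\<close>

lemma (in decomposition) not_twice_differentiable_B_tilde:
  assumes t0: "t = 0" and L: "k - j < L" "L \<le> k"
  shows "\<not> twice_differentiable_at (B_tilde k L) 1"
proof
  assume td: "twice_differentiable_at (B_tilde k L) 1"
  define i where "i = k - L"
  have i: "i < j" "i < k" "k - i = L" using L jk by (auto simp: i_def)
  define c where "c = k - j"
  have c: "k - (j - 1) = Suc c" using j_pos jk by (simp add: c_def)
  have xx: "x\<^sup>2 - x = real c" using x_sq t0 jk by (simp add: c_def of_nat_diff)
  have T: "top_root k m x > 0" if "m < i" for m
  proof -
    have e: "j - m = Suc (j - Suc m)" "0 < j - Suc m" using that i by auto
    show ?thesis using top_root_eq[of m] pseq_pos[of 0 "j - Suc m"] e that i t0 by simp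
  qed
  have pb1: "bot_root c x m = pseq 0 m" for m using bot_root_eq[of m] t0 by (simp add: c_def)
  have pb2: "bot_root (Suc c) x m = pseq 0 (Suc m)" for m
  proof (induction m)
    case (Suc m)
    show ?case using xx by (simp add: Suc del: pseq.simps) simp
  qed simp
  define U1 where "U1 = crit_weight k (j - 1) i"
  define U2 where "U2 = crit_weight k j i"
  have sm: "smooth2_at U1 x" "smooth2_at U2 x" unfolding U1_def U2_def by (intro smooth2_at_crit_weight T i(2); assumption)+
  have U2x: "U2 x = 1" unfolding U2_def using i by (intro crit_weight_eq_1) auto
  have ji: "j - i = Suc (j - 1 - i)" using i by simp
  have diff: "U1 y - U2 y = (bot_root c y (Suc 0))\<^sup>2 * (\<Prod>q=1..j-1-i. bot_root c y (Suc q) + bot_root (Suc c) y q) / real L" for y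
  proof -
    have "U1 y - U2 y = ((bot_root c y (Suc (j - 1 - i)))\<^sup>2 - (bot_root (Suc c) y (j - 1 - i))\<^sup>2) / real L"
      unfolding U1_def U2_def crit_weight_def c i(3) ji c_def[symmetric] by (simp add: diff_divide_distrib)
    also have "(bot_root c y (Suc (j - 1 - i)))\<^sup>2 - (bot_root (Suc c) y (j - 1 - i))\<^sup>2 = bot_root c y (Suc (Suc (j - 1 - i))) - bot_root (Suc c) y (Suc (j - 1 - i))"
      by simp
    finally show ?thesis unfolding bot_root_diff .
  qed
  have U1x: "U1 x = 1" using diff[of x] U2x xx by (simp add: pb1)
  define X where "X u = 1 / (2 * rho_tilde k L u)" for u
  have evT: "eventually (\<lambda>y. \<forall>m\<in>{..<i}. top_root k m y > 0) (nhds x)"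
  proof (intro eventually_ball_finite ballI)
    show "eventually (\<lambda>y. top_root k m y > 0) (nhds x)" if "m \<in> {..<i}" for m
      using isCont_top_root[of x k m] T[of m] that by (intro order_tendstoD(1)) (auto simp: isCont_def tendsto_nhds_iff simp del: top_root.simps)
  qed auto
  have evp1: "eventually (\<lambda>y. \<forall>m\<in>{2..j-i}. bot_root c y m > 0) (nhds x)"
  proof (intro eventually_ball_finite ballI)
    show "eventually (\<lambda>y. bot_root c y m > 0) (nhds x)" if "m \<in> {2..j-i}" for m
      using isCont_bot_root[of x c m] pb1[of m] pseq_pos[of 0 "m - 1"] that
      by (intro order_tendstoD(1)) (auto simp: isCont_def tendsto_nhds_iff simp del: bot_root.simps pseq.simps)
  qed auto
  have evp2: "eventually (\<lambda>y. \<forall>m\<in>{1..j-1-i}. bot_root (Suc c) y m > 0) (nhds x)"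
  proof (intro eventually_ball_finite ballI)
    show "eventually (\<lambda>y. bot_root (Suc c) y m > 0) (nhds x)" if "m \<in> {1..j-1-i}" for m
      using isCont_bot_root[of x "Suc c" m] pb2[of m] pseq_pos[of 0 m] that
      by (intro order_tendstoD(1)) (auto simp: isCont_def tendsto_nhds_iff simp del: bot_root.simps pseq.simps)
  qed auto
  have evU1: "eventually (\<lambda>y. U1 y > 0) (nhds x)" unfolding U1_def
    using isCont_crit_weight[OF i(2), where J = "j - 1" and x = x] U1x by (intro order_tendstoD(1)) (auto simp: isCont_def tendsto_nhds_iff U1_def)
  have evU2: "eventually (\<lambda>y. U2 y > 0) (nhds x)" unfolding U2_def
    using isCont_crit_weight[OF i(2), where J = j and x = x] U2x by (intro order_tendstoD(1)) (auto simp: isCont_def tendsto_nhds_iff U2_def)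
  have evb: "eventually (\<lambda>y. y\<^sup>2 - y - real c + 1 > 0 \<and> y > 1/2) (nhds x)"
  proof (rule eventually_conj)
    have "((\<lambda>y. y\<^sup>2 - y - real c + 1) \<longlongrightarrow> x\<^sup>2 - x - real c + 1) (nhds x)"
      by (intro tendsto_intros filterlim_ident)
    thus "eventually (\<lambda>y. y\<^sup>2 - y - real c + 1 > 0) (nhds x)" by (rule order_tendstoD(1)) (use xx in simp)
    show "eventually (\<lambda>y. y > 1/2) (nhds x)" by (intro order_tendstoD(1)[OF filterlim_ident]) (use x_ge_1 in simp)
  qed
  \<comment> \<open>The sign of y^2 - y - c decides which radicand vanishes first. For y \<ge> x the
    radicand j stays nonnegative after the radicand j - 1 has vanished; for y < x the root at j - 1
    is still positive when the radicand j vanishes.\<close>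
  have mono: "(y\<^sup>2 - y) - (x\<^sup>2 - x) = (y - x) * (y + x - 1)" for y by (simp add: algebra_simps power2_eq_square)
  have inv1: "X (U1 y) = y"
    if "y \<ge> x" "\<forall>m\<in>{..<i}. top_root k m y > 0" "\<forall>m\<in>{1..j-1-i}. bot_root (Suc c) y m > 0" "U1 y > 0" for y
  proof -
    have "(y - x) * (y + x - 1) \<ge> 0" using that(1) x_ge_1 by simp
    hence "y\<^sup>2 - y - real c \<ge> 0" using mono[of y] xx by simp
    hence b: "y\<^sup>2 - y - real (k - (j - 1)) + 1 \<ge> 0" unfolding c by simp
    have p: "bot_root (k - (j - 1)) y m > 0" if "0 < m" "m \<le> j - 1 - i" for m
      unfolding c using that \<open>\<forall>m\<in>{1..j-1-i}. bot_root (Suc c) y m > 0\<close> by simp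
    have "rho_tilde k (k - i) (crit_weight k (j - 1) i y) = 1 / (2 * y)"
      by (rule rho_tilde_param) (use that p i jk x_ge_1 b in \<open>auto simp: U1_def\<close>)
    thus ?thesis using that(1) x_ge_1 by (simp add: X_def U1_def i(3))
  qed
  have inv2: "X (U2 y) = y"
    if "y < x" "\<forall>m\<in>{..<i}. top_root k m y > 0" "\<forall>m\<in>{2..j-i}. bot_root c y m > 0" "U2 y > 0" "y\<^sup>2 - y - real c + 1 > 0" "y > 1/2" for y
  proof -
    have "(y - x) * (y + x - 1) < 0" using that x_ge_1 by (intro mult_neg_pos) auto
    hence "bot_root c y 1 > 0" using mono[of y] xx by simp
    hence p: "bot_root (k - j) y m > 0" if "0 < m" "m \<le> j - i" for m
      using that \<open>\<forall>m\<in>{2..j-i}. bot_root c y m > 0\<close> by (cases "m = 1") (auto simp: c_def simp del: bot_root.simps)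
    have "rho_tilde k (k - i) (crit_weight k j i y) = 1 / (2 * y)"
      by (rule rho_tilde_param) (use that p i jk in \<open>auto simp: c_def U2_def\<close>)
    thus ?thesis using that by (simp add: X_def U2_def i(3))
  qed
  have X1: "X 1 = x"
    using inv1[of x] eventually_nhds_x_imp_x[OF evT] eventually_nhds_x_imp_x[OF evp2] U1x by simp
  hence rt1: "rho_tilde k L 1 = 1 / (2 * x)" using x_ge_1 by (auto simp: X_def field_simps)
  have XB: "X = (\<lambda>u. x * B_tilde k L u)"
    using x_ge_1 by (auto simp: X_def B_tilde_def rt1)
  have tdX: "twice_differentiable_at X 1"
  proof -
    have d: "deriv X u = x * deriv (B_tilde k L) u" if "B_tilde k L differentiable (at u)" for u
      unfolding XB using that by (intro DERIV_imp_deriv DERIV_cmult) (simp add: DERIV_deriv_iff_real_differentiable)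
    have ev: "eventually (\<lambda>u. B_tilde k L differentiable (at u)) (nhds 1)"
      using td unfolding twice_differentiable_at_def by blast
    have "eventually (\<lambda>u. X differentiable (at u)) (nhds 1)"
      using ev unfolding XB by eventually_elim (intro differentiable_mult differentiable_const)
    moreover have "(deriv (B_tilde k L) has_real_derivative deriv (deriv (B_tilde k L)) 1) (at 1)"
      using td unfolding twice_differentiable_at_def by (simp add: DERIV_deriv_iff_real_differentiable)
    hence "((\<lambda>u. x * deriv (B_tilde k L) u) has_real_derivative x * deriv (deriv (B_tilde k L)) 1) (at 1)"
      by (rule DERIV_cmult)
    hence "(deriv X has_real_derivative x * deriv (deriv (B_tilde k L)) 1) (at 1)"
      using ev d by (subst DERIV_cong_ev[OF refl _ refl]) (auto elim: eventually_mono)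
    ultimately show ?thesis unfolding twice_differentiable_at_def using real_differentiable_def by blast
  qed
  have "deriv (deriv U1) x = deriv (deriv U2) x"
  proof (rule two_sided_inverse_second_derivs[OF tdX sm U1x U2x])
    show "eventually (\<lambda>y. X (U1 y) = y) (at_right x)"
      unfolding eventually_at_filter using evT evp2 evU1 by eventually_elim (use inv1 in auto)
    show "eventually (\<lambda>y. X (U2 y) = y) (at_left x)"
      unfolding eventually_at_filter using evT evp1 evU2 evb by eventually_elim (use inv2 in auto)
  qed
  \<comment> \<open>The difference of the branches is the polynomial P^2 Q / L. As P vanishes at x,
    only the term 2 P'(x)^2 Q(x) / L survives in the second derivative, with P'(x) = - (2 x - 1) and
    Q(x) > 0.\<close>
  moreover have "deriv (deriv U1) x - deriv (deriv U2) x \<noteq> 0"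
  proof -
    obtain P where "\<forall>y::real. poly P y = bot_root c y (Suc 0)" using bot_root_poly by blast
    hence P: "poly P y = bot_root c y (Suc 0)" for y by blast
    have "\<exists>Q. \<forall>y::real. poly Q y = (\<Prod>q=1..n. bot_root c y (Suc q) + bot_root (Suc c) y q)" for n
    proof (induction n)
      case 0
      show ?case by (intro exI[of _ 1]) simp
    next
      case (Suc n)
      then obtain Q where Q: "\<forall>y::real. poly Q y = (\<Prod>q=1..n. bot_root c y (Suc q) + bot_root (Suc c) y q)" by blast
      obtain A where A: "\<forall>y::real. poly A y = bot_root c y (Suc (Suc n))" using bot_root_poly by blast
      obtain B where B: "\<forall>y::real. poly B y = bot_root (Suc c) y (Suc n)" using bot_root_poly by blast
      show ?case by (intro exI[of _ "Q * (A + B)"]) (use Q A B in \<open>simp del: bot_root.simps\<close>)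
    qed
    then obtain Q where "\<forall>y::real. poly Q y = (\<Prod>q=1..j-1-i. bot_root c y (Suc q) + bot_root (Suc c) y q)" by blast
    hence Q: "poly Q y = (\<Prod>q=1..j-1-i. bot_root c y (Suc q) + bot_root (Suc c) y q)" for y by blast
    define W where "W = smult (1 / real L) (P\<^sup>2 * Q)"
    have W: "U1 y - U2 y = poly W y" for y by (simp add: diff W_def P Q)
    have "eventually (\<lambda>y. deriv U1 y - deriv U2 y = poly (pderiv W) y) (nhds x)"
      using sm(1,2)[unfolded smooth2_at_def, THEN conjunct1]
    proof eventually_elim
      case (elim y)
      have "((\<lambda>y. U1 y - U2 y) has_real_derivative deriv U1 y - deriv U2 y) (at y)"
        by (rule DERIV_diff[OF elim])
      hence "(poly W has_real_derivative deriv U1 y - deriv U2 y) (at y)" by (simp only: W)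
      thus ?case using poly_DERIV DERIV_unique by blast
    qed
    moreover have "((\<lambda>y. deriv U1 y - deriv U2 y) has_real_derivative deriv (deriv U1) x - deriv (deriv U2) x) (at x)"
      using sm unfolding smooth2_at_def by (intro DERIV_diff) auto
    ultimately have "(poly (pderiv W) has_real_derivative deriv (deriv U1) x - deriv (deriv U2) x) (at x)"
      by (subst (asm) DERIV_cong_ev[OF refl _ refl]) auto
    hence "deriv (deriv U1) x - deriv (deriv U2) x = poly (pderiv (pderiv W)) x"
      using poly_DERIV DERIV_unique by blast
    also have "\<dots> = 2 * (poly (pderiv P) x)\<^sup>2 * poly Q x / real L"
    proof -
      have "poly P x = 0" by (simp add: P pb1 del: bot_root.simps)
      thus ?thesis unfolding W_def
        by (simp add: pderiv_smult pderiv_mult pderiv_add power2_eq_square algebra_simps)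
    qed
    also have "poly (pderiv P) x = - (2 * x - 1)"
    proof -
      have "(poly P has_real_derivative - (2 * x - 1)) (at x)"
        unfolding P[abs_def] bot_root.simps by (auto intro!: derivative_eq_intros)
      thus ?thesis using poly_DERIV DERIV_unique by blast
    qed
    finally have "deriv (deriv U1) x - deriv (deriv U2) x = 2 * (- (2 * x - 1))\<^sup>2 * poly Q x / real L" .
    moreover have "poly Q x > 0"
      unfolding Q using pseq_pos[of 0] by (intro prod_pos) (auto simp: pb1 pb2 simp del: bot_root.simps pseq.simps intro!: add_pos_pos)
    moreover have "(- (2 * x - 1))\<^sup>2 > 0" using x_ge_1 by simp
    moreover have "L > 0" using L by simp
    ultimately show ?thesis by simp
  qed
  ultimately show False by simp
qed

section \<open>Product formula for the total number of leaves\<close>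

lemma nice_at_prod:
  "(\<And>m. m \<in> A \<Longrightarrow> nice_at (F m) a b) \<Longrightarrow> nice_at (\<lambda>s u. \<Prod>m\<in>A. F m s u) a b"
  by (induction A rule: infinite_finite_induct) auto

text \<open>The linear recurrence, iterated upwards from level L, contributes one factor z and one
  root per level; below level L no leaf is counted. Keeping the roots on the left avoids division of
  formal series.\<close>

lemma level_count_gf_mult_prod:
  assumes "L \<le> k" "l \<le> L"
  shows "level_count_gf k L l * (\<Prod>m=l..L. root_gf k L 1 m) = fps_const (of_nat L) * fps_X ^ (Suc L - l)"
  using assms(2)
proof (induction rule: inc_induct)
  case base
  show ?case using level_count_gf_mult_root_gf[of L k L] assms by (simp add: level_count_gf_eq_0)
next
  case (step l)
  have "(\<Prod>m=l..L. root_gf k L 1 m) = root_gf k L 1 l * (\<Prod>m=Suc l..L. root_gf k L 1 m)"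
    using step.hyps by (intro prod.atLeast_Suc_atMost) auto
  hence "level_count_gf k L l * (\<Prod>m=l..L. root_gf k L 1 m) =
      (level_count_gf k L l * root_gf k L 1 l) * (\<Prod>m=Suc l..L. root_gf k L 1 m)" by (simp add: mult_ac)
  also have "level_count_gf k L l * root_gf k L 1 l = fps_X * level_count_gf k L (Suc l)"
    using level_count_gf_mult_root_gf[of l k L] step.hyps assms(1) by simp
  also have "fps_X * level_count_gf k L (Suc l) * (\<Prod>m=Suc l..L. root_gf k L 1 m) =
      fps_X * (level_count_gf k L (Suc l) * (\<Prod>m=Suc l..L. root_gf k L 1 m))" by (simp only: mult.assoc)
  also have "\<dots> = fps_X * (fps_const (of_nat L) * fps_X ^ (Suc L - Suc l))" using step.IH by simp
  also have "\<dots> = fps_const (of_nat L) * fps_X ^ (Suc L - l)"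
    using step.hyps by (simp add: Suc_diff_le mult_ac)
  finally show ?case .
qed

lemma fps_nth_prod_0: "fps_nth (\<Prod>m\<in>A. f m) 0 = (\<Prod>m\<in>A. fps_nth (f m :: 'a::comm_semiring_1 fps) 0)"
  by (induction A rule: infinite_finite_induct) auto

lemma level_count_gf_has_fps_expansion:
  assumes "L \<le> k"
  shows "(\<lambda>z. of_nat L * z ^ Suc L / (\<Prod>m=k-L..k. csqrt (rad (wt k L 1) z m))) has_fps_expansion level_count_gf k L 0"
proof -
  define Q where "Q = (\<Prod>m=0..L. root_gf k L 1 m)"
  have Q0: "fps_nth Q 0 = 1" by (simp add: Q_def fps_nth_prod_0)
  hence Qnz: "Q \<noteq> 0" by auto
  have "level_count_gf k L 0 * Q = fps_const (of_nat L) * fps_X ^ Suc L"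
    using level_count_gf_mult_prod[OF assms, of 0] by (simp add: Q_def)
  hence eq: "level_count_gf k L 0 = fps_const (of_nat L) * fps_X ^ Suc L / Q"
    using Qnz by (metis nonzero_mult_div_cancel_right)
  have "Q = (\<Prod>m=k-L..k. root_gf k L 1 (k - m))"
    unfolding Q_def
    by (rule prod.reindex_bij_witness[where i = "\<lambda>m. k - m" and j = "\<lambda>m. k - m"]) (use assms in auto)
  moreover have "(\<lambda>z. \<Prod>m=k-L..k. csqrt (rad (wt k L 1) z m)) has_fps_expansion (\<Prod>m=k-L..k. root_gf k L 1 (k - m))"
    by (intro has_fps_expansion_prod csqrt_rad_has_fps_expansion) auto
  ultimately have "(\<lambda>z. \<Prod>m=k-L..k. csqrt (rad (wt k L 1) z m)) has_fps_expansion Q" by simp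
  hence "(\<lambda>z. of_nat L * z ^ Suc L / (\<Prod>m=k-L..k. csqrt (rad (wt k L 1) z m))) has_fps_expansion
      fps_const (of_nat L) * fps_X ^ Suc L / Q"
    by (intro has_fps_expansion_divide' has_fps_expansion_mult has_fps_expansion_const has_fps_expansion_fps_X_power) (use Q0 in auto)
  thus ?thesis by (simp only: eq)
qed

lemma of_real_notin_nonpos_Ints:
  assumes "real_of_int n < y" "y < real_of_int n + 1"
  shows "complex_of_real y \<notin> \<int>\<^sub>\<le>\<^sub>0"
proof
  assume "complex_of_real y \<in> \<int>\<^sub>\<le>\<^sub>0"
  then obtain m where "complex_of_real y = of_int m" by (elim nonpos_Ints_cases)
  hence "y = real_of_int m" by (metis Re_complex_of_real of_real_of_int_eq)
  hence "real_of_int n < real_of_int m" "real_of_int m < real_of_int (n + 1)" using assms by auto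
  thus False by (simp only: of_int_less_iff)
qed

lemma mean_leaves_eq:
  assumes "terms_at k 0 n \<noteq> {}"
  shows "mean_leaves k L n = (\<Sum>s\<in>terms_at k 0 n. real (leaves_at L s)) / real (card (terms_at k 0 n))"
  unfolding mean_leaves_def random_term_def closed_terms_of_size_eq
  by (rule integral_pmf_of_set) (use assms in auto)

subsection \<open>The fourth-root case\<close>

text \<open>For j = 1 the vanishing pair would contain the index 0, whose radicand is even in z, so
  that - r would be singular as well. From j = 2 on, \<open>r\<close> is the only singular point of
  the roots on the circle.\<close>

locale quartic_case = decomposition +
  assumes t_0: "t = 0" and j_ge_2: "j \<ge> 2"
begin

abbreviation "r \<equiv> 1 / (2 * x)"

sublocale tower: real_tower "\<lambda>m. real (k - m)" "\<lambda>m. ystar m / x" r k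
  by (rule tower_at_1)

abbreviation "ca \<equiv> \<lambda>m. complex_of_real (real (k - m))"
abbreviation "cr \<equiv> complex_of_real r"

lemma norm_cr: "norm cr = r"
  using tower.r_pos by (simp only: norm_of_real abs_of_pos)

lemma cr_nz: "cr \<noteq> 0"
  using x_ge_1 by simp

lemma wt_1: "wt k L 1 = ca"
  by (rule ext) (simp add: wt_def)

lemma j_less_k: "j < k"
proof -
  have "real j \<ge> 2" using j_ge_2 by simp
  hence "x \<ge> 2" unfolding x_def pseq.simps using t zero_le_power2[of "pseq t j"] by linarith
  hence "x * (x - 1) > 0" by simp
  moreover have "real k - real j = x * (x - 1)" using k_eq t_0 by (simp add: algebra_simps power2_eq_square)
  ultimately show ?thesis by simp
qed

lemma \<sigma>_pos: "m \<noteq> j \<Longrightarrow> m \<noteq> j - 1 \<Longrightarrow> ystar m / x > 0"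
  using ystar_pos[of m] x_ge_1 by simp

lemma ystar_pred: "ystar (j - 1) = 0"
  unfolding ystar_def using j_ge_2 t_0 by simp

lemma rad_r_pred: "rad ca cr (j - 1) = 0" and rad_r_j: "rad ca cr j = 0"
  using tower.rad_of_real[of "j - 1"] tower.rad_of_real[of j] ystar_pred ystar_j j_less_k by simp_all

lemma rad_at_r: "m \<le> k \<Longrightarrow> m \<noteq> j \<Longrightarrow> m \<noteq> j - 1 \<Longrightarrow> rad ca cr m \<notin> \<real>\<^sub>\<le>\<^sub>0"
  using tower.rad_notin_nonpos_Reals[of cr m] \<sigma>_pos[of m] norm_cr by auto

lemma rad_at_boundary:
  assumes w: "norm w \<le> 1" "w \<noteq> 1" and m: "m \<le> k"
  shows "rad ca (cr * w) m \<notin> \<real>\<^sub>\<le>\<^sub>0"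
proof -
  have n: "norm (cr * w) \<le> r"
    using mult_left_mono[OF w(1), of r] tower.r_pos unfolding norm_mult norm_cr by simp
  show ?thesis
  proof (cases "m = j \<or> m = j - 1")
    case False
    thus ?thesis using tower.rad_notin_nonpos_Reals[OF n m] \<sigma>_pos[of m] by blast
  next
    case True
    then obtain m' where m': "m = Suc m'" using j_ge_2 by (cases m) auto
    have "cr * w \<noteq> cr" using w cr_nz by (metis mult_cancel_left mult_1_right)
    thus ?thesis unfolding m'
      by (intro tower.rad_notin_nonpos_Reals_boundary n) (use True j_less_k m' in auto)
  qed
qed

text \<open>
  For \<open>z = zz s\<close> the radicand \<open>j - 1\<close> is \<open>s\<^sup>4 g s\<close> and the radicand \<open>j\<close> is \<open>s\<^sup>2 h s\<close>, so the \<open>m\<close>-th square root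
  is \<open>s ^ e m * Y m s\<close> with \<open>Y m 0 \<noteq> 0\<close>.
\<close>

definition "zz s = cr * (1 - s ^ 4)"
definition "g s = - cr * rad_quot ca (zz s) cr (j - 1)"
definition "h s = 2 * zz s * csqrt (g s) + cr * s\<^sup>2 * (2 + 4 * ca j * (zz s + cr))"
definition "Y m s = (if m < j - 1 then csqrt (rad ca (zz s) m) else if m = j - 1 then csqrt (g s)
   else if m = j then csqrt (h s) else chain ca (zz s) (s * csqrt (h s)) j (m - j))"
definition "e m = (if m = j - 1 then 2 else if m = j then 1 else (0::nat))"

lemma zz_0 [simp]: "zz 0 = cr"
  by (simp add: zz_def)

lemma nice_zz: "nice_at (\<lambda>s u. zz s) 0 0"
  unfolding zz_def by (intro nice_at_mult nice_at_diff nice_at_const nice_at_power nice_at_fst)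

lemma nice_g: "nice_at (\<lambda>s u. g s) 0 0"
proof -
  have "nice_at (\<lambda>s u. rad_quot ca (zz s) cr (j - 1)) 0 0"
    by (rule nice_at_rad_quot[where Z = "\<lambda>s u. zz s" and Z' = "\<lambda>s u. cr" and a = "\<lambda>u. ca"])
       (use rad_at_r j_less_k in \<open>auto intro: nice_zz simp del: of_real_divide\<close>)
  from nice_at_mult[OF nice_at_const[of "- cr"] this] show ?thesis by (simp only: g_def[abs_def])
qed

lemma g_0: "\<exists>y>0. g 0 = of_real y"
proof -
  obtain D where D: "D < 0" "rad_quot ca cr cr (j - 1) = of_real D"
  proof -
    have s: "ystar m / x > 0" if "m < j - 1" for m using \<sigma>_pos[of m] that by auto
    have "\<exists>d<0. rad_quot ca cr cr (j - 1) = of_real d" by (rule tower.rad_quot_neg[OF _ s]) (use j_less_k in auto)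
    thus thesis using that by blast
  qed
  have "g 0 = of_real (- r * D)" using D(2) by (simp add: g_def)
  moreover have "- r * D > 0" using D(1) tower.r_pos by (intro mult_neg_neg) (simp_all only: neg_less_0_iff_less)
  ultimately show ?thesis by blast
qed

lemma nice_csqrt_g: "nice_at (\<lambda>s u. csqrt (g s)) 0 0"
  by (rule nice_at_csqrt[OF nice_g]) (use g_0 in auto)

lemma nice_h: "nice_at (\<lambda>s u. h s) 0 0"
  unfolding h_def
  by (intro nice_at_add nice_at_mult nice_at_power nice_at_const nice_at_fst nice_zz nice_csqrt_g)

lemma h_0: "\<exists>y>0. h 0 = of_real y"
proof -
  obtain y where y: "y > 0" "g 0 = of_real y" using g_0 by blast
  have "h 0 = of_real (2 * r * sqrt y)" using y by (simp add: h_def)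
  moreover have "2 * r * sqrt y > 0" using y tower.r_pos by simp
  ultimately show ?thesis by blast
qed

lemma nice_csqrt_h: "nice_at (\<lambda>s u. csqrt (h s)) 0 0"
  by (rule nice_at_csqrt[OF nice_h]) (use h_0 in auto)

lemma csqrt_h_0: "csqrt (h 0) \<noteq> 0"
  using h_0 by auto

lemma nice_chain: "j + i \<le> k \<Longrightarrow> nice_at (\<lambda>s u. chain ca (zz s) (s * csqrt (h s)) j i) 0 0"
proof (rule nice_at_chain[where a = "\<lambda>u. ca" and Z = "\<lambda>s u. zz s" and y = "\<lambda>s u. s * csqrt (h s)"])
  show "nice_at (\<lambda>s u. s * csqrt (h s)) 0 0" by (intro nice_at_mult nice_at_fst nice_csqrt_h)
  show "0 * csqrt (h 0) = csqrt (rad ca (zz 0) j)" by (simp only: zz_0 rad_r_j) simp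
  fix m assume "j + i \<le> k" "m < i"
  thus "rad ca (zz 0) (j + Suc m) \<notin> \<real>\<^sub>\<le>\<^sub>0" unfolding zz_0 by (intro rad_at_r) auto
qed (auto intro: nice_zz)

lemma nice_Y:
  assumes "m \<le> k"
  shows "nice_at (\<lambda>s u. Y m s) 0 0"
proof -
  consider "m < j - 1" | "m = j - 1" | "m = j" | "m > j" using j_ge_2 by linarith
  thus ?thesis
  proof cases
    case 1
    have "nice_at (\<lambda>s u. csqrt (rad ca (zz s) m)) 0 0"
      by (intro nice_at_csqrt nice_at_rad[where Z = "\<lambda>s u. zz s" and a = "\<lambda>u. ca"])
         (use rad_at_r 1 assms in \<open>auto intro: nice_zz simp del: of_real_divide\<close>)
    thus ?thesis using 1 by (simp add: Y_def)
  next
    case 2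
    thus ?thesis using nice_csqrt_g by (simp add: Y_def)
  next
    case 3
    have "j \<noteq> j - 1" "\<not> j < j - 1" using j_ge_2 by linarith+
    hence "Y m = (\<lambda>s. csqrt (h s))" unfolding 3 Y_def[abs_def] by (simp only: if_False if_True refl)
    thus ?thesis using nice_csqrt_h by simp
  next
    case 4
    have "\<not> m < j - 1" "m \<noteq> j - 1" "m \<noteq> j" using 4 j_ge_2 by linarith+
    hence "Y m = (\<lambda>s. chain ca (zz s) (s * csqrt (h s)) j (m - j))"
      unfolding Y_def[abs_def] by (simp only: if_False refl)
    thus ?thesis using nice_chain[of "m - j"] 4 assms by simp
  qed
qed

lemma Y_0:
  assumes "m \<le> k"
  shows "Y m 0 \<noteq> 0"
proof -
  consider "m = j - 1" | "m = j" "m \<noteq> j - 1" | "m \<noteq> j" "m \<noteq> j - 1" by linarith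
  thus ?thesis
  proof cases
    case 1
    thus ?thesis using g_0 by (auto simp: Y_def)
  next
    case 2
    thus ?thesis using csqrt_h_0 by (simp add: Y_def)
  next
    case 3
    have "Y m 0 = csqrt (rad ca cr m)"
    proof (cases "m < j - 1")
      case False
      have "0 * csqrt (h 0) = csqrt (rad ca cr j)" by (simp only: rad_r_j) simp
      from chain_eq[OF this, of "m - j"] show ?thesis using False 3 by (simp add: Y_def)
    qed (simp add: Y_def)
    thus ?thesis using rad_at_r[of m] 3 assms by auto
  qed
qed

lemma near:
  "\<exists>\<epsilon>>0. \<forall>w\<in>delta_domain (1/3). norm (root_at 4 w) < \<epsilon> \<longrightarrow>
     (\<forall>m\<le>k. csqrt (rad ca (cr * w) m) = root_at 4 w ^ e m * Y m (root_at 4 w))"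
proof -
  have "\<exists>\<epsilon>>0. \<forall>m<j-1. \<forall>s\<in>ball 0 \<epsilon>. \<forall>u\<in>ball (0::complex) \<epsilon>. rad ca (zz s) m \<in> - \<real>\<^sub>\<le>\<^sub>0"
  proof (rule nice_at_eventually_all)
    fix m assume m: "m < j - 1"
    show "nice_at (\<lambda>s u. rad ca (zz s) m) 0 0"
      by (rule nice_at_rad[where Z = "\<lambda>s u. zz s" and a = "\<lambda>u. ca"])
         (use rad_at_r m j_less_k in \<open>auto intro: nice_zz simp del: of_real_divide\<close>)
    show "rad ca (zz 0) m \<in> - \<real>\<^sub>\<le>\<^sub>0" using rad_at_r[of m] m j_less_k unfolding zz_0 by auto
  qed (auto intro: open_Compl)
  then obtain \<epsilon>1 where \<epsilon>1: "\<epsilon>1 > 0"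
    and \<epsilon>1': "\<forall>m<j-1. \<forall>s\<in>ball 0 \<epsilon>1. \<forall>u\<in>ball (0::complex) \<epsilon>1. rad ca (zz s) m \<in> - \<real>\<^sub>\<le>\<^sub>0" by blast
  have nonpos: "rad ca (zz s) m \<notin> \<real>\<^sub>\<le>\<^sub>0" if "m < j - 1" "s \<in> ball 0 \<epsilon>1" for m s
    using \<epsilon>1'[rule_format, OF that, of 0] \<epsilon>1 by simp
  define V where "V = {g. \<bar>Im g\<bar> < Re g / 2}"
  have V: "open V" unfolding V_def by (intro open_Collect_less continuous_intros) auto
  have "csqrt (g 0) \<in> V" "csqrt (h 0) \<in> V" using g_0 h_0 by (auto simp: V_def)
  obtain \<epsilon>2 where \<epsilon>2: "\<epsilon>2 > 0" "\<And>s u. s \<in> ball 0 \<epsilon>2 \<Longrightarrow> u \<in> ball 0 \<epsilon>2 \<Longrightarrow> csqrt (g s) \<in> V"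
    by (rule nice_at_eventually[OF nice_csqrt_g V \<open>csqrt (g 0) \<in> V\<close>]) blast
  obtain \<epsilon>3 where \<epsilon>3: "\<epsilon>3 > 0" "\<And>s u. s \<in> ball 0 \<epsilon>3 \<Longrightarrow> u \<in> ball 0 \<epsilon>3 \<Longrightarrow> csqrt (h s) \<in> V"
    by (rule nice_at_eventually[OF nice_csqrt_h V \<open>csqrt (h 0) \<in> V\<close>]) blast
  define \<epsilon> where "\<epsilon> = min \<epsilon>1 (min \<epsilon>2 \<epsilon>3)"
  have \<epsilon>: "\<epsilon> > 0" "\<epsilon> \<le> \<epsilon>1" "\<epsilon> \<le> \<epsilon>2" "\<epsilon> \<le> \<epsilon>3" using \<epsilon>1 \<epsilon>2(1) \<epsilon>3(1) by (auto simp: \<epsilon>_def)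
  have "csqrt (rad ca (cr * w) m) = root_at 4 w ^ e m * Y m (root_at 4 w)"
    if w: "w \<in> delta_domain (1/3)" and sm: "norm (root_at 4 w) < \<epsilon>" and m: "m \<le> k" for w m
  proof -
    define s where "s = root_at 4 w"
    have w1: "w \<noteq> 1" using delta_domainD(3)[OF w] by simp
    have s2: "s\<^sup>2 = csqrt (1 - w)" and s_csqrt: "s = csqrt (csqrt (1 - w))"
      using root_at_4[OF w1] unfolding s_def by auto
    have s4: "s ^ 4 = 1 - w"
    proof -
      have "s ^ 4 = (s\<^sup>2)\<^sup>2" by (simp flip: power_mult)
      thus ?thesis by (simp add: s2)
    qed
    have z: "cr * w = zz s" by (simp add: zz_def s4)
    have s0: "s \<noteq> 0" using s4 w1 by auto
    have sb: "s \<in> ball 0 \<epsilon>1" "s \<in> ball 0 \<epsilon>2" "s \<in> ball 0 \<epsilon>3" using sm \<epsilon> by (auto simp: s_def)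
    have gV: "csqrt (g s) \<in> V" using \<epsilon>2(2)[OF sb(2), of 0] \<epsilon>2(1) by simp
    have hV: "csqrt (h s) \<in> V" using \<epsilon>3(2)[OF sb(3), of 0] \<epsilon>3(1) by simp
    have "rad ca (zz s) (j - 1) = rad ca (zz s) (j - 1) - rad ca cr (j - 1)" using rad_r_pred by simp
    also have "\<dots> = (zz s - cr) * rad_quot ca (zz s) cr (j - 1)"
      by (intro rad_diff csqrt_add_nonzero nonpos sb rad_at_r) (use j_less_k in auto)
    also have "\<dots> = (1 - w) * g s"
    proof -
      have "(c * (1 - v) - c) * D = v * (- c * D)" for c v D :: complex by (simp add: algebra_simps)
      from this[of cr "1 - w"] show ?thesis unfolding g_def zz_def s4 .
    qed
    finally have r1: "csqrt (rad ca (zz s) (j - 1)) = s\<^sup>2 * csqrt (g s)"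
      using csqrt_square_mult[OF w, of "g s"] gV by (simp add: V_def s2)
    have jS: "j = Suc (j - 1)" using j_ge_2 by simp
    \<comment> \<open>Both radicands vanish at \<open>cr\<close>, hence so does the polynomial part
      of the radicand j. Nearby that part has order s^4, and the inner root, of order s^2,
      dominates.\<close>
    have poly0: "1 - 2 * cr - 4 * ca j * cr\<^sup>2 = 0"
    proof -
      have "rad ca cr (Suc (j - 1)) = 0" unfolding jS[symmetric] by (rule rad_r_j)
      hence "1 - 2 * cr - 4 * ca (Suc (j - 1)) * cr\<^sup>2 + 2 * cr * csqrt (rad ca cr (j - 1)) = 0"
        by (simp only: rad.simps)
      thus ?thesis unfolding rad_r_pred jS[symmetric]
        by (simp only: csqrt_0 mult_zero_right add_0_right)
    qed
    have alg: "1 - 2 * Z - 4 * A * Z\<^sup>2 + 2 * Z * (S * G) = S * (2 * Z * G + c * S * (2 + 4 * A * (Z + c)))"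
      if "Z = c * (1 - S\<^sup>2)" "1 - 2 * c - 4 * A * c\<^sup>2 = 0" for Z A S G c :: complex
    proof -
      have "1 - 2 * Z - 4 * A * Z\<^sup>2 + 2 * Z * (S * G) =
          (c - Z) * (2 + 4 * A * (Z + c)) + S * (2 * Z * G) + (1 - 2 * c - 4 * A * c\<^sup>2)"
        by (simp add: algebra_simps power2_eq_square)
      also have "c - Z = S * (c * S)" unfolding that(1) by (simp add: algebra_simps power2_eq_square)
      finally show ?thesis unfolding that(2) by (simp add: algebra_simps)
    qed
    have "zz s = cr * (1 - (s\<^sup>2)\<^sup>2)" by (simp add: zz_def flip: power_mult)
    from alg[OF this poly0, of "csqrt (g s)"] rad.simps(2)[of ca "zz s" "j - 1", unfolded r1 jS[symmetric]]
    have r2: "rad ca (zz s) j = s\<^sup>2 * h s" unfolding h_def by (simp only:)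
    have r3: "csqrt (rad ca (zz s) j) = s * csqrt (h s)"
    proof (rule csqrt_unique)
      show "(s * csqrt (h s))\<^sup>2 = rad ca (zz s) j" by (simp only: r2 power_mult_distrib power2_csqrt)
      have "Re (s * csqrt (h s)) > 0"
      proof (rule Re_mult_csqrt_pos)
        have "Re (s\<^sup>2) \<ge> 0" unfolding s2 using csqrt_principal[of "1 - w"] by auto
        moreover have "norm (s\<^sup>2) > 0" using s0 by simp
        ultimately show "Re (s\<^sup>2) > - norm (s\<^sup>2) / 2" by linarith
        show "Re s \<ge> 0" unfolding s_csqrt using csqrt_principal[of "csqrt (1 - w)"] by auto
        show "\<bar>Im (csqrt (h s))\<bar> < Re (csqrt (h s)) / 2" using hV by (simp add: V_def)
      qed
      thus "0 < Re (s * csqrt (h s)) \<or> Re (s * csqrt (h s)) = 0 \<and> 0 \<le> Im (s * csqrt (h s))" by simp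
    qed
    have "csqrt (rad ca (zz s) m) = s ^ e m * Y m s"
    proof -
      consider "m < j - 1" | "m = j - 1" | "m = j" "m \<noteq> j - 1" | "m > j" using j_ge_2 by linarith
      thus ?thesis
      proof cases
        case 3
        have "\<not> j < j - 1" using j_ge_2 by linarith
        hence "Y m s = csqrt (h s)" "e m = 1" using 3 by (simp_all only: Y_def e_def if_False if_True refl)
        thus ?thesis using 3 r3 by (simp only: power_one_right)
      next
        case 4
        from chain_eq[OF r3[symmetric], of "m - j"] show ?thesis using 4 by (simp add: Y_def e_def)
      qed (use r1 r3 in \<open>simp_all add: Y_def e_def\<close>)
    qed
    thus ?thesis by (simp only: z s_def)
  qed
  thus ?thesis using \<epsilon>(1) by blast
qed

lemma nice_boundary:
  assumes "norm w \<le> 1" "w \<noteq> 1" "m \<le> k"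
  shows "nice_at (\<lambda>w u. csqrt (rad ca (cr * w) m)) w 0"
  by (intro nice_at_csqrt nice_at_rad[where Z = "\<lambda>w u. cr * w" and a = "\<lambda>u. ca"])
     (use rad_at_boundary assms in \<open>auto intro!: nice_at_mult simp del: of_real_divide\<close>)

text \<open>\<open>zz\<close> is stationary at 0 and \<open>chain\<close> has a nonzero derivative
  there, so the outermost root has a term of exact order (1 - w)^(1/4); its coefficients have order
  n^(-5/4).\<close>

lemma root_limit:
  obtains c where "c \<noteq> 0" "(\<lambda>n. cr ^ n * fps_nth (root_gf k L 1 0) n * of_real (real n powr (5/4))) \<longlonglongrightarrow> c"
proof -
  obtain \<epsilon> where \<epsilon>: "\<epsilon> > 0" "\<forall>w\<in>delta_domain (1/3). norm (root_at 4 w) < \<epsilon> \<longrightarrow>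
     (\<forall>m\<le>k. csqrt (rad ca (cr * w) m) = root_at 4 w ^ e m * Y m (root_at 4 w))" using near by blast
  have ek: "e k = 0" using j_less_k by (simp add: e_def)
  have A: "(\<lambda>w. csqrt (rad ca (cr * w) k)) has_fps_expansion Abs_fps (\<lambda>n. cr ^ n * fps_nth (root_gf k L 1 0) n)"
    using csqrt_rad_scaled_has_fps_expansion[of k L 1 cr] unfolding wt_1 .
  have "(\<lambda>n. fps_nth (Abs_fps (\<lambda>n. cr ^ n * fps_nth (root_gf k L 1 0) n)) n * of_real (real n powr (1/4 + 1))) \<longlonglongrightarrow>
           (deriv ^^ 1) (\<lambda>s. Y k s) 0 / fact 1 * rGamma (- of_real (1/4))"
  proof (rule coeff_asymptotics[where \<Phi> = "\<lambda>s u. Y k s" and F = "\<lambda>w u. csqrt (rad ca (cr * w) k)" and b = 0 and q = 4 and p = 0])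
    show "csqrt (rad ca (cr * w) k) = Y k (root_at 4 w) / root_at 4 w ^ 0"
      if "w \<in> delta_domain (1/3)" "norm (root_at 4 w) < \<epsilon>" for w
      using \<epsilon>(2) that ek by simp
  qed (use nice_Y[of k] nice_boundary \<epsilon>(1) A in auto)
  hence lim: "(\<lambda>n. cr ^ n * fps_nth (root_gf k L 1 0) n * of_real (real n powr (5/4))) \<longlonglongrightarrow> deriv (Y k) 0 * rGamma (- of_real (1/4))"
    by simp
  have "\<exists>D. D \<noteq> 0 \<and> ((\<lambda>s. chain ca (zz s) (s * csqrt (h s)) j (k - j)) has_field_derivative D) (at 0)"
  proof (rule chain_has_nonzero_derivative)
    show "(zz has_field_derivative 0) (at 0)"
    proof -
      have "((\<lambda>s::complex. 1 - s ^ 4) has_field_derivative 0) (at 0)" by (auto intro!: derivative_eq_intros)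
      from DERIV_cmult[OF this, of cr] show ?thesis unfolding zz_def[abs_def] mult_zero_right .
    qed
    show "zz 0 \<noteq> 0" unfolding zz_0 by (rule cr_nz)
    show "((\<lambda>s. s * csqrt (h s)) has_field_derivative csqrt (h 0)) (at 0)"
      using DERIV_mult[OF DERIV_ident nice_at_deriv_fst[OF nice_csqrt_h]] by simp
    show "0 * csqrt (h 0) = csqrt (rad ca (zz 0) j)" by (simp only: zz_0 rad_r_j) simp
    show "rad ca (zz 0) (j + Suc m) \<notin> \<real>\<^sub>\<le>\<^sub>0" if "m < k - j" for m
      unfolding zz_0 using that by (intro rad_at_r) auto
  qed (rule csqrt_h_0)
  moreover have "Y k = (\<lambda>s. chain ca (zz s) (s * csqrt (h s)) j (k - j))"
    using j_less_k by (auto simp: Y_def fun_eq_iff)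
  ultimately have "deriv (Y k) 0 \<noteq> 0" using DERIV_imp_deriv by metis
  moreover have "rGamma (- of_real (1/4)) \<noteq> (0::complex)"
    using of_real_notin_nonpos_Ints[of "-1" "-1/4"] by (simp add: rGamma_eq_zero_iff)
  ultimately show ?thesis using that[OF _ lim] by simp
qed

text \<open>The order in s to which the denominator of the product formula vanishes.\<close>

definition "p L = (\<Sum>m=k-L..k. e m)"

lemma p_values:
  "L \<le> k \<Longrightarrow> L < k - j \<Longrightarrow> p L = 0" "L = k - j \<Longrightarrow> p L = 1" "L \<le> k \<Longrightarrow> k - j < L \<Longrightarrow> p L = 3"
proof -
  have e_eq: "e m = (if m = j - 1 then 2 else 0) + (if m = j then 1 else 0)" for m
    using j_ge_2 by (auto simp: e_def)
  have p: "p L = (if j - 1 \<in> {k-L..k} then 2 else 0) + (if j \<in> {k-L..k} then 1 else 0)"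
    unfolding p_def e_eq sum.distrib by simp
  show "L \<le> k \<Longrightarrow> L < k - j \<Longrightarrow> p L = 0" unfolding p by auto
  show "L = k - j \<Longrightarrow> p L = 1" unfolding p using j_less_k j_ge_2 by auto
  show "L \<le> k \<Longrightarrow> k - j < L \<Longrightarrow> p L = 3" unfolding p using j_less_k by auto
qed

text \<open>The series is \<Phi>(s) / s^p. For p > 0 its leading exponent is - p/4 with \<Phi>(0)
  nonzero. For p = 0 the constant term affects only the coefficient of index 0, so the next term is
  taken; then just an upper bound is wanted, and nothing is claimed about its constant.\<close>

lemma count_limit:
  assumes L: "L \<le> k"
  defines "m0 \<equiv> (if p L = 0 then 1 else 0)"
  defines "\<beta> \<equiv> (real m0 - real (p L)) / 4"
  obtains c where "(\<lambda>n. cr ^ n * fps_nth (level_count_gf k L 0) n * of_real (real n powr (\<beta> + 1))) \<longlonglongrightarrow> c"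
    "p L > 0 \<Longrightarrow> L > 0 \<Longrightarrow> c \<noteq> 0"
proof -
  obtain \<epsilon> where \<epsilon>: "\<epsilon> > 0" "\<forall>w\<in>delta_domain (1/3). norm (root_at 4 w) < \<epsilon> \<longrightarrow>
     (\<forall>m\<le>k. csqrt (rad ca (cr * w) m) = root_at 4 w ^ e m * Y m (root_at 4 w))" using near by blast
  define F where "F w = of_nat L * (cr * w) ^ Suc L / (\<Prod>m=k-L..k. csqrt (rad ca (cr * w) m))" for w
  define \<Phi> where "\<Phi> s = of_nat L * zz s ^ Suc L / (\<Prod>m=k-L..k. Y m s)" for s
  define A where "A = Abs_fps (\<lambda>n. cr ^ n * fps_nth (level_count_gf k L 0) n)"
  have A: "F has_fps_expansion A"
    using has_fps_expansion_scale[OF level_count_gf_has_fps_expansion[OF L], of cr] unfolding F_def[abs_def] A_def wt_1 .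
  have nP: "nice_at (\<lambda>s u. \<Phi> s) 0 0"
    unfolding \<Phi>_def using Y_0
    by (intro nice_at_divide nice_at_mult nice_at_const nice_at_power nice_zz nice_at_prod nice_Y) auto
  have nF: "nice_at (\<lambda>w u. F w) w 0" if "norm w \<le> 1" "w \<noteq> 1" for w
  proof -
    have "csqrt (rad ca (cr * w) m) \<noteq> 0" if "m \<le> k" for m
      using rad_at_boundary[OF \<open>norm w \<le> 1\<close> \<open>w \<noteq> 1\<close> that] by (metis csqrt_eq_0 nonpos_Reals_zero_I)
    hence "(\<Prod>m=k-L..k. csqrt (rad ca (cr * w) m)) \<noteq> 0"
      by (auto simp only: prod_zero_iff[OF finite_atLeastAtMost] atLeastAtMost_iff)
    thus ?thesis unfolding F_def
      by (intro nice_at_divide nice_at_mult nice_at_const nice_at_power nice_at_fst nice_at_prod nice_boundary that) auto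
  qed
  have lim: "(\<lambda>n. fps_nth A n * of_real (real n powr (\<beta> + 1))) \<longlonglongrightarrow> (deriv ^^ m0) \<Phi> 0 / fact m0 * rGamma (- of_real \<beta>)"
  proof (rule coeff_asymptotics[where \<Phi> = "\<lambda>s u. \<Phi> s" and F = "\<lambda>w u. F w" and b = 0 and q = 4 and p = "p L"])
    fix w u assume w: "w \<in> delta_domain (1/3)" and s: "norm (root_at 4 w) < \<epsilon>"
    define s where "s = root_at 4 w"
    have w1: "w \<noteq> 1" using delta_domainD(3)[OF w] by simp
    have s2: "s\<^sup>2 = csqrt (1 - w)" using root_at_4[OF w1] by (simp only: s_def)
    have "s ^ 4 = (s\<^sup>2)\<^sup>2" by (simp flip: power_mult)
    hence "s ^ 4 = 1 - w" by (simp only: s2 power2_csqrt)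
    hence z: "cr * w = zz s" by (simp add: zz_def)
    have "(\<Prod>m=k-L..k. csqrt (rad ca (cr * w) m)) = (\<Prod>m=k-L..k. s ^ e m * Y m s)"
      using \<epsilon>(2) w s by (intro prod.cong) (auto simp: s_def)
    also have "\<dots> = s ^ p L * (\<Prod>m=k-L..k. Y m s)" by (simp add: prod.distrib p_def power_sum)
    finally show "F w = \<Phi> (root_at 4 w) / root_at 4 w ^ p L"
      unfolding F_def \<Phi>_def s_def[symmetric] z by simp
  next
    show "m0 < p L + 4" by (simp add: m0_def)
    show "(real m - real (p L)) / real 4 \<in> \<nat>" if "m < m0" for m using that by (auto simp: m0_def split: if_splits)
    show "\<beta> = (real m0 - real (p L)) / real 4" by (simp add: \<beta>_def)
  qed (use nP nF \<epsilon>(1) A in \<open>auto simp: m0_def \<beta>_def split: if_splits\<close>)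
  show ?thesis
  proof (rule that)
    show "(\<lambda>n. cr ^ n * fps_nth (level_count_gf k L 0) n * of_real (real n powr (\<beta> + 1))) \<longlonglongrightarrow>
        (deriv ^^ m0) \<Phi> 0 / fact m0 * rGamma (- of_real \<beta>)" using lim by (simp add: A_def)
    assume pL: "p L > 0" and L0: "L > 0"
    have "\<Phi> 0 \<noteq> 0" using L0 cr_nz Y_0 by (auto simp: \<Phi>_def)
    moreover have "rGamma (- of_real \<beta>) \<noteq> (0::complex)"
    proof -
      have "p L = 1 \<or> p L = 3"
        using p_values[of L] L pL by (cases "L < k - j"; cases "L = k - j") auto
      hence "- \<beta> = 1/4 \<or> - \<beta> = 3/4" using pL by (auto simp: \<beta>_def m0_def)
      hence "complex_of_real (- \<beta>) \<notin> \<int>\<^sub>\<le>\<^sub>0" using of_real_notin_nonpos_Ints[of 0 "- \<beta>"] by auto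
      thus ?thesis by (simp add: rGamma_eq_zero_iff)
    qed
    ultimately show "(deriv ^^ m0) \<Phi> 0 / fact m0 * rGamma (- of_real \<beta>) \<noteq> 0" using pL by (simp add: m0_def)
  qed
qed

text \<open>Quotient of the orders n^(-\<beta>-1) for the leaves and n^(-5/4) for the terms, which
  gives \<gamma> = 1/4 - \<beta>: the exponents 0, 1/2 and 1 for p = 0, 1 and 3.\<close>

lemma mean_limit:
  assumes L: "L \<le> k"
  defines "\<gamma> \<equiv> (if p L = 0 then 0 else (1 + real (p L)) / 4)"
  obtains c where "(\<lambda>n. mean_leaves k L n / real n powr \<gamma>) \<longlonglongrightarrow> c" "p L > 0 \<Longrightarrow> L > 0 \<Longrightarrow> c \<noteq> 0"
proof -
  define m0 where "m0 = (if p L = 0 then 1 else 0 :: nat)"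
  define \<beta> where "\<beta> = (real m0 - real (p L)) / 4"
  have \<gamma>: "\<gamma> = 1/4 - \<beta>" by (auto simp: \<gamma>_def \<beta>_def m0_def field_simps)
  obtain cM where cM: "(\<lambda>n. cr ^ n * fps_nth (level_count_gf k L 0) n * of_real (real n powr (\<beta> + 1))) \<longlonglongrightarrow> cM"
    "p L > 0 \<Longrightarrow> L > 0 \<Longrightarrow> cM \<noteq> 0"
    using count_limit[OF L] unfolding \<beta>_def m0_def by blast
  obtain cZ where cZ: "cZ \<noteq> 0" "(\<lambda>n. cr ^ n * fps_nth (root_gf k L 1 0) n * of_real (real n powr (5/4))) \<longlonglongrightarrow> cZ"
    by (rule root_limit)
  define M where "M n = cr ^ n * fps_nth (level_count_gf k L 0) n * of_real (real n powr (\<beta> + 1))" for n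
  define Z where "Z n = cr ^ n * fps_nth (root_gf k L 1 0) n * of_real (real n powr (5/4))" for n
  have Zlim: "(\<lambda>n. norm (Z (Suc n))) \<longlonglongrightarrow> norm cZ"
    using tendsto_norm[OF cZ(2)] unfolding Z_def[symmetric] by (rule LIMSEQ_Suc)
  have Mlim: "(\<lambda>n. norm (M n)) \<longlonglongrightarrow> norm cM" using tendsto_norm[OF cM(1)] unfolding M_def[symmetric] .
  have "(\<lambda>n. ((real n + 1) / real n) powr (5/4)) \<longlonglongrightarrow> 1" by real_asymp
  hence "(\<lambda>n. 2 * r * (norm (M n) / norm (Z (Suc n))) * ((real n + 1) / real n) powr (5/4)) \<longlonglongrightarrow> 2 * r * (norm cM / norm cZ) * 1"
    by (intro tendsto_mult tendsto_divide tendsto_const Mlim Zlim) (use cZ in auto)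
  moreover have "eventually (\<lambda>n. 2 * r * (norm (M n) / norm (Z (Suc n))) * ((real n + 1) / real n) powr (5/4)
      = mean_leaves k L n / real n powr \<gamma>) sequentially"
  proof -
    have "eventually (\<lambda>n. norm (Z (Suc n)) > 0) sequentially"
      using cZ(1) by (intro order_tendstoD(1)[OF Zlim]) simp
    thus ?thesis using eventually_gt_at_top[of 0]
    proof eventually_elim
      case (elim n)
      define S where "S = (\<Sum>s\<in>terms_at k 0 n. real (leaves_at L s))"
      define C where "C = real (card (terms_at k 0 n))"
      have "fps_nth (level_count_gf k L 0) n = of_real S" by (simp add: level_count_gf_def S_def leaves_at_def)
      moreover have "S \<ge> 0" by (simp add: S_def sum_nonneg)
      ultimately have nM: "norm (M n) = r ^ n * S * real n powr (\<beta> + 1)"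
        unfolding M_def norm_mult norm_power norm_cr by simp
      have "fps_nth (root_gf k L 1 0) (Suc n) = of_real (- 2 * C)"
        by (simp add: root_gf_nth_Suc level_gf_def C_def)
      moreover have "C \<ge> 0" by (simp add: C_def)
      ultimately have nZ: "norm (Z (Suc n)) = r ^ Suc n * (2 * C) * real (Suc n) powr (5/4)"
        unfolding Z_def norm_mult norm_power norm_cr by (simp del: power_Suc)
      have C0: "C > 0" using elim(1) \<open>C \<ge> 0\<close> unfolding nZ by (cases "C = 0") auto
      hence "terms_at k 0 n \<noteq> {}" by (auto simp: C_def)
      hence mean: "mean_leaves k L n = S / C" by (simp add: mean_leaves_eq S_def C_def)
      define R where "R = r ^ n"
      have R: "R > 0" using tower.r_pos by (simp only: R_def zero_less_power)
      have n0: "real n > 0" using elim(2) by simp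
      have e1: "((real n + 1) / real n) powr (5/4) = real (Suc n) powr (5/4) / real n powr (5/4)"
        using n0 by (simp add: powr_divide add.commute)
      have e2: "real n powr (\<beta> + 1) / real n powr (5/4) = 1 / real n powr \<gamma>"
      proof -
        have "real n powr (\<beta> + 1) / real n powr (5/4) = real n powr (\<beta> + 1 - 5/4)" by (rule powr_diff[symmetric])
        also have "\<beta> + 1 - 5/4 = - \<gamma>" by (simp add: \<gamma>)
        finally show ?thesis by (simp add: powr_minus_divide)
      qed
      have "2 * r * (norm (M n) / norm (Z (Suc n))) * ((real n + 1) / real n) powr (5/4) =
          2 * r * (R * S * real n powr (\<beta> + 1) / (r * R * (2 * C) * real (Suc n) powr (5/4))) * (real (Suc n) powr (5/4) / real n powr (5/4))"
        unfolding nM nZ e1 by (simp only: R_def power_Suc)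
      also have "\<dots> = S / C * (real n powr (\<beta> + 1) / real n powr (5/4))"
      proof -
        have "2 * q * (R * S * a / (q * R * (2 * C) * b)) * (b / d) = S / C * (a / d)" if "q > 0" "b > 0" for q a b d :: real
          using that R C0 by (simp add: field_simps)
        from this[OF tower.r_pos] show ?thesis by simp
      qed
      also have "\<dots> = mean_leaves k L n / real n powr \<gamma>" unfolding e2 mean by simp
      finally show ?case .
    qed
  qed
  ultimately have "(\<lambda>n. mean_leaves k L n / real n powr \<gamma>) \<longlonglongrightarrow> 2 * r * (norm cM / norm cZ) * 1"
    by (rule Lim_transform_eventually)
  thus ?thesis by (rule that) (use cM(2) cZ(1) tower.r_pos x_ge_1 in auto)
qed

lemma mean_leaves_quartic:
  assumes L: "L \<le> k"
  shows "L < k - j \<Longrightarrow> mean_leaves k L \<in> O(\<lambda>n. 1)"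
    "L = k - j \<Longrightarrow> mean_leaves k L \<in> \<Theta>(\<lambda>n. sqrt (real n))"
    "k - j < L \<Longrightarrow> mean_leaves k L \<in> \<Theta>(\<lambda>n. real n)"
proof -
  obtain c where c: "(\<lambda>n. mean_leaves k L n / real n powr (if p L = 0 then 0 else (1 + real (p L)) / 4)) \<longlonglongrightarrow> c"
    "p L > 0 \<Longrightarrow> L > 0 \<Longrightarrow> c \<noteq> 0"
    using mean_limit[OF L] by blast
  have theta: "mean_leaves k L \<in> \<Theta>(g)"
    if "p L > 0" "L > 0" "\<And>n. n > 0 \<Longrightarrow> real n powr ((1 + real (p L)) / 4) = g n" "\<And>n. n > 0 \<Longrightarrow> g n \<noteq> 0" for g
  proof (rule bigthetaI_tendsto)
    show "c \<noteq> 0" using c(2) that by blast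
    show "((\<lambda>n. mean_leaves k L n / g n) \<longlongrightarrow> c) at_top"
      by (intro Lim_transform_eventually[OF c(1)] eventually_mono[OF eventually_gt_at_top[of 0]])
         (use that in auto)
  qed
  show "mean_leaves k L \<in> O(\<lambda>n. 1)" if "L < k - j"
  proof (rule bigoI_tendsto)
    have "p L = 0" using p_values(1)[OF L that] .
    thus "((\<lambda>n. mean_leaves k L n / 1) \<longlongrightarrow> c) at_top"
      by (intro Lim_transform_eventually[OF c(1)] eventually_mono[OF eventually_gt_at_top[of 0]]) auto
  qed auto
  show "mean_leaves k L \<in> \<Theta>(\<lambda>n. sqrt (real n))" if "L = k - j"
  proof -
    have "p L = 1" using p_values(2)[OF that] .
    thus ?thesis using that j_less_k by (intro theta) (auto simp: powr_half_sqrt)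
  qed
  show "mean_leaves k L \<in> \<Theta>(\<lambda>n. real n)" if "k - j < L"
  proof -
    have "p L = 3" using p_values(3)[OF L that] .
    thus ?thesis using that by (intro theta) auto
  qed
qed

end

subsection \<open>The theorem\<close>

lemma leaves_at_from_le_size: "leaves_at_from L l t \<le> term_size t"
  by (induction t arbitrary: l) (auto intro: add_mono le_SucI)

text \<open>At the last level no abstraction is possible, so the tree is binary.\<close>

lemma size_level_1: "\<forall>m\<in>node_levels 1 t. m \<le> 1 \<Longrightarrow> Suc (term_size t) \<le> 2 * leaves_at_from 1 1 t"
proof (induction t)
  case (Abs t)
  thus ?case using root_level_in_node_levels[of 2 t] by (auto simp: numeral_2_eq_2)
qed auto

text \<open>A closed term of this kind consists of abstracted binary trees joined by applications. A
  block with m leaves has 2 m nodes, and there is one application fewer than blocks, of which there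
  are at most as many as leaves.\<close>

lemma size_level_0:
  "closed_at 0 t \<Longrightarrow> \<forall>m\<in>node_levels 0 t. m \<le> 1 \<Longrightarrow> Suc (term_size t) \<le> 3 * leaves_at_from 1 0 t"
proof (induction t)
  case (Abs t)
  thus ?case using size_level_1[of t] by auto
qed auto

text \<open>Even sizes are realised by an abstraction over a comb of applications; applying the
  identity to such a term adds 3 and yields the odd sizes.\<close>

lemma terms_at_1_nonempty:
  assumes "n \<ge> 4"
  shows "terms_at 1 0 n \<noteq> {}"
proof -
  have lev1: "\<exists>t. t \<in> terms_at 1 1 (Suc (2 * m))" for m
  proof (induction m)
    case 0
    have "Var 1 \<in> terms_at 1 1 (Suc (2 * 0))" by (simp add: terms_at_def)
    thus ?case by blast
  next
    case (Suc m)
    then obtain t where "t \<in> terms_at 1 1 (Suc (2 * m))" by blast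
    hence "App (Var 1) t \<in> terms_at 1 1 (Suc (2 * Suc m))" by (auto simp: terms_at_def)
    thus ?case by blast
  qed
  have even: "\<exists>t. t \<in> terms_at 1 0 (2 * Suc m)" for m
  proof -
    obtain t where "t \<in> terms_at 1 1 (Suc (2 * m))" using lev1 by blast
    hence "Abs t \<in> terms_at 1 0 (2 * Suc m)" by (auto simp: terms_at_def)
    thus ?thesis by blast
  qed
  have "\<exists>m. n = 2 * Suc m \<or> n = 3 + 2 * Suc m" using assms by presburger
  then obtain m where "n = 2 * Suc m \<or> n = 3 + 2 * Suc m" by blast
  thus ?thesis
  proof
    assume "n = 2 * Suc m"
    thus ?thesis using even[of m] by auto
  next
    assume n: "n = 3 + 2 * Suc m"
    obtain t where "t \<in> terms_at 1 0 (2 * Suc m)" using even by blast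
    hence "App (Abs (Var 1)) t \<in> terms_at 1 0 n" unfolding n by (auto simp: terms_at_def)
    thus ?thesis by blast
  qed
qed

lemma mean_leaves_1: "mean_leaves 1 1 \<in> \<Theta>(\<lambda>n. real n)"
proof (rule bigthetaI')
  have "real n / 3 \<le> mean_leaves 1 1 n \<and> mean_leaves 1 1 n \<le> real n" if n: "n \<ge> 4" for n
  proof -
    let ?T = "terms_at 1 0 n"
    have ne: "?T \<noteq> {}" by (rule terms_at_1_nonempty[OF n])
    hence card: "real (card ?T) > 0" by (simp add: card_gt_0_iff)
    have b: "real n / 3 \<le> real (leaves_at 1 s)" "real (leaves_at 1 s) \<le> real n" if "s \<in> ?T" for s
      using size_level_0[of s] leaves_at_from_le_size[of 1 0 s] that by (auto simp: terms_at_def leaves_at_def)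
    have "(\<Sum>s\<in>?T. real n / 3) \<le> (\<Sum>s\<in>?T. real (leaves_at 1 s))" by (intro sum_mono b)
    moreover have "(\<Sum>s\<in>?T. real (leaves_at 1 s)) \<le> (\<Sum>s\<in>?T. real n)" by (intro sum_mono b)
    ultimately show ?thesis unfolding mean_leaves_eq[OF ne] using card by (simp add: field_simps)
  qed
  thus "eventually (\<lambda>n. 1/3 * norm (real n) \<le> norm (mean_leaves 1 1 n) \<and> norm (mean_leaves 1 1 n) \<le> 1 * norm (real n)) at_top"
    by (intro eventually_mono[OF eventually_ge_at_top[of 4]]) force
qed auto

lemma N_seq_1: "N_seq 1 = 1"
  by (simp add: N_seq_def)

text \<open>Places k = N_j in the range required by \<open>N_seq_decomposition\<close>. Consecutive
  values b \<ge> a of \<open>u_seq\<close> with b \<ge> 1 satisfy b^2 - b \<ge> a^2 - a, and the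
  summand j makes the increase strict.\<close>

lemma N_seq_less_Suc: "N_seq j < N_seq (Suc j)"
proof -
  define a where "a = real (u_seq j)"
  define b where "b = real (u_seq (Suc j))"
  have b: "b = a\<^sup>2 + real j + 1" by (simp add: a_def b_def)
  have a0: "a \<ge> 0" by (simp add: a_def)
  have "0 \<le> a * (a\<^sup>2 - a)"
  proof -
    have "a = 0 \<or> a \<ge> 1" unfolding a_def by (cases "u_seq j") auto
    hence "a\<^sup>2 - a \<ge> 0" by (auto simp: power2_eq_square)
    thus ?thesis using a0 by simp
  qed
  have "b \<ge> a"
  proof -
    have "a\<^sup>2 + 1 - a = (a - 1/2)\<^sup>2 + 3/4" by (simp add: power2_eq_square algebra_simps)
    hence "a\<^sup>2 + 1 - a \<ge> 0" by (metis add_nonneg_nonneg zero_le_power2 divide_nonneg_nonneg zero_le_numeral)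
    thus ?thesis unfolding b by simp
  qed
  moreover have "b \<ge> 1" unfolding b by simp
  ultimately have "b\<^sup>2 - b \<ge> a\<^sup>2 - a"
  proof -
    have "(b\<^sup>2 - b) - (a\<^sup>2 - a) = (b - a) * (b + a - 1)" by (simp add: power2_eq_square algebra_simps)
    also have "\<dots> \<ge> 0" using \<open>b \<ge> a\<close> \<open>b \<ge> 1\<close> a0 by simp
    finally show ?thesis by simp
  qed
  hence "real (N_seq j) < real (N_seq (Suc j))" unfolding of_nat_N_seq a_def b_def by simp
  thus ?thesis by simp
qed

theorem theorem2p7:
  fixes k :: nat
  assumes "k \<ge> 1"
  shows
    "(\<forall>j. N_seq j < k \<and> k < N_seq (Suc j) \<longrightarrow>
        (\<forall>L\<in>{0..<k - j}. mean_leaves k L \<in> O(\<lambda>n. 1)) \<and>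
        (\<forall>L\<in>{k - j..k}. mean_leaves k L \<in> \<Theta>(\<lambda>n. real n)) \<and>
        (\<forall>L\<in>{k - j..k}.
           deriv (deriv (B_tilde k L)) 1 + deriv (B_tilde k L) 1 - (deriv (B_tilde k L) 1)\<^sup>2 \<noteq> 0 \<longrightarrow>
           leaves_asymp_normal k L \<and>
           proportional_to_n (mean_leaves k L) \<and> proportional_to_n (var_leaves k L)))
     \<and>
     (\<forall>j. k = N_seq j \<longrightarrow>
        (\<forall>L\<in>{0..<k - j}. mean_leaves k L \<in> O(\<lambda>n. 1)) \<and>
        (k - j \<ge> 1 \<longrightarrow> mean_leaves k (k - j) \<in> \<Theta>(\<lambda>n. sqrt (real n))) \<and>
        (\<forall>L\<in>{k - j + 1..k}. mean_leaves k L \<in> \<Theta>(\<lambda>n. real n)) \<and>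
        (\<forall>L\<in>{k - j + 1..k}.
           twice_differentiable_at (B_tilde k L) 1 \<and>
           deriv (deriv (B_tilde k L)) 1 + deriv (B_tilde k L) 1 - (deriv (B_tilde k L) 1)\<^sup>2 \<noteq> 0 \<longrightarrow>
           leaves_asymp_normal k L \<and>
           proportional_to_n (mean_leaves k L) \<and> proportional_to_n (var_leaves k L)))"
proof (intro conjI allI impI)
  fix j assume j: "N_seq j < k \<and> k < N_seq (Suc j)"
  obtain t where tt: "0 \<le> t" "t < 1" "real k = (pseq t (Suc j))\<^sup>2 - pseq t (Suc j) + real j + t"
    "t = 0 \<longleftrightarrow> k = N_seq j"
    using N_seq_decomposition[of j k] j by auto
  have j1: "j \<ge> 1"
  proof (rule ccontr)
    assume "\<not> j \<ge> 1"
    hence "j = 0" by simp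
    thus False using j N_seq_1 by simp
  qed
  interpret decomposition k j t "pseq t (Suc j)"
    by unfold_locales (use assms j1 le_N_seq[of j] j tt in auto)
  have "k \<noteq> N_seq j" using j by linarith
  hence t0: "t > 0" using tt(1,4) by (metis less_eq_real_def)
  show "\<forall>L\<in>{0..<k - j}. mean_leaves k L \<in> O(\<lambda>n. 1)"
    using mean_leaves_bounded_sqrt[OF t0] by auto
  show "\<forall>L\<in>{k - j..k}. mean_leaves k L \<in> \<Theta>(\<lambda>n. real n)"
    using leaves_linear_sqrt(1)[OF t0] proportional_to_n_imp_bigtheta by auto
  show "\<forall>L\<in>{k - j..k}.
           deriv (deriv (B_tilde k L)) 1 + deriv (B_tilde k L) 1 - (deriv (B_tilde k L) 1)\<^sup>2 \<noteq> 0 \<longrightarrow>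
           leaves_asymp_normal k L \<and>
           proportional_to_n (mean_leaves k L) \<and> proportional_to_n (var_leaves k L)"
    using leaves_linear_sqrt[OF t0] by auto
next
  fix j assume j: "k = N_seq j"
  obtain t where tt: "0 \<le> t" "t < 1" "real k = (pseq t (Suc j))\<^sup>2 - pseq t (Suc j) + real j + t"
    "t = 0 \<longleftrightarrow> k = N_seq j"
    using N_seq_decomposition[of j k] j N_seq_less_Suc[of j] by auto
  have j1: "j \<ge> 1" using j assms by (cases j) (auto simp: N_seq_def)
  interpret decomposition k j t "pseq t (Suc j)"
    by unfold_locales (use assms j1 le_N_seq[of j] j tt in auto)
  have t0: "t = 0" using tt(4) j by blast
  have quartic: "quartic_case k j t (pseq t (Suc j))" if "j \<noteq> 1"
    by unfold_locales (use t0 j1 that in auto)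
  \<comment> \<open>With k = j = 1 the first range of levels is empty and k - j \<ge> 1 fails, so
    only the mean at level 1 is left to be estimated by counting.\<close>
  have one: "k = 1" if "j = 1" using j that N_seq_1 by simp
  show "\<forall>L\<in>{0..<k - j}. mean_leaves k L \<in> O(\<lambda>n. 1)"
  proof (cases "j = 1")
    case False
    thus ?thesis using quartic_case.mean_leaves_quartic(1)[OF quartic] by auto
  qed (use one in auto)
  show "mean_leaves k (k - j) \<in> \<Theta>(\<lambda>n. sqrt (real n))" if "k - j \<ge> 1"
  proof (cases "j = 1")
    case False
    thus ?thesis using quartic_case.mean_leaves_quartic(2)[OF quartic, of "k - j"] by auto
  qed (use one that in auto)
  show "\<forall>L\<in>{k - j + 1..k}. mean_leaves k L \<in> \<Theta>(\<lambda>n. real n)"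
  proof (cases "j = 1")
    case True
    show ?thesis
    proof
      fix L assume "L \<in> {k - j + 1..k}"
      hence "L = 1" using True one by auto
      thus "mean_leaves k L \<in> \<Theta>(\<lambda>n. real n)" using mean_leaves_1 one[OF True] by simp
    qed
  next
    case False
    thus ?thesis using quartic_case.mean_leaves_quartic(3)[OF quartic] by auto
  qed
  show "\<forall>L\<in>{k - j + 1..k}.
           twice_differentiable_at (B_tilde k L) 1 \<and>
           deriv (deriv (B_tilde k L)) 1 + deriv (B_tilde k L) 1 - (deriv (B_tilde k L) 1)\<^sup>2 \<noteq> 0 \<longrightarrow>
           leaves_asymp_normal k L \<and>
           proportional_to_n (mean_leaves k L) \<and> proportional_to_n (var_leaves k L)"
    using not_twice_differentiable_B_tilde[OF t0] by auto
qed

end
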